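(* Let $\alpha\in(0,1)$, $\tau>0$, $d\ge 1$, let $A\in\mathbb{R}^{d\times d}$, and let $g:\mathbb{R}^d\times\mathbb{R}^d\to\mathbb{R}^d$ be a function such that (1) $g(0,0)=0$; (2) $g$ is Lipschitz continuous in a neighborhood of the origin and $\lim_{\varrho\to 0}\ell_g(\varrho)=0$, where $$\ell_g(\varrho):=\sup_{\substack{x,y,\hat x,\hat y\in B_{\mathbb{R}^d}(0,\varrho)\\ (x,y)\ne(\hat x,\hat y)}}\frac{\|g(x,y)-g(\hat x,\hat y)\|}{\|x-\hat x\|+\|y-\hat y\|}.$$ Assume that every (complex) eigenvalue of $A$ lies in $$\mathcal{S}_{\alpha,\tau}:=\left\{\lambda\in\mathbb{C}\setminus\{0\}:\ |\lambda|<\left(\frac{|\arg(\lambda)|-\alpha\pi/2}{\tau}\right)^{\alpha},\ \frac{\alpha\pi}{2}<|\arg(\lambda)|\le\pi\right\}.$$ Then the trivial solution of the delay Caputo fractional differential equation $${}^{C}D^{\alpha}_{0+}x(t)=Ax(t-\tau)+g(x(t),x(t-\tau)),\quad t\in[0,\infty),$$ with initial condition $x(t)=\phi(t)$ for $t\in[-\tau,0]$, $\phi\in C([-\tau,0];\mathbb{R}^d)$, is asymptotically stable.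
   Context: $\|\cdot\|$ is a norm on $\mathbb{R}^d$, $B_{\mathbb{R}^d}(0,\varrho)$ is the ball of radius $\varrho$ centered at the origin, $\|\phi\|_\infty:=\sup_{t\in[-\tau,0]}\|\phi(t)\|$ for $\phi\in C([-\tau,0];\mathbb{R}^d)$, and $\arg$ takes values in $(-\pi,\pi]$. Solution: ${}^{C}D^\alpha_{0+}$ is the Caputo fractional derivative of order $\alpha$ (for absolutely continuous $x$, $({}^{C}D^\alpha_{0+}x)(t)=\frac{1}{\Gamma(1-\alpha)}\int_0^t(t-s)^{-\alpha}x'(s)\,ds$, componentwise). For $T>0$, a solution on $[-\tau,T]$ of the initial value problem with data $\phi$ is a continuous function $x:[-\tau,T]\to\mathbb{R}^d$ with $x(t)=\phi(t)$ on $[-\tau,0]$ satisfying the equation on $(0,T]$, understood in the equivalent integral form $$x(t)=\phi(0)+\frac{1}{\Gamma(\alpha)}\int_0^t(t-s)^{\alpha-1}\big[Ax(s-\tau)+g(x(s),x(s-\tau))\big]ds,\quad t\in[0,T].$$ The solution with initial function $\phi$ is denoted by $\varphi(\cdot,\phi)$, and $[-\tau,t_{\max}(\phi))$, $0<t_{\max}(\phi)\le\infty$, denotes its maximal interval of existence. Stability: the trivial solution is called stable if for every $\varepsilon>0$ there is $\delta>0$ such that for every $\phi$ with $\|\phi\|_\infty\le\delta$ one has $t_{\max}(\phi)=\infty$ and $\|\varphi(t,\phi)\|\le\varepsilon$ for all $t\ge0$. It is called asymptotically stable if it is stable and there is $\hat\delta>0$ such that $\lim_{t\to\infty}\varphi(t,\phi)=0$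 whenever $\|\phi\|_\infty\le\hat\delta$. *)

theory Defs
  imports "HOL-Analysis.Analysis"
begin

definition is_norm :: "('a::real_vector \<Rightarrow> real) \<Rightarrow> bool" where
  "is_norm N \<longleftrightarrow>
     (\<forall>x. 0 \<le> N x) \<and>
     (\<forall>x. N x = 0 \<longleftrightarrow> x = 0) \<and>
     (\<forall>c x. N (c *\<^sub>R x) = \<bar>c\<bar> * N x) \<and>
     (\<forall>x y. N (x + y) \<le> N x + N y)"

definition complex_eigenvalue :: "real ^ 'd ^ 'd \<Rightarrow> complex \<Rightarrow> bool" where
  "complex_eigenvalue A z \<longleftrightarrow>
     (\<exists>v :: complex ^ 'd. v \<noteq> 0 \<and> map_matrix complex_of_real A *v v = z *s v)"

definition stability_region :: "real \<Rightarrow> real \<Rightarrow> complex set" where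
  "stability_region \<alpha> \<tau> =
     {z. z \<noteq> 0 \<and>
         cmod z < ((\<bar>Arg z\<bar> - \<alpha> * pi / 2) / \<tau>) powr \<alpha> \<and>
         \<alpha> * pi / 2 < \<bar>Arg z\<bar> \<and> \<bar>Arg z\<bar> \<le> pi}"

definition lipschitz_near_origin ::
    "('a::real_vector \<Rightarrow> real) \<Rightarrow> ('a \<Rightarrow> 'a \<Rightarrow> 'a) \<Rightarrow> bool" where
  "lipschitz_near_origin N g \<longleftrightarrow>
     (\<exists>r>0. \<exists>L. \<forall>x y x' y'.
        N x < r \<longrightarrow> N y < r \<longrightarrow> N x' < r \<longrightarrow> N y' < r \<longrightarrow>
        N (g x y - g x' y') \<le> L * (N (x - x') + N (y - y')))"

text \<open>The supremum is taken in the extended reals, so that it is \<open>\<infinity>\<close> when \<open>g\<close> is not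
  Lipschitz on the ball of radius \<open>r\<close>.\<close>

definition lipschitz_modulus ::
    "('a::real_vector \<Rightarrow> real) \<Rightarrow> ('a \<Rightarrow> 'a \<Rightarrow> 'a) \<Rightarrow> real \<Rightarrow> ereal" where
  "lipschitz_modulus N g r =
     Sup {ereal (N (g x y - g x' y') / (N (x - x') + N (y - y'))) | x y x' y'.
            N x < r \<and> N y < r \<and> N x' < r \<and> N y' < r \<and> (x, y) \<noteq> (x', y')}"

definition sup_norm :: "('a \<Rightarrow> real) \<Rightarrow> real \<Rightarrow> (real \<Rightarrow> 'a) \<Rightarrow> real" where
  "sup_norm N \<tau> \<phi> = (SUP t\<in>{-\<tau>..0}. N (\<phi> t))"

text \<open>Solution on \<open>[-\<tau>, T]\<close>, in integral form, of the Caputo equation of order \<open>\<alpha>\<close> with right-hand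
  side \<open>A x(t - \<tau>) + g (x t) (x (t - \<tau>))\<close>. Integrability is required explicitly because
  the function \<open>g\<close> is arbitrary away from the origin and \<open>integral\<close> is \<open>0\<close> on
  non-integrable functions. Values of \<open>x\<close> outside \<open>[-\<tau>, T]\<close> are irrelevant.\<close>

definition solution_on ::
    "real \<Rightarrow> real \<Rightarrow> real ^ 'd ^ 'd \<Rightarrow> (real ^ 'd \<Rightarrow> real ^ 'd \<Rightarrow> real ^ 'd) \<Rightarrow>
     (real \<Rightarrow> real ^ 'd) \<Rightarrow> real \<Rightarrow> (real \<Rightarrow> real ^ 'd) \<Rightarrow> bool" where
  "solution_on \<alpha> \<tau> A g \<phi> T x \<longleftrightarrow>
     continuous_on {-\<tau>..T} x \<and>
     (\<forall>t\<in>{-\<tau>..0}. x t = \<phi> t) \<and>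
     (\<forall>t\<in>{0..T}.
        (\<lambda>s. (t - s) powr (\<alpha> - 1) *\<^sub>R (A *v x (s - \<tau>) + g (x s) (x (s - \<tau>))))
          absolutely_integrable_on {0..t} \<and>
        x t = \<phi> 0 + (1 / Gamma \<alpha>) *\<^sub>R
          integral {0..t}
            (\<lambda>s. (t - s) powr (\<alpha> - 1) *\<^sub>R (A *v x (s - \<tau>) + g (x s) (x (s - \<tau>)))))"

text \<open>\<open>x\<close> is \<^emph>\<open>the\<close> solution with initial function \<open>\<phi>\<close> and \<open>[-\<tau>, tm)\<close> its maximal interval of
  existence: every solution lives on a strictly smaller interval and is a restriction of \<open>x\<close>.\<close>

definition maximal_solution ::
    "real \<Rightarrow> real \<Rightarrow> real ^ 'd ^ 'd \<Rightarrow> (real ^ 'd \<Rightarrow> real ^ 'd \<Rightarrow> real ^ 'd) \<Rightarrow>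
     (real \<Rightarrow> real ^ 'd) \<Rightarrow> ereal \<Rightarrow> (real \<Rightarrow> real ^ 'd) \<Rightarrow> bool" where
  "maximal_solution \<alpha> \<tau> A g \<phi> tm x \<longleftrightarrow>
     0 < tm \<and>
     (\<forall>T>0. ereal T < tm \<longrightarrow> solution_on \<alpha> \<tau> A g \<phi> T x) \<and>
     (\<forall>T>0. \<forall>y. solution_on \<alpha> \<tau> A g \<phi> T y \<longrightarrow>
        ereal T < tm \<and> (\<forall>t\<in>{-\<tau>..T}. y t = x t))"

lemma maximal_solution_unique:
  assumes x: "maximal_solution \<alpha> \<tau> A g \<phi> tm x"
    and y: "maximal_solution \<alpha> \<tau> A g \<phi> tm' y"
  shows "tm = tm'" and "\<And>t. -\<tau> \<le> t \<Longrightarrow> ereal t < tm \<Longrightarrow> x t = y t"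
proof -
  have le: "a \<le> b"
    if "maximal_solution \<alpha> \<tau> A g \<phi> a u" "maximal_solution \<alpha> \<tau> A g \<phi> b v" for a b u v
  proof (rule ccontr)
    assume "\<not> a \<le> b"
    then obtain T where T: "b < ereal T" "ereal T < a"
      using ereal_dense2[of b a] by (auto simp: not_le)
    have "0 < b" using that(2) by (simp add: maximal_solution_def)
    with T(1) have "0 < T" using less_trans by fastforce
    then show False
      using T that unfolding maximal_solution_def by (meson less_asym)
  qed
  show "tm = tm'" using le[OF x y] le[OF y x] by simp
  show "x t = y t" if "-\<tau> \<le> t" "ereal t < tm" for t
  proof -
    have "max (ereal t) 0 < tm" using that x by (simp add: maximal_solution_def)
    then obtain T where T: "max (ereal t) 0 < ereal T" "ereal T < tm"
      using ereal_dense2 by blast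
    then have "0 < T" "t < T" by auto
    then show ?thesis
      using T(2) x y that(1) unfolding maximal_solution_def by (metis atLeastAtMost_iff less_imp_le)
  qed
qed

definition stable ::
    "(real ^ 'd \<Rightarrow> real) \<Rightarrow> real \<Rightarrow> real \<Rightarrow> real ^ 'd ^ 'd \<Rightarrow>
     (real ^ 'd \<Rightarrow> real ^ 'd \<Rightarrow> real ^ 'd) \<Rightarrow> bool" where
  "stable N \<alpha> \<tau> A g \<longleftrightarrow>
     (\<forall>\<epsilon>>0. \<exists>\<delta>>0. \<forall>\<phi>. continuous_on {-\<tau>..0} \<phi> \<and> sup_norm N \<tau> \<phi> \<le> \<delta> \<longrightarrow>
        (\<exists>x. maximal_solution \<alpha> \<tau> A g \<phi> \<infinity> x \<and> (\<forall>t\<ge>0. N (x t) \<le> \<epsilon>)))"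

definition asymptotically_stable ::
    "(real ^ 'd \<Rightarrow> real) \<Rightarrow> real \<Rightarrow> real \<Rightarrow> real ^ 'd ^ 'd \<Rightarrow>
     (real ^ 'd \<Rightarrow> real ^ 'd \<Rightarrow> real ^ 'd) \<Rightarrow> bool" where
  "asymptotically_stable N \<alpha> \<tau> A g \<longleftrightarrow>
     stable N \<alpha> \<tau> A g \<and>
     (\<exists>\<delta>>0. \<forall>\<phi>. continuous_on {-\<tau>..0} \<phi> \<and> sup_norm N \<tau> \<phi> \<le> \<delta> \<longrightarrow>
        (\<exists>x. maximal_solution \<alpha> \<tau> A g \<phi> \<infinity> x \<and> (x \<longlongrightarrow> 0) at_top))"

end

theory Submission
  imports Defs "HOL-Complex_Analysis.Complex_Analysis" "Jordan_Normal_Form.Schur_Decomposition"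
begin

text \<open>Over the complex numbers \<open>A\<close> is similar to a diagonal matrix plus an arbitrarily small
  matrix, and the small matrix can be treated together with \<open>g\<close> as a perturbation with small
  Lipschitz constant. This leaves scalar equations \<open>D\<^sup>\<alpha> x(t) = l x(t - \<tau>)\<close> with \<open>l\<close> in the
  stability region, for which \<open>s\<^sup>\<alpha> - l e\<^sup>-\<^sup>s\<^sup>\<tau>\<close> has no zero with nonnegative real part. Laplace
  inversion on the line with real part \<open>1 / t\<close> shows that the resolvent \<open>r\<close> is integrable on the
  half-line, with integral \<open>- 1 / l\<close>. Hence the variation of constants formula is a contraction
  on small bounded continuous functions that tend to zero at infinity, and its fixed point is the
  solution; the value of the integral of \<open>r\<close> makes the contribution of \<open>\<phi>(0)\<close> vanish in the limit.\<close>

section \<open>Diagonalization up to a small error\<close>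

text \<open>The branch point of s^\<alpha> at the origin keeps the inversion line from passing into
  the left half-plane, so only power decay is sought. It comes from the second derivative of the
  transform: its singularity of order 2 - \<alpha> at the origin contributes t^(1-\<alpha>) on the
  line with real part 1/t, and two integrations by parts divide by t^2. The obstacle lies at
  infinity. The transform of the resolvent decays only like |s|^(-\<alpha>), so it is not absolutely
  integrable on a vertical line, and the resolvent is unbounded near 0 and, for small \<alpha>, near
  further multiples of \<tau>. Inversion is therefore applied to the difference from a damped
  resolvent with the same singularities; this difference is continuous and its transform is of order
  |s|^(-1-\<alpha>). Since \<open>g\<close> is controlled only near the origin, uniqueness among all
  solutions is a separate continuation argument: a competing solution is not known in advance to
  stay in the small ball.\<close>

text \<open>Index functions replace the matrix type of the Schur decomposition, so that the result
  can be carried along a bijection to any finite index type. The last conjunct is what remains of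
  the characteristic polynomial: its roots are the diagonal entries, and each of them is an
  eigenvalue.\<close>

lemma schur_triangularization:
  fixes a :: "nat \<Rightarrow> nat \<Rightarrow> complex"
  shows "\<exists>p q b. (\<forall>i<n. \<forall>j<n. (\<Sum>k<n. p i k * q k j) = (if i = j then 1 else 0)) \<and>
    (\<forall>i<n. \<forall>j<n. (\<Sum>k<n. a i k * p k j) = (\<Sum>k<n. p i k * b k j)) \<and>
    (\<forall>i<n. \<forall>j<i. b i j = 0) \<and>
    (\<forall>k<n. \<exists>v. (\<exists>i<n. v i \<noteq> 0) \<and> (\<forall>i<n. (\<Sum>j<n. a i j * v j) = b k k * v i))"
proof -
  define A where "A = Matrix.mat n n (\<lambda>(i, j). a i j)"
  have A: "A \<in> carrier_mat n n" by (simp add: A_def)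
  obtain es where es: "char_poly A = (\<Prod>e\<leftarrow>es. [:- e, 1:])" using char_poly_factorized[OF A] by blast
  obtain B P Q where dec: "schur_decomposition A es = (B, P, Q)" by (cases "schur_decomposition A es") auto
  have wit: "similar_mat_wit A B P Q" and ut: "upper_triangular B" and dg: "diag_mat B = es"
    using schur_decomposition[OF A es dec] by auto
  note w = similar_mat_witD2[OF A wit]
  have dims: "dim_row B = n" "dim_col B = n" "dim_row P = n" "dim_col P = n" "dim_row Q = n" "dim_col Q = n"
    using w by auto
  have entry: "(X * Y) $$ (i, j) = (\<Sum>k<n. X $$ (i, k) * Y $$ (k, j))"
    if "X \<in> carrier_mat n n" "Y \<in> carrier_mat n n" "i < n" "j < n" for X Y :: "complex mat" and i j
    using that by (auto simp: scalar_prod_def atLeast0LessThan intro!: sum.cong)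
  have "A * P = (P * B) * (Q * P)" using w(3-7) by (simp add: assoc_mult_mat[of _ n n _ n _ n])
  then have AP: "A * P = P * B" using w by simp
  have f1: "(\<Sum>k<n. P $$ (i, k) * Q $$ (k, j)) = (if i = j then 1 else 0)" if "i < n" "j < n" for i j
    using entry[OF w(6,7) that] w(1) that by simp
  have f2: "(\<Sum>k<n. a i k * P $$ (k, j)) = (\<Sum>k<n. P $$ (i, k) * B $$ (k, j))" if "i < n" "j < n" for i j
  proof -
    have "(\<Sum>k<n. a i k * P $$ (k, j)) = (\<Sum>k<n. A $$ (i, k) * P $$ (k, j))" using that by (simp add: A_def)
    then show ?thesis using entry[OF w(4,6) that] entry[OF w(6,5) that] AP by simp
  qed
  have f3: "B $$ (i, j) = 0" if "i < n" "j < i" for i j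
    using ut that dims by (auto simp: upper_triangular_def)
  have f4: "\<exists>v. (\<exists>i<n. v i \<noteq> 0) \<and> (\<forall>i<n. (\<Sum>j<n. a i j * v j) = B $$ (k, k) * v i)" if k: "k < n" for k
  proof -
    have "B $$ (k, k) \<in> set es" unfolding dg[symmetric] using k dims by (auto simp: diag_mat_def)
    then have "poly (char_poly A) (B $$ (k, k)) = 0"
      unfolding es poly_prod_list by (auto simp: prod_list_zero_iff)
    then obtain v where v: "eigenvector A v (B $$ (k, k))"
      using eigenvalue_root_char_poly[OF A] by (auto simp: eigenvalue_def)
    then have dv: "dim_vec v = n" and v0: "v \<noteq> 0\<^sub>v n" and Av: "A *\<^sub>v v = B $$ (k, k) \<cdot>\<^sub>v v"
      using A by (auto simp: eigenvector_def)
    have "\<exists>i<n. vec_index v i \<noteq> 0" using v0 dv by (auto intro!: eq_vecI)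
    moreover have "(\<Sum>j<n. a i j * vec_index v j) = B $$ (k, k) * vec_index v i" if i: "i < n" for i
    proof -
      have "vec_index (A *\<^sub>v v) i = (\<Sum>j<n. a i j * vec_index v j)"
        using i dv by (auto simp: A_def scalar_prod_def atLeast0LessThan intro!: sum.cong)
      then show ?thesis using i dv unfolding Av by simp
    qed
    ultimately show ?thesis by blast
  qed
  show ?thesis
    by (intro exI[of _ "\<lambda>i j. P $$ (i, j)"] exI[of _ "\<lambda>i j. Q $$ (i, j)"] exI[of _ "\<lambda>i j. B $$ (i, j)"]
        conjI allI impI f1 f2 f3 f4)
qed

text \<open>\<open>\<Lambda>\<close> is chosen before \<open>\<epsilon>\<close>: the admissible size
  of the error will depend on the resolvents belonging to the eigenvalues, so these must not move
  when the error shrinks.\<close>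

lemma near_diagonalization:
  fixes A :: "'d::finite \<Rightarrow> 'd \<Rightarrow> complex"
  shows "\<exists>\<Lambda> :: 'd \<Rightarrow> complex.
    (\<forall>i. \<exists>v. (\<exists>j. v j \<noteq> 0) \<and> (\<forall>j. (\<Sum>k\<in>UNIV. A j k * v k) = \<Lambda> i * v j)) \<and>
    (\<forall>\<epsilon>>0. \<exists>P Q M. (\<forall>i j. (\<Sum>k\<in>UNIV. P i k * Q k j) = (if i = j then 1 else 0)) \<and>
      (\<forall>i j. (\<Sum>k\<in>UNIV. A i k * P k j) = P i j * \<Lambda> j + (\<Sum>k\<in>UNIV. P i k * M k j)) \<and>
      (\<forall>i j. cmod (M i j) \<le> \<epsilon>))"
proof -
  define n where "n = CARD('d)"
  obtain h where h: "bij_betw h {..<n} (UNIV :: 'd set)"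
    using ex_bij_betw_nat_finite[of "UNIV :: 'd set"] by (auto simp: n_def atLeast0LessThan)
  define d where "d = inv_into {..<n} h"
  have d: "bij_betw d UNIV {..<n}" unfolding d_def by (rule bij_betw_inv_into[OF h])
  have hd: "h (d i) = i" for i unfolding d_def using h by (simp add: bij_betw_inv_into_right)
  have dh: "d (h k) = k" if "k < n" for k unfolding d_def using h that by (simp add: bij_betw_inv_into_left)
  have dn: "d i < n" for i using bij_betwE[OF d] by auto
  have dinj: "d i = d j \<longleftrightarrow> i = j" for i j using hd by metis
  have re: "(\<Sum>k\<in>UNIV. f (d k)) = (\<Sum>k<n. f k)" for f :: "nat \<Rightarrow> complex" by (rule sum.reindex_bij_betw[OF d])
  define a where "a = (\<lambda>i j. A (h i) (h j))"
  have aA: "A i j = a (d i) (d j)" for i j by (simp add: a_def hd)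
  obtain p q b where pq: "\<forall>i<n. \<forall>j<n. (\<Sum>k<n. p i k * q k j) = (if i = j then 1 else 0)"
    and ap: "\<forall>i<n. \<forall>j<n. (\<Sum>k<n. a i k * p k j) = (\<Sum>k<n. p i k * b k j)"
    and b0: "\<forall>i<n. \<forall>j<i. b i j = 0"
    and ev: "\<forall>k<n. \<exists>v. (\<exists>i<n. v i \<noteq> 0) \<and> (\<forall>i<n. (\<Sum>j<n. a i j * v j) = b k k * v i)"
    using schur_triangularization[of n a] by (elim exE conjE) (rule that)
  \<comment> \<open>Conjugating the triangular form by \<open>diag(1, t, t\<^sup>2, \<dots>)\<close> multiplies the entry \<open>(i, j)\<close> by \<open>t\<^sup>j\<^sup>-\<^sup>i\<close>.\<close>
  show ?thesis
  proof (rule exI[of _ "\<lambda>i. b (d i) (d i)"], intro conjI[OF allI] allI[OF impI])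
    fix i :: 'd
    obtain v where vv: "(\<exists>j<n. v j \<noteq> 0) \<and> (\<forall>j<n. (\<Sum>k<n. a j k * v k) = b (d i) (d i) * v j)"
      using ev[rule_format, OF dn[of i]] by (rule exE)
    note v = conjunct1[OF vv] conjunct2[OF vv]
    obtain j where "j < n" "v j \<noteq> 0" using v(1) by blast
    then have "\<exists>j. v (d j) \<noteq> 0" using dh by metis
    moreover have "(\<Sum>k\<in>UNIV. A j k * v (d k)) = b (d i) (d i) * v (d j)" for j
      using v(2) dn[of j] re[of "\<lambda>k. a (d j) k * v k"] by (simp add: aA)
    ultimately show "\<exists>v. (\<exists>j. v j \<noteq> 0) \<and> (\<forall>j. (\<Sum>k\<in>UNIV. A j k * v k) = b (d i) (d i) * v j)"
      by (intro exI[of _ "\<lambda>k. v (d k)"] conjI allI)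
  next
    fix \<epsilon> :: real assume \<epsilon>: "0 < \<epsilon>"
    define Bm where "Bm = (\<Sum>i<n. \<Sum>j<n. cmod (b i j)) + 1"
    have bB: "cmod (b i j) \<le> Bm" if "i < n" "j < n" for i j
    proof -
      have "cmod (b i j) \<le> (\<Sum>j<n. cmod (b i j))" using that by (intro member_le_sum) auto
      also have "\<dots> \<le> (\<Sum>i<n. \<Sum>j<n. cmod (b i j))" using that by (intro member_le_sum[of i "{..<n}" "\<lambda>i. \<Sum>j<n. cmod (b i j)"]) (auto intro: sum_nonneg)
      finally show ?thesis by (simp add: Bm_def)
    qed
    have Bm: "0 < Bm" by (auto simp: Bm_def intro!: add_nonneg_pos sum_nonneg)
    \<comment> \<open>Every entry above the diagonal carries at least one factor \<open>t\<close>.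
      With \<open>t \<le> 1\<close> higher powers only help, so it suffices that \<open>t\<close>
      times the bound \<open>Bm\<close> on the entries is at most \<open>\<epsilon>\<close>.\<close>
    define t where "t = min 1 (\<epsilon> / Bm)"
    have t: "0 < t" "t \<le> 1" "t * Bm \<le> \<epsilon>" using \<epsilon> Bm by (auto simp: t_def min_def field_simps)
    let ?t = "of_real t :: complex"
    have t0: "?t \<noteq> 0" using t by simp
    define m where "m = (\<lambda>i j. if i < j then b i j * ?t ^ (j - i) else 0)"
    let ?P = "\<lambda>i k. p (d i) (d k) * ?t ^ d k" and ?Q = "\<lambda>k j. q (d k) (d j) / ?t ^ d k" and ?M = "\<lambda>i j. m (d i) (d j)"
    have e1: "(\<Sum>k\<in>UNIV. ?P i k * ?Q k j) = (if i = j then 1 else 0)" for i j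
    proof -
      have "(\<Sum>k\<in>UNIV. ?P i k * ?Q k j) = (\<Sum>k\<in>UNIV. p (d i) (d k) * q (d k) (d j))"
        using t0 by (intro sum.cong) auto
      also have "\<dots> = (\<Sum>k<n. p (d i) k * q k (d j))" by (rule re)
      also have "\<dots> = (if i = j then 1 else 0)" using pq dn[of i] dn[of j] by (simp add: dinj)
      finally show ?thesis .
    qed
    have e2: "(\<Sum>k\<in>UNIV. A i k * ?P k j) = ?P i j * b (d j) (d j) + (\<Sum>k\<in>UNIV. ?P i k * ?M k j)" for i j
    proof -
      have pt: "p (d i) k * b k (d j) * ?t ^ d j = (if k = d j then p (d i) (d j) * ?t ^ d j * b (d j) (d j) else 0) + p (d i) k * ?t ^ k * m k (d j)" if "k < n" for k
      proof -
        consider "d j < k" | "k = d j" | "k < d j" by linarith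
        then show ?thesis
        proof cases
          case 1 then show ?thesis using b0 that by (simp add: m_def)
        next
          case 2 then show ?thesis by (simp add: m_def)
        next
          case 3
          then have "?t ^ d j = ?t ^ k * ?t ^ (d j - k)" by (simp flip: power_add)
          then show ?thesis using 3 by (simp add: m_def)
        qed
      qed
      have "(\<Sum>k\<in>UNIV. A i k * ?P k j) = (\<Sum>k\<in>UNIV. a (d i) (d k) * p (d k) (d j)) * ?t ^ d j"
        by (simp add: aA sum_distrib_right mult.assoc)
      also have "\<dots> = (\<Sum>k<n. p (d i) k * b k (d j)) * ?t ^ d j"
        using ap dn[of i] dn[of j] re[of "\<lambda>k. a (d i) k * p k (d j)"] by simp
      also have "\<dots> = (\<Sum>k<n. (if k = d j then p (d i) (d j) * ?t ^ d j * b (d j) (d j) else 0) + p (d i) k * ?t ^ k * m k (d j))"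
        unfolding sum_distrib_right by (intro sum.cong refl pt) auto
      also have "\<dots> = ?P i j * b (d j) (d j) + (\<Sum>k<n. p (d i) k * ?t ^ k * m k (d j))"
        using dn[of j] by (simp add: sum.distrib)
      also have "(\<Sum>k<n. p (d i) k * ?t ^ k * m k (d j)) = (\<Sum>k\<in>UNIV. ?P i k * ?M k j)"
        by (rule re[symmetric])
      finally show ?thesis .
    qed
    have e3: "cmod (?M i j) \<le> \<epsilon>" for i j
    proof (cases "d i < d j")
      case True
      have "t ^ (d j - d i) \<le> t ^ 1" using True t by (intro power_decreasing) auto
      then have "cmod (b (d i) (d j)) * t ^ (d j - d i) \<le> Bm * t" using bB[OF dn dn] Bm t by (intro mult_mono) auto
      then show ?thesis using True t by (simp add: m_def norm_mult norm_power mult.commute)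
    qed (use \<epsilon> in \<open>simp add: m_def\<close>)
    show "\<exists>P Q M. (\<forall>i j. (\<Sum>k\<in>UNIV. P i k * Q k j) = (if i = j then 1 else 0)) \<and>
      (\<forall>i j. (\<Sum>k\<in>UNIV. A i k * P k j) = P i j * b (d j) (d j) + (\<Sum>k\<in>UNIV. P i k * M k j)) \<and>
      (\<forall>i j. cmod (M i j) \<le> \<epsilon>)"
      by (intro exI[of _ ?P] exI[of _ ?Q] exI[of _ ?M] conjI allI e1 e2 e3)
  qed
qed

no_notation vec_index (infixl "$" 100)
no_notation fps_nth (infixl "$" 75)

section \<open>Injectivity of the Laplace transform\<close>

lemma abs_le_mult_imp_zero:
  fixes a J :: real
  assumes "\<And>e. e > 0 \<Longrightarrow> \<bar>a\<bar> \<le> e * J" "J \<ge> 0"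
  shows "a = 0"
proof (rule ccontr)
  assume "a \<noteq> 0"
  then have "\<bar>a\<bar> * (J + 2) \<le> 0"
    using assms(1)[of "\<bar>a\<bar> / (2 * (J + 1))"] assms(2) by (auto simp: field_simps split: if_splits)
  then show False using \<open>a \<noteq> 0\<close> assms(2) by (auto simp: mult_le_0_iff)
qed

lemma set_integrable_sum [intro]:
  fixes f :: "'i \<Rightarrow> 'a \<Rightarrow> 'b::{banach, second_countable_topology}"
  assumes "\<And>i. i \<in> I \<Longrightarrow> set_integrable M A (f i)"
  shows "set_integrable M A (\<lambda>x. \<Sum>i\<in>I. f i x)"
  using assms unfolding set_integrable_def by (simp add: scaleR_sum_right)

lemma set_integral_sum:
  fixes f :: "'i \<Rightarrow> 'a \<Rightarrow> 'b::{banach, second_countable_topology}"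
  assumes "\<And>i. i \<in> I \<Longrightarrow> set_integrable M A (f i)"
  shows "(LINT x:A|M. \<Sum>i\<in>I. f i x) = (\<Sum>i\<in>I. LINT x:A|M. f i x)"
  using assms unfolding set_integrable_def set_lebesgue_integral_def by (simp add: scaleR_sum_right)

text \<open>Substituting x = exp(-t) turns the vanishing transforms at the nonnegative integers into
  orthogonality to all monomials in x. Weierstrass approximation extends this to every continuous
  function on [0,1], one of which is \<open>u\<close> itself times a cutoff; so the integral of u^2
  against a nonnegative weight is zero.\<close>

lemma Lerch_real:
  fixes u :: "real \<Rightarrow> real"
  assumes cont: "continuous_on {0..} u"
    and int: "set_integrable lborel {0..} u"
    and zero: "\<And>k::nat. (LINT t:{0..}|lborel. exp (- real k * t) * u t) = 0"
    and t: "0 \<le> t"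
  shows "u t = 0"
proof -
  have mono_poly: "(LINT t:{0..}|lborel. p (exp (- t)) * u t) = 0 \<and>
      set_integrable lborel {0..} (\<lambda>t. p (exp (- t)) * u t)"
    if p: "real_polynomial_function p" for p :: "real \<Rightarrow> real"
  proof -
    obtain a n where pa: "p = (\<lambda>x. \<Sum>i\<le>n::nat. a i * x ^ i)"
      using p unfolding real_polynomial_function_iff_sum by blast
    have i1: "set_integrable lborel {0..} (\<lambda>t. exp (- real k * t) * u t)" for k :: nat
      by (rule set_integrable_bound[OF int])
         (auto simp: set_borel_measurable_def abs_mult mult_left_le_one_le
            intro!: borel_measurable_continuous_on_indicator[where 'a=real and 'b=real, unfolded real_scaleR_def] continuous_intros cont)
    have eq: "p (exp (- t)) * u t = (\<Sum>i\<le>n. a i * (exp (- real i * t) * u t))" for t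
      by (simp add: pa sum_distrib_right sum_distrib_left exp_of_nat_mult[symmetric] mult_ac)
    have i2: "set_integrable lborel {0..} (\<lambda>t. \<Sum>i\<le>n. a i * (exp (- real i * t) * u t))"
      by (intro set_integrable_sum set_integrable_mult_right i1)
    moreover have "(LINT t:{0..}|lborel. \<Sum>i\<le>n. a i * (exp (- real i * t) * u t))
        = (\<Sum>i\<le>n. (LINT t:{0..}|lborel. a i * (exp (- real i * t) * u t)))"
      by (intro set_integral_sum set_integrable_mult_right i1)
    moreover have "\<dots> = 0" using zero by (simp add: set_integral_mult_right)
    ultimately show ?thesis by (simp add: eq)
  qed
  have ortho: "(LINT t:{0..}|lborel. V (exp (- t)) * u t) = 0 \<and> set_integrable lborel {0..} (\<lambda>t. V (exp (- t)) * u t)"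
    if V: "continuous_on {0..1} V" for V :: "real \<Rightarrow> real"
  proof -
    have meas: "set_borel_measurable borel {0..} (\<lambda>t. V (exp (- t)) * u t)"
      unfolding set_borel_measurable_def
      by (intro borel_measurable_continuous_on_indicator continuous_intros cont
          continuous_on_compose2[OF V]) auto
    obtain B where B: "\<And>x. x \<in> {0..1} \<Longrightarrow> \<bar>V x\<bar> \<le> B"
      using compact_imp_bounded[OF compact_continuous_image[OF V]] unfolding bounded_iff by (auto simp del: atLeastAtMost_iff)
    have iV: "set_integrable lborel {0..} (\<lambda>t. V (exp (- t)) * u t)"
    proof (rule set_integrable_bound)
      show "set_integrable lborel {0..} (\<lambda>t. B * u t)" using int by simp
      show "set_borel_measurable lborel {0..} (\<lambda>t. V (exp (- t)) * u t)" using meas by (simp add: set_borel_measurable_def)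
      show "AE x in lborel. x \<in> {0..} \<longrightarrow> norm (V (exp (- x)) * u x) \<le> norm (B * u x)"
        using B by (auto simp: abs_mult intro!: mult_right_mono order_trans[OF B abs_ge_self])
    qed
    let ?J = "LINT t:{0..}|lborel. \<bar>u t\<bar>"
    have "\<bar>LINT t:{0..}|lborel. V (exp (- t)) * u t\<bar> \<le> e * ?J" if e: "e > 0" for e
    proof -
      obtain p where p: "real_polynomial_function p" "\<And>x. x \<in> {0..1} \<Longrightarrow> \<bar>V x - p x\<bar> < e"
        using Stone_Weierstrass_real_polynomial_function[of "{0..1}" V e] V e by auto
      note mp = mono_poly[OF p(1)]
      have "(LINT t:{0..}|lborel. V (exp (- t)) * u t) = (LINT t:{0..}|lborel. V (exp (- t)) * u t - p (exp (- t)) * u t)"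
        using mp iV by (subst set_integral_diff) auto
      also have "\<bar>\<dots>\<bar> \<le> (LINT t:{0..}|lborel. \<bar>V (exp (- t)) * u t - p (exp (- t)) * u t\<bar>)"
        using set_integral_norm_bound[OF set_integral_diff(1)[OF iV mp[THEN conjunct2]]] by simp
      also have "\<dots> \<le> (LINT t:{0..}|lborel. e * \<bar>u t\<bar>)"
      proof (rule set_integral_mono)
        show "set_integrable lborel {0..} (\<lambda>t. \<bar>V (exp (- t)) * u t - p (exp (- t)) * u t\<bar>)"
          using set_integral_diff(1)[OF iV mp[THEN conjunct2]] by (rule set_integrable_abs)
        show "set_integrable lborel {0..} (\<lambda>t. e * \<bar>u t\<bar>)" using set_integrable_abs[OF int] by simp
        show "\<bar>V (exp (- t)) * u t - p (exp (- t)) * u t\<bar> \<le> e * \<bar>u t\<bar>" if "t \<in> {0..}" for t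
          using p(2)[of "exp (- t)"] that
          by (simp add: left_diff_distrib[symmetric] abs_mult mult_right_mono less_imp_le)
      qed
      finally show ?thesis by simp
    qed
    moreover have "?J \<ge> 0" by (simp add: set_lebesgue_integral_def)
    ultimately have "(LINT t:{0..}|lborel. V (exp (- t)) * u t) = 0"
      using abs_le_mult_imp_zero by blast
    with iV show ?thesis by blast
  qed
  \<comment> \<open>The cutoff \<open>ch\<close> vanishes from \<open>M\<close> on, so
    \<open>V\<close> extends continuously by 0 to x = 0 even if \<open>u\<close> has no limit at
    infinity. \<open>M = t + 1\<close> keeps \<open>ch\<close> positive at \<open>t\<close> and
    slightly to its right.\<close>
  define M where "M = t + 1"
  define ch where "ch = (\<lambda>s. max 0 (1 - s / M))"
  define V where "V = (\<lambda>x. if x \<le> exp (- M) then 0 else u (- ln x) * ch (- ln x))"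
  have M: "M > 0" using t by (simp add: M_def)
  have "continuous_on ({0..exp (-M)} \<union> {exp (-M)..1}) V"
    unfolding V_def
  proof (rule continuous_on_If)
    show "continuous_on {exp (- M)..1} (\<lambda>x. u (- ln x) * ch (- ln x))"
      unfolding ch_def
      using M by (intro continuous_intros continuous_on_compose2[OF cont])
         (auto simp: less_le_trans[OF exp_gt_zero] ln_le_zero_iff[OF less_le_trans[OF exp_gt_zero]])
    show "0 = u (- ln x) * ch (- ln x)" if "x \<in> {exp (-M)..1}" "x \<le> exp (-M)" for x
    proof -
      have "x = exp (-M)" using that by simp
      then show ?thesis using M by (simp add: ch_def)
    qed
  qed (auto)
  moreover have "{0..exp (-M)} \<union> {exp (-M)..1} = {0..1}"
    using M by (intro ivl_disj_un_two_touch(4)) auto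
  ultimately have cV: "continuous_on {0..1} V" by simp
  have Veq: "V (exp (- s)) * u s = (u s)\<^sup>2 * ch s" if "s \<ge> 0" for s
    using that M by (auto simp: V_def ch_def power2_eq_square field_simps)
  have Veq': "indicator {0..} s * (V (exp (- s)) * u s) = indicator {0..} s * ((u s)\<^sup>2 * ch s)" for s :: real
    using Veq[of s] by (auto simp: indicator_def)
  have I0: "(\<integral>s. indicator {0..} s * ((u s)\<^sup>2 * ch s) \<partial>lborel) = 0" and
       Ii: "integrable lborel (\<lambda>s. indicator {0..} s * ((u s)\<^sup>2 * ch s))"
    using ortho[OF cV] unfolding set_lebesgue_integral_def set_integrable_def real_scaleR_def Veq' by auto
  have "continuous_on {0..} (\<lambda>s. (u s)\<^sup>2 * ch s)" unfolding ch_def using M by (intro continuous_intros cont) auto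
  have AE0: "AE s in lborel. indicator {0..} s * ((u s)\<^sup>2 * ch s) = 0"
    using integral_nonneg_eq_0_iff_AE[OF Ii] I0 by (auto simp: ch_def)
  show "u t = 0"
  proof (rule ccontr)
    assume ne: "u t \<noteq> 0"
    have "\<forall>\<^sub>F s in at t within {0..}. u s \<noteq> 0"
      using cont t ne by (intro tendsto_imp_eventually_ne) (auto simp: continuous_on_def)
    then obtain d where d: "d > 0" "\<And>s. s \<in> {0..} \<Longrightarrow> s \<noteq> t \<Longrightarrow> dist s t < d \<Longrightarrow> u s \<noteq> 0"
      unfolding eventually_at by blast
    \<comment> \<open>An interval to the right of \<open>t\<close>, because \<open>t\<close> may be
      the endpoint 0; its length of at most 1 keeps it below \<open>M\<close>, where
      \<open>ch\<close> is positive.\<close>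
    let ?I = "{t<..<t + min d 1}"
    have "AE s in lborel. s \<notin> ?I"
    proof (rule AE_mp[OF AE0], intro AE_I2 impI)
      fix s assume a: "indicator {0..} s * ((u s)\<^sup>2 * ch s) = 0"
      show "s \<notin> ?I"
      proof
        assume s: "s \<in> ?I"
        then have "u s \<noteq> 0" using d(2)[of s] t by (auto simp: dist_real_def min_def split: if_splits)
        moreover have "ch s > 0" using s t M by (auto simp: ch_def M_def field_simps)
        ultimately show False using a s t by auto
      qed
    qed
    then have "emeasure lborel ?I = 0" by (subst (asm) AE_iff_measurable[of ?I]) auto
    then show False using d(1) by (simp add: min_def split: if_splits)
  qed
qed

section \<open>Delayed Mittag-Leffler functions\<close>

text \<open>For nonnegative functions gauge and Lebesgue integrability agree. This imports the
  Gamma, Beta, power and exponential integrals, which are available as gauge integrals.\<close>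

lemma has_bochner_integral_HK_nonneg:
  fixes f :: "real \<Rightarrow> real"
  assumes "(f has_integral I) S" "\<And>x. x \<in> S \<Longrightarrow> 0 \<le> f x" "set_borel_measurable borel S f" "0 \<le> I"
  shows "has_bochner_integral lborel (\<lambda>x. indicator S x * f x) I"
proof (rule has_bochner_integral_nn_integral)
  show m: "(\<lambda>x. indicator S x * f x) \<in> borel_measurable lborel"
    using assms(3) by (simp add: set_borel_measurable_def)
  have eq: "(\<lambda>x. indicator S x * f x) = (\<lambda>x. if x \<in> S then f x else 0)" by auto
  show "(\<integral>\<^sup>+ x. ennreal (indicator S x * f x) \<partial>lborel) = ennreal I"
  proof (rule nn_integral_has_integral_lborel)
    show "((\<lambda>x. indicator S x * f x) has_integral I) UNIV"
      unfolding eq has_integral_restrict_UNIV by fact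
  qed (use m assms(2) in \<open>auto simp: indicator_def\<close>)
  show "AE x in lborel. 0 \<le> indicator S x * f x" using assms(2) by (auto simp: indicator_def)
qed fact

text \<open>The Riemann-Liouville kernel: convolution with it is the fractional integral of order
  \<open>\<beta>\<close>. Extension by 0 to the nonpositive axis builds causality into the kernel,
  so integrals over the whole line see only the past.\<close>

definition rl_kernel :: "real \<Rightarrow> real \<Rightarrow> real" where
  "rl_kernel \<beta> t = (if 0 < t then t powr (\<beta> - 1) / Gamma \<beta> else 0)"

lemma rl_kernel_nonneg: "0 < \<beta> \<Longrightarrow> 0 \<le> rl_kernel \<beta> t"
  by (simp add: rl_kernel_def Gamma_real_pos less_imp_le)

lemma rl_kernel_nonpos_eq: "t \<le> 0 \<Longrightarrow> rl_kernel \<beta> t = 0"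
  by (simp add: rl_kernel_def)

lemma rl_kernel_measurable [measurable]: "rl_kernel \<beta> \<in> borel_measurable borel"
  unfolding rl_kernel_def by measurable

lemma rl_kernel_laplace:
  assumes "0 < \<beta>" "0 < \<sigma>"
  shows "has_bochner_integral lborel (\<lambda>t. exp (- \<sigma> * t) * rl_kernel \<beta> t) (\<sigma> powr (- \<beta>))"
proof -
  let ?f = "\<lambda>t::real. t powr (\<beta> - 1) / exp t"
  have "has_bochner_integral lborel (\<lambda>x. indicator {0..} x * ?f x) (Gamma \<beta>)"
    by (intro has_bochner_integral_HK_nonneg Gamma_integral_real)
       (use assms in \<open>auto simp: set_borel_measurable_def Gamma_real_pos less_imp_le\<close>)
  then have "has_bochner_integral lborel (\<lambda>x. indicator {0..} (0 + \<sigma> * x) * ?f (0 + \<sigma> * x)) (Gamma \<beta> /\<^sub>R \<bar>\<sigma>\<bar>)"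
    using assms(2) by (subst (asm) lborel_has_bochner_integral_real_affine_iff[where t=0 and c=\<sigma>]) auto
  then have "has_bochner_integral lborel (\<lambda>x. (\<sigma> powr (1 - \<beta>) / Gamma \<beta>) * (indicator {0..} (0 + \<sigma> * x) * ?f (0 + \<sigma> * x)))
     ((\<sigma> powr (1 - \<beta>) / Gamma \<beta>) * (Gamma \<beta> /\<^sub>R \<bar>\<sigma>\<bar>))"
    by (rule has_bochner_integral_mult_right)
  also have "(\<sigma> powr (1 - \<beta>) / Gamma \<beta>) * (Gamma \<beta> /\<^sub>R \<bar>\<sigma>\<bar>) = \<sigma> powr (- \<beta>)"
    using assms Gamma_real_pos[OF assms(1), THEN less_imp_neq] by (simp add: powr_diff powr_minus field_simps)
  also have "(\<lambda>x. (\<sigma> powr (1 - \<beta>) / Gamma \<beta>) * (indicator {0..} (0 + \<sigma> * x) * ?f (0 + \<sigma> * x)))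
     = (\<lambda>t. exp (- \<sigma> * t) * rl_kernel \<beta> t)"
  proof
    fix t :: real
    show "(\<sigma> powr (1 - \<beta>) / Gamma \<beta>) * (indicator {0..} (0 + \<sigma> * t) * ?f (0 + \<sigma> * t)) = exp (- \<sigma> * t) * rl_kernel \<beta> t"
      using assms Gamma_real_pos[OF assms(1), THEN less_imp_neq]
      by (auto simp: rl_kernel_def indicator_def powr_mult exp_minus field_simps zero_le_mult_iff
           powr_diff)
  qed
  finally show ?thesis .
qed

text \<open>The semigroup law of fractional integration: the Beta integral rescaled from [0,1] to
  [0,t].\<close>

lemma rl_kernel_convolution:
  assumes "0 < a" "0 < b"
  shows "has_bochner_integral lborel (\<lambda>s. rl_kernel a (t - s) * rl_kernel b s) (rl_kernel (a + b) t)"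
proof (cases "0 < t")
  case False
  then have "(\<lambda>s. rl_kernel a (t - s) * rl_kernel b s) = (\<lambda>s. 0)" by (auto simp: rl_kernel_def fun_eq_iff)
  then show ?thesis using False by (simp add: rl_kernel_def has_bochner_integral_zero)
next
  case True
  let ?f = "\<lambda>x::real. x powr (b - 1) * (1 - x) powr (a - 1)"
  let ?g = "\<lambda>s. rl_kernel a (t - s) * rl_kernel b s"
  have G: "Gamma a > 0" "Gamma b > 0" "Gamma (a + b) > 0" using assms by (auto intro: Gamma_real_pos)
  have B: "Beta b a > 0" unfolding Beta_def using G by (simp add: add.commute)
  have "has_bochner_integral lborel (\<lambda>x. indicator {0..1} x * ?f x) (Beta b a)"
    by (intro has_bochner_integral_HK_nonneg has_integral_Beta_real)
       (use assms B in \<open>auto simp: set_borel_measurable_def\<close>)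
  then have "has_bochner_integral lborel (\<lambda>x. (t powr (a + b - 2) / (Gamma a * Gamma b)) * (indicator {0..1} x * ?f x))
     ((t powr (a + b - 2) / (Gamma a * Gamma b)) * Beta b a)"
    by (rule has_bochner_integral_mult_right)
  also have "(\<lambda>x. (t powr (a + b - 2) / (Gamma a * Gamma b)) * (indicator {0..1} x * ?f x)) = (\<lambda>x. ?g (0 + t * x))"
  proof
    fix x :: real
    consider "x \<le> 0" | "x \<ge> 1" | "0 < x" "x < 1" by linarith
    then show "(t powr (a + b - 2) / (Gamma a * Gamma b)) * (indicator {0..1} x * ?f x) = ?g (0 + t * x)"
    proof cases
      case 1 then show ?thesis using True by (auto simp: indicator_def rl_kernel_def zero_less_mult_iff)
    next
      case 2 then show ?thesis using True by (auto simp: indicator_def rl_kernel_def mult_le_0_iff not_less)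
    next
      case 3
      have "t - t * x = t * (1 - x)" by (simp add: algebra_simps)
      moreover have "t powr (a + b - 2) = t powr (a - 1) * t powr (b - 1)"
        by (simp add: powr_add[symmetric] algebra_simps)
      ultimately show ?thesis using True 3 by (simp add: rl_kernel_def powr_mult)
    qed
  qed
  also have "(t powr (a + b - 2) / (Gamma a * Gamma b)) * Beta b a = rl_kernel (a + b) t /\<^sub>R \<bar>t\<bar>"
  proof -
    have "t powr (a + b - 1) = t powr (a + b - 2) * t"
      using True powr_add[of t "a + b - 2" 1] by simp
    then show ?thesis
    using True G by (simp add: rl_kernel_def Beta_def add.commute field_simps)
  qed
  finally show ?thesis
    using True lborel_has_bochner_integral_real_affine_iff[where t=0 and c=t and f="?g"] by simp
qed

text \<open>For \<open>\<beta> < 1\<close> the kernel blows up at 0 like t^(\<beta>-1). The factor 1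
  - exp(-bt), at most bt for t >= 0, cancels this and leaves a bound of order t^\<beta>. It is the
  factor that appears when a damped term of the series is subtracted from the undamped one.\<close>

lemma continuous_on_rl_kernel_damped:
  assumes "0 < \<beta>" "0 \<le> b"
  shows "continuous_on UNIV (\<lambda>t. rl_kernel \<beta> t * (1 - exp (- b * t)))"
proof -
  let ?k = "\<lambda>t. rl_kernel \<beta> t * (1 - exp (- b * t))"
  have Gnz: "Gamma \<beta> \<noteq> 0" using Gamma_real_pos[OF assms(1)] by simp
  have "continuous_on {0..} ?k"
    unfolding continuous_on_eq_continuous_within
  proof
    fix x :: real assume "x \<in> {0..}"
    then consider "x = 0" | "x > 0" by force
    then show "continuous (at x within {0..}) ?k"
    proof cases
      case 1
      have "((\<lambda>t. b * t powr \<beta> / Gamma \<beta>) \<longlongrightarrow> b * 0 powr \<beta> / Gamma \<beta>) (at 0 within {0..})"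
        using assms Gnz by (intro tendsto_intros tendsto_powr2) (auto simp: eventually_at_topological)
      then have lim: "((\<lambda>t. b * t powr \<beta> / Gamma \<beta>) \<longlongrightarrow> 0) (at 0 within {0..})" by simp
      have "(?k \<longlongrightarrow> 0) (at 0 within {0..})"
      proof (rule Lim_null_comparison[OF _ lim])
        have "norm (?k t) \<le> b * t powr \<beta> / Gamma \<beta>" if t: "t \<ge> 0" for t
        proof (cases "t = 0")
          case False
          with t have t: "t > 0" by simp
          have "1 - exp (- b * t) \<le> b * t" using exp_ge_add_one_self[of "- b * t"] by simp
          moreover have "0 \<le> 1 - exp (- b * t)" using assms t by simp
          ultimately have "norm (?k t) \<le> rl_kernel \<beta> t * (b * t)"
            using rl_kernel_nonneg[OF assms(1), of t] by (simp add: abs_mult mult_left_mono)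
          also have "t powr \<beta> = t powr (\<beta> - 1) * t" using t powr_add[of t "\<beta> - 1" 1] by simp
          then have "rl_kernel \<beta> t * (b * t) = b * t powr \<beta> / Gamma \<beta>" using t by (simp add: rl_kernel_def)
          finally show ?thesis .
        qed (auto simp: rl_kernel_def)
        then show "\<forall>\<^sub>F t in at 0 within {0..}. norm (?k t) \<le> b * t powr \<beta> / Gamma \<beta>"
          by (auto simp: eventually_at_filter)
      qed
      then show ?thesis using 1 by (simp add: continuous_within rl_kernel_def)
    next
      case 2
      have ev: "\<forall>\<^sub>F t in nhds x. ?k t = t powr (\<beta> - 1) / Gamma \<beta> * (1 - exp (- b * t))"
        using eventually_nhds_in_open[OF open_greaterThan, of x 0] 2
        by (auto simp: rl_kernel_def elim!: eventually_mono)
      moreover have "isCont (\<lambda>t. t powr (\<beta> - 1) / Gamma \<beta> * (1 - exp (- b * t))) x"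
        using 2 assms Gnz by (intro continuous_intros) auto
      ultimately have "isCont ?k x" using isCont_cong[OF ev] by simp
      then show ?thesis by (rule continuous_at_imp_continuous_at_within)
    qed
  qed
  moreover have "continuous_on {..0} ?k"
    by (rule continuous_on_eq[OF continuous_on_const[of _ 0]]) (auto simp: rl_kernel_def)
  ultimately have "continuous_on ({..0} \<union> {0..}) ?k" by (intro continuous_on_closed_Un) auto
  moreover have "{..0} \<union> {0..} = (UNIV :: real set)" by auto
  ultimately show ?thesis by simp
qed

text \<open>For \<open>b = 0\<close> the sum below is the resolvent of \<open>D\<^sup>\<alpha> x(t) = l x(t - \<tau>)\<close>, with Laplace transform
  \<open>1 / (s\<^sup>\<alpha> - l e\<^sup>-\<^sup>s\<^sup>\<tau>)\<close>. A positive \<open>b\<close> replaces \<open>s\<^sup>\<alpha>\<close> by \<open>(s + b)\<^sup>\<alpha>\<close> and makes it integrable for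
  trivial reasons once \<open>b\<^sup>\<alpha> > \<bar>l\<bar>\<close>, while keeping the same singularities at the multiples of \<open>\<tau>\<close>.\<close>

definition delay_ml_term :: "real \<Rightarrow> real \<Rightarrow> complex \<Rightarrow> real \<Rightarrow> nat \<Rightarrow> real \<Rightarrow> complex" where
  "delay_ml_term \<alpha> \<tau> l b j t =
     l ^ j * of_real (exp (- b * (t - real j * \<tau>)) * rl_kernel (real (Suc j) * \<alpha>) (t - real j * \<tau>))"

definition delay_ml :: "real \<Rightarrow> real \<Rightarrow> complex \<Rightarrow> real \<Rightarrow> real \<Rightarrow> complex" where
  "delay_ml \<alpha> \<tau> l b t = (\<Sum>j. delay_ml_term \<alpha> \<tau> l b j t)"

lemma delay_ml_term_eq_0: "t \<le> real j * \<tau> \<Longrightarrow> delay_ml_term \<alpha> \<tau> l b j t = 0"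
  by (simp add: delay_ml_term_def rl_kernel_def)

lemma delay_ml_finite:
  assumes "0 < \<tau>" "t \<le> real n * \<tau>"
  shows "(\<lambda>j. delay_ml_term \<alpha> \<tau> l b j t) sums (\<Sum>j<n. delay_ml_term \<alpha> \<tau> l b j t)"
    and "delay_ml \<alpha> \<tau> l b t = (\<Sum>j<n. delay_ml_term \<alpha> \<tau> l b j t)"
proof -
  show *: "(\<lambda>j. delay_ml_term \<alpha> \<tau> l b j t) sums (\<Sum>j<n. delay_ml_term \<alpha> \<tau> l b j t)"
  proof (rule sums_finite)
    fix j assume "j \<notin> {..<n}"
    then have "real n * \<tau> \<le> real j * \<tau>" using assms by simp
    then show "delay_ml_term \<alpha> \<tau> l b j t = 0" using assms by (intro delay_ml_term_eq_0) linarith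
  qed auto
  show "delay_ml \<alpha> \<tau> l b t = (\<Sum>j<n. delay_ml_term \<alpha> \<tau> l b j t)"
    unfolding delay_ml_def using sums_unique[OF *] by simp
qed

lemma ex_delay_steps: "0 < (\<tau>::real) \<Longrightarrow> \<exists>n::nat. t < real n * \<tau>"
  using reals_Archimedean2[of "t / \<tau>"] by (auto simp: field_simps)

lemma delay_ml_nonpos: "0 < \<tau> \<Longrightarrow> t \<le> 0 \<Longrightarrow> delay_ml \<alpha> \<tau> l b t = 0"
  using delay_ml_finite(2)[of \<tau> t 0] by simp

lemma delay_ml_term_measurable [measurable]: "delay_ml_term \<alpha> \<tau> l b j \<in> borel_measurable borel"
  unfolding delay_ml_term_def by measurable

lemma delay_ml_measurable [measurable]: "delay_ml \<alpha> \<tau> l b \<in> borel_measurable borel"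
  unfolding delay_ml_def by measurable

text \<open>Term \<open>j\<close> transforms into a multiple of the \<open>j\<close>-th power of q =
  l exp(-\<sigma>\<tau>) / (\<sigma>+b)^\<alpha>, so the transformed series is geometric, and
  \<open>small\<close> is the condition |q| < 1. For positive b with b^\<alpha> > |l| it admits
  \<sigma> = 0, which makes the damped series integrable.\<close>

lemma delay_ml_laplace:
  assumes \<alpha>: "0 < \<alpha>" and \<tau>: "0 < \<tau>" and sb: "0 < \<sigma> + b"
    and small: "cmod l * exp (- \<sigma> * \<tau>) < (\<sigma> + b) powr \<alpha>"
  shows "has_bochner_integral lborel (\<lambda>t. of_real (exp (- \<sigma> * t)) * delay_ml \<alpha> \<tau> l b t)
     (1 / (of_real ((\<sigma> + b) powr \<alpha>) - l * of_real (exp (- \<sigma> * \<tau>))))"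
proof -
  let ?f = "\<lambda>j t. of_real (exp (- \<sigma> * t)) * delay_ml_term \<alpha> \<tau> l b j t"
  let ?P = "(\<sigma> + b) powr \<alpha>"
  let ?q = "l * of_real (exp (- \<sigma> * \<tau>) / ?P)"
  have P: "?P > 0" using sb by simp
  have I: "has_bochner_integral lborel (\<lambda>t. exp (- \<sigma> * t) * (exp (- b * (t - real j * \<tau>)) * rl_kernel (real (Suc j) * \<alpha>) (t - real j * \<tau>)))
      (exp (- \<sigma> * (real j * \<tau>)) * (\<sigma> + b) powr (- (real (Suc j) * \<alpha>)))" (is "has_bochner_integral _ (?g j) (?I j)") for j
  proof -
    have "has_bochner_integral lborel (\<lambda>t. exp (- (\<sigma> + b) * t) * rl_kernel (real (Suc j) * \<alpha>) t) ((\<sigma> + b) powr (- (real (Suc j) * \<alpha>)))"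
      using \<alpha> sb by (intro rl_kernel_laplace) auto
    then have "has_bochner_integral lborel (\<lambda>t. exp (- (\<sigma> + b) * (- (real j * \<tau>) + 1 * t)) * rl_kernel (real (Suc j) * \<alpha>) (- (real j * \<tau>) + 1 * t)) ((\<sigma> + b) powr (- (real (Suc j) * \<alpha>)))"
      using lborel_has_bochner_integral_real_affine_iff[of 1 "\<lambda>t. exp (- (\<sigma> + b) * t) * rl_kernel (real (Suc j) * \<alpha>) t" _ "- (real j * \<tau>)"] by simp
    then have "has_bochner_integral lborel (\<lambda>t. exp (- \<sigma> * (real j * \<tau>)) * (exp (- (\<sigma> + b) * (- (real j * \<tau>) + 1 * t)) * rl_kernel (real (Suc j) * \<alpha>) (- (real j * \<tau>) + 1 * t))) (?I j)"
      by (rule has_bochner_integral_mult_right)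
    also have "(\<lambda>t. exp (- \<sigma> * (real j * \<tau>)) * (exp (- (\<sigma> + b) * (- (real j * \<tau>) + 1 * t)) * rl_kernel (real (Suc j) * \<alpha>) (- (real j * \<tau>) + 1 * t))) = ?g j"
      by (rule ext, simp add: mult.assoc[symmetric] exp_add[symmetric]) (simp add: algebra_simps)
    finally show ?thesis .
  qed
  have Ieq: "?I j = (1 / ?P) * (exp (- \<sigma> * \<tau>) / ?P) ^ j" for j
  proof -
    have "(\<sigma> + b) powr (real (Suc j) * \<alpha>) = ?P * ?P ^ j"
      unfolding powr_realpow[OF P, symmetric] powr_powr powr_add[symmetric] by (simp add: algebra_simps)
    then have "(\<sigma> + b) powr (- (real (Suc j) * \<alpha>)) = inverse ?P * inverse (?P ^ j)"
      by (simp add: powr_minus)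
    moreover have "exp (- \<sigma> * (real j * \<tau>)) = exp (- \<sigma> * \<tau>) ^ j"
      by (simp add: exp_of_nat_mult[symmetric] mult_ac)
    ultimately show ?thesis by (simp add: field_simps)
  qed
  have g0: "?g j t \<ge> 0" for j t using rl_kernel_nonneg[of "real (Suc j) * \<alpha>"] \<alpha> by simp
  have f_eq: "?f j t = l ^ j * of_real (?g j t)" for j t
    by (simp add: delay_ml_term_def)
  have hf: "has_bochner_integral lborel (?f j) (1 / of_real ?P * ?q ^ j)" for j
  proof -
    have "has_bochner_integral lborel (\<lambda>t. l ^ j * of_real (?g j t)) (l ^ j * of_real (?I j))"
      by (intro has_bochner_integral_mult_right has_bochner_integral_of_real I)
    then show ?thesis unfolding f_eq Ieq by (simp add: power_mult_distrib field_simps)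
  qed
  have nf: "norm (?f j t) = cmod l ^ j * ?g j t" for j t
    unfolding f_eq norm_mult norm_power norm_of_real using g0 by simp
  have q: "cmod ?q < 1"
    using small P by (simp add: norm_mult norm_divide field_simps)
  have inf: "(\<integral>t. norm (?f j t) \<partial>lborel) = (1 / ?P) * cmod ?q ^ j" for j
  proof -
    have "(\<integral>t. norm (?f j t) \<partial>lborel) = cmod l ^ j * ?I j"
      unfolding nf using has_bochner_integral_integral_eq[OF I[of j]] by simp
    also have "\<dots> = (1 / ?P) * cmod ?q ^ j"
      unfolding Ieq using P by (simp add: norm_mult norm_divide power_mult_distrib field_simps)
    finally show ?thesis .
  qed
  \<comment> \<open>For fixed \<open>t\<close> the terms that start after \<open>t\<close> vanish,
    so the sum is finite; the geometric bound is what makes the integrals of the norms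
    summable.\<close>
  have s1: "AE t in lborel. summable (\<lambda>j. norm (?f j t))"
  proof (rule AE_I2)
    fix t
    obtain n where "t < real n * \<tau>" using ex_delay_steps[OF \<tau>] by blast
    have "norm (?f j t) = 0" if "j \<notin> {..<n}" for j
    proof -
      have "real n * \<tau> \<le> real j * \<tau>" using that \<tau> by simp
      then show ?thesis using \<open>t < real n * \<tau>\<close> by (simp add: delay_ml_term_eq_0)
    qed
    then show "summable (\<lambda>j. norm (?f j t))"
      by (intro summable_finite[of "{..<n}"]) auto
  qed
  have s2: "summable (\<lambda>j. \<integral>t. norm (?f j t) \<partial>lborel)"
    unfolding inf using q by (intro summable_mult summable_geometric) auto
  have fi: "integrable lborel (?f j)" for j using hf[of j] by (simp add: has_bochner_integral_iff)
  have suminf_eq: "(\<lambda>t. \<Sum>j. ?f j t) = (\<lambda>t. of_real (exp (- \<sigma> * t)) * delay_ml \<alpha> \<tau> l b t)"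
  proof
    fix t
    obtain n where "t < real n * \<tau>" using ex_delay_steps[OF \<tau>] by blast
    then show "(\<Sum>j. ?f j t) = of_real (exp (- \<sigma> * t)) * delay_ml \<alpha> \<tau> l b t"
      unfolding delay_ml_def
      by (intro suminf_mult sums_summable[OF delay_ml_finite(1)[OF \<tau> less_imp_le[of t "real n * \<tau>"]]])
  qed
  have "(\<lambda>j. \<integral>t. ?f j t \<partial>lborel) sums (\<integral>t. (\<Sum>j. ?f j t) \<partial>lborel)"
    by (rule sums_integral[OF fi s1 s2])
  moreover have "(\<lambda>j. \<integral>t. ?f j t \<partial>lborel) sums (1 / of_real ?P * (1 / (1 - ?q)))"
    unfolding has_bochner_integral_integral_eq[OF hf] using q by (intro sums_mult geometric_sums) auto
  ultimately have "(\<integral>t. (\<Sum>j. ?f j t) \<partial>lborel) = 1 / of_real ?P * (1 / (1 - ?q))" by (rule sums_unique2)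
  also have "\<dots> = 1 / (of_real ?P - l * of_real (exp (- \<sigma> * \<tau>)))"
    using P by (simp add: field_simps)
  finally show ?thesis
    using integrable_suminf[OF fi s1 s2] unfolding suminf_eq by (simp add: has_bochner_integral_iff)
qed

text \<open>Near any \<open>t\<close> both series are finite sums, and the difference of the terms
  starting at j\<tau> carries the factor 1 - exp(-b(t - j\<tau>)), which removes the singularity
  there. The series themselves may be unbounded near such a point.\<close>

lemma continuous_delay_ml_diff:
  assumes "0 < \<alpha>" "0 < \<tau>" "0 \<le> b"
  shows "continuous_on UNIV (\<lambda>t. delay_ml \<alpha> \<tau> l 0 t - delay_ml \<alpha> \<tau> l b t)"
  unfolding continuous_on_eq_continuous_at[OF open_UNIV]
proof
  fix t :: real
  obtain n where n: "t < real n * \<tau>" using ex_delay_steps[OF assms(2)] by blast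
  let ?s = "\<lambda>t. \<Sum>j<n. l ^ j * of_real (rl_kernel (real (Suc j) * \<alpha>) (t - real j * \<tau>) * (1 - exp (- b * (t - real j * \<tau>))))"
  have ev: "\<forall>\<^sub>F u in nhds t. delay_ml \<alpha> \<tau> l 0 u - delay_ml \<alpha> \<tau> l b u = ?s u"
  proof (rule eventually_mono[OF eventually_nhds_in_open[OF open_lessThan]])
    show "t \<in> {..<real n * \<tau>}" using n by simp
    fix u assume u: "u \<in> {..<real n * \<tau>}"
    then have "delay_ml \<alpha> \<tau> l c u = (\<Sum>j<n. delay_ml_term \<alpha> \<tau> l c j u)" for c
      by (intro delay_ml_finite(2)[OF assms(2)]) simp
    then show "delay_ml \<alpha> \<tau> l 0 u - delay_ml \<alpha> \<tau> l b u = ?s u"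
      by (simp add: delay_ml_term_def algebra_simps flip: sum_subtractf)
  qed
  have k: "isCont (\<lambda>t. rl_kernel (real (Suc j) * \<alpha>) (t - real j * \<tau>) * (1 - exp (- b * (t - real j * \<tau>)))) t" for j
  proof -
    have "continuous_on UNIV (\<lambda>t. rl_kernel (real (Suc j) * \<alpha>) (t - real j * \<tau>) * (1 - exp (- b * (t - real j * \<tau>))))"
      by (rule continuous_on_compose2[OF continuous_on_rl_kernel_damped]) (use assms in \<open>auto intro!: continuous_intros\<close>)
    then show ?thesis by (simp add: continuous_on_eq_continuous_at)
  qed
  have "isCont ?s t" by (intro continuous_sum continuous_mult continuous_const continuous_of_real k)
  then show "isCont (\<lambda>t. delay_ml \<alpha> \<tau> l 0 t - delay_ml \<alpha> \<tau> l b t) t"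
    using isCont_cong[OF ev] by simp
qed

section \<open>Inversion of the Laplace transform and decay\<close>

lemma integrable_powr_tail:
  assumes "1 < \<beta>"
  shows "integrable lborel (\<lambda>x::real. indicator {1..} x * (x powr (- \<beta>)))"
proof -
  have "has_bochner_integral lborel (\<lambda>x. indicator {1..} x * (x powr (- \<beta>))) (- (1 powr (- \<beta> + 1)) / (- \<beta> + 1))"
    by (intro has_bochner_integral_HK_nonneg has_integral_powr_to_inf)
       (use assms in \<open>auto simp: set_borel_measurable_def divide_nonneg_neg\<close>)
  then show ?thesis by (simp add: has_bochner_integral_iff)
qed

lemma integrable_norm_line_powr_1:
  assumes "1 < \<beta>"
  shows "integrable lborel (\<lambda>\<omega>. cmod (Complex 1 \<omega>) powr (- \<beta>))"
proof -
  note i1 = integrable_powr_tail[OF assms]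
  have i2: "integrable lborel (\<lambda>x::real. indicator {1..} (-x) * ((-x) powr (- \<beta>)))"
    using lborel_integrable_real_affine[of "\<lambda>x::real. indicator {1..} x * (x powr (- \<beta>))" "-1" 0] i1 by simp
  have i3: "integrable lborel (\<lambda>x::real. indicator {-1..1} x :: real)" by simp
  show ?thesis
  proof (rule Bochner_Integration.integrable_bound[OF Bochner_Integration.integrable_add[OF Bochner_Integration.integrable_add[OF i1 i2] i3]])
    show "AE x in lborel. norm (cmod (Complex 1 x) powr - \<beta>)
       \<le> norm (indicator {1..} x * x powr - \<beta> + indicator {1..} (- x) * (- x) powr - \<beta> + indicator {-1..1} x)"
    proof (rule AE_I2)
      fix x :: real
      have a: "\<bar>x\<bar> \<le> cmod (Complex 1 x)" using abs_Im_le_cmod[of "Complex 1 x"] by simp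
      have b: "1 \<le> cmod (Complex 1 x)" using abs_Re_le_cmod[of "Complex 1 x"] by simp
      consider "x \<ge> 1" | "x \<le> -1" | "-1 \<le> x" "x \<le> 1" by linarith
      then show "norm (cmod (Complex 1 x) powr - \<beta>)
       \<le> norm (indicator {1..} x * x powr - \<beta> + indicator {1..} (- x) * (- x) powr - \<beta> + indicator {-1..1} x)"
      proof cases
        case 1
        then have "cmod (Complex 1 x) powr - \<beta> \<le> x powr - \<beta>" using a assms by (intro powr_mono2') auto
        then show ?thesis using 1 by (auto simp: indicator_def)
      next
        case 2
        then have "cmod (Complex 1 x) powr - \<beta> \<le> (-x) powr - \<beta>" using a assms by (intro powr_mono2') auto
        then show ?thesis using 2 by (auto simp: indicator_def)
      next
        case 3
        then have "cmod (Complex 1 x) powr - \<beta> \<le> 1 powr - \<beta>" using b assms by (intro powr_mono2') auto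
        moreover have "0 \<le> indicator {1..} x * x powr - \<beta> + indicator {1..} (- x) * (- x) powr - \<beta>" by simp
        ultimately show ?thesis using 3 by (simp del: add_nonneg_nonneg)
      qed
    qed
  qed (simp add: cmod_def)
qed

text \<open>Scaling \<omega> by \<open>c\<close>. The factor c^(1-\<beta>) is the source of the
  decay rates: at c = 1/t it becomes t^(\<beta>-1).\<close>

lemma line_powr_integral:
  assumes "1 < \<beta>" "0 < c"
  shows "has_bochner_integral lborel (\<lambda>\<omega>. cmod (Complex c \<omega>) powr (- \<beta>))
     (c powr (1 - \<beta>) * (LINT \<omega>|lborel. cmod (Complex 1 \<omega>) powr (- \<beta>)))"
proof -
  let ?g = "\<lambda>\<omega>. cmod (Complex c \<omega>) powr (- \<beta>)"
  have "Complex c (c * \<omega>) = of_real c * Complex 1 \<omega>" for \<omega> by (simp add: complex_eq_iff)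
  then have eq: "?g (0 + c * \<omega>) = c powr (- \<beta>) * cmod (Complex 1 \<omega>) powr (- \<beta>)" for \<omega>
    using assms by (simp add: norm_mult powr_mult)
  have "has_bochner_integral lborel (\<lambda>\<omega>. c powr (- \<beta>) * cmod (Complex 1 \<omega>) powr (- \<beta>))
     (c powr (- \<beta>) * (LINT \<omega>|lborel. cmod (Complex 1 \<omega>) powr (- \<beta>)))"
    by (intro has_bochner_integral_mult_right has_bochner_integral_integrable integrable_norm_line_powr_1 assms)
  then have "has_bochner_integral lborel (\<lambda>\<omega>. ?g (0 + c * \<omega>))
     ((c powr (1 - \<beta>) * (LINT \<omega>|lborel. cmod (Complex 1 \<omega>) powr (- \<beta>))) /\<^sub>R \<bar>c\<bar>)"
    unfolding eq using assms by (simp add: powr_diff powr_minus field_simps)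
  then show ?thesis
    using assms lborel_has_bochner_integral_real_affine_iff[where t=0 and c=c and f="?g"] by simp
qed

lemma exp_laplace:
  fixes z :: complex
  assumes "0 < Re z"
  shows "has_bochner_integral lborel (\<lambda>t. indicator {0..} t *\<^sub>R exp (- z * of_real t)) (1 / z)"
proof -
  have "has_bochner_integral lborel (\<lambda>t. indicator {0..} t * exp (- Re z * t)) (exp (- Re z * 0) / Re z)"
    by (intro has_bochner_integral_HK_nonneg has_integral_exp_minus_to_infinity)
       (use assms in \<open>auto simp: set_borel_measurable_def\<close>)
  then have i: "integrable lborel (\<lambda>t. indicator {0..} t * exp (- Re z * t))"
    by (simp add: has_bochner_integral_iff)
  have int: "integrable lborel (\<lambda>t. indicator {0..} t *\<^sub>R exp (- z * of_real t))"
    by (rule Bochner_Integration.integrable_bound[OF i]) (auto simp: indicator_def)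
  let ?G = "\<lambda>T. (LINT t|lborel. indicator {0..T} t *\<^sub>R exp (- z * of_real t))"
  have val: "?G T = (1 - exp (- z * of_real T)) / z" if "0 \<le> T" for T
  proof -
    have z: "z \<noteq> 0" using assms by auto
    have "((\<lambda>t. exp (- z * of_real t)) has_integral (- exp (- z * of_real T) / z) - (- exp (- z * of_real 0) / z)) {0..T}"
    proof (rule fundamental_theorem_of_calculus[OF that])
      fix t :: real
      have "((\<lambda>w. - exp (- z * w) / z) has_field_derivative exp (- z * of_real t)) (at (of_real t))"
        using z by (auto intro!: derivative_eq_intros)
      then show "((\<lambda>t. - exp (- z * of_real t) / z) has_vector_derivative exp (- z * of_real t)) (at t within {0..T})"
        by (rule has_vector_derivative_real_field)
    qed
    moreover have "set_integrable lborel {0..T} (\<lambda>t. exp (- z * of_real t))"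
      by (intro borel_integrable_atLeastAtMost' continuous_intros)
    ultimately show ?thesis
      using set_borel_integral_eq_integral(2) unfolding set_lebesgue_integral_def
      by (fastforce simp: has_integral_iff diff_divide_distrib)
  qed
  have "(?G \<longlongrightarrow> (LINT t|lborel. indicator {0..} t *\<^sub>R exp (- z * of_real t))) at_top"
  proof (rule integral_dominated_convergence_at_top[OF _ _ i])
    show "AE x in lborel. ((\<lambda>T. indicator {0..T} x *\<^sub>R exp (- z * of_real x)) \<longlongrightarrow> indicator {0..} x *\<^sub>R exp (- z * of_real x)) at_top"
    proof (rule AE_I2)
      fix x :: real
      have "\<forall>\<^sub>F T in at_top. indicator {0..T} x *\<^sub>R exp (- z * of_real x) = indicator {0..} x *\<^sub>R exp (- z * of_real x)"
        using eventually_ge_at_top[of x] by eventually_elim (auto simp: indicator_def)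
      then show "((\<lambda>T. indicator {0..T} x *\<^sub>R exp (- z * of_real x)) \<longlongrightarrow> indicator {0..} x *\<^sub>R exp (- z * of_real x)) at_top"
        by (rule tendsto_eventually)
    qed
  qed (auto simp: indicator_def intro!: always_eventually)
  moreover have "(?G \<longlongrightarrow> (1 - 0) / z) at_top"
  proof (rule Lim_transform_eventually)
    have "((\<lambda>T. exp (- z * of_real T)) \<longlongrightarrow> 0) at_top"
    proof (rule tendsto_norm_zero_cancel)
      have "((\<lambda>T. exp (- (Re z * T))) \<longlongrightarrow> 0) at_top"
        using assms by (intro filterlim_compose[OF exp_at_bot] filterlim_uminus_at_top[THEN iffD1] filterlim_tendsto_pos_mult_at_top[OF tendsto_const _ filterlim_ident])
      then show "((\<lambda>T. norm (exp (- z * of_real T))) \<longlongrightarrow> 0) at_top" by simp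
    qed
    then show "((\<lambda>T. (1 - exp (- z * of_real T)) / z) \<longlongrightarrow> (1 - 0) / z) at_top"
      using assms by (intro tendsto_intros) auto
    show "\<forall>\<^sub>F T in at_top. (1 - exp (- z * of_real T)) / z = ?G T"
      using eventually_ge_at_top[of 0] by eventually_elim (subst val, auto)
  qed
  ultimately have "(LINT t|lborel. indicator {0..} t *\<^sub>R exp (- z * of_real t)) = 1 / z"
    using tendsto_unique[OF trivial_limit_at_top_linorder] by simp blast
  with int show ?thesis by (simp add: has_bochner_integral_iff)
qed

lemma has_contour_integral_linepath_vertical:
  assumes "0 < R"
  shows "(G has_contour_integral I) (linepath (Complex c (-R)) (Complex c R)) \<longleftrightarrow>
     ((\<lambda>\<omega>. G (Complex c \<omega>) * \<i>) has_integral I) {-R..R}"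
proof -
  have "((\<lambda>z. G (of_real c + \<i> * z) * \<i>) has_contour_integral I) (linepath (of_real (-R)) (of_real R)) \<longleftrightarrow>
     ((\<lambda>\<omega>. G (of_real c + \<i> * of_real \<omega>) * \<i>) has_integral I) {-R..R}"
    using assms by (subst has_contour_integral_linepath_Reals_iff) auto
  moreover have "of_real c + \<i> * of_real \<omega> = Complex c \<omega>" for \<omega> by (simp add: complex_eq_iff)
  moreover have "G (linepath (Complex c (-R)) (Complex c R) x) * (Complex c R - Complex c (-R)) =
      G (of_real c + \<i> * linepath (of_real (-R)) (of_real R) x) * \<i> * (of_real R - of_real (-R))" for x
  proof -
    have "linepath (Complex c (-R)) (Complex c R) x = of_real c + \<i> * linepath (of_real (-R)) (of_real R) x"
      by (simp add: linepath_def complex_eq_iff algebra_simps)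
    moreover have "Complex c R - Complex c (-R) = \<i> * (of_real R - of_real (-R))" by (simp add: complex_eq_iff)
    ultimately show ?thesis by simp
  qed
  ultimately show ?thesis unfolding has_contour_integral_linepath by simp
qed

text \<open>Cauchy's formula on a growing rectangle to the right of the line. The far sides have
  length of order R while the integrand there is of order R^(-\<beta>-1), so only the vertical line
  survives. It is traversed downwards, which accounts for the denominator \<sigma> - s in place of s
  - \<sigma>.\<close>

lemma Cauchy_half_plane:
  fixes F :: "complex \<Rightarrow> complex"
  assumes hol: "F holomorphic_on {s. 0 < Re s}"
    and bound: "\<And>s. 0 < Re s \<Longrightarrow> cmod (F s) \<le> C * cmod s powr (- \<beta>)"
    and "1 < \<beta>" "0 < c" "c < \<sigma>"
  shows "has_bochner_integral lborel (\<lambda>\<omega>. F (Complex c \<omega>) / (of_real \<sigma> - Complex c \<omega>)) (2 * pi * F \<sigma>)"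
proof -
  let ?G = "\<lambda>s. F s / (s - of_real \<sigma>)"
  let ?g = "\<lambda>\<omega>. F (Complex c \<omega>) / (of_real \<sigma> - Complex c \<omega>)"
  have C0: "0 \<le> C"
  proof -
    have "0 \<le> cmod (F 1)" by simp
    also have "\<dots> \<le> C" using bound[of 1] by simp
    finally show ?thesis .
  qed
  have contF: "continuous_on {s. 0 < Re s} F" by (rule holomorphic_on_imp_continuous_on[OF hol])
  have contg: "continuous_on UNIV ?g"
  proof -
    have cC: "continuous_on UNIV (Complex c)" by (intro continuous_on_Complex continuous_intros)
    have "continuous_on UNIV (\<lambda>\<omega>. F (Complex c \<omega>))"
      by (rule continuous_on_compose2[OF contF cC]) (use assms in auto)
    then show ?thesis by (intro continuous_intros cC) (use assms in \<open>auto simp: complex_eq_iff\<close>)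
  qed
  have intg: "integrable lborel ?g"
  proof (rule Bochner_Integration.integrable_bound)
    show "integrable lborel (\<lambda>\<omega>. C / (\<sigma> - c) * cmod (Complex c \<omega>) powr (- \<beta>))"
      using line_powr_integral[OF assms(3,4)] by (auto simp: has_bochner_integral_iff)
    show "?g \<in> borel_measurable lborel" using borel_measurable_continuous_onI[OF contg] by simp
    show "AE x in lborel. norm (?g x) \<le> norm (C / (\<sigma> - c) * cmod (Complex c x) powr - \<beta>)"
    proof (rule AE_I2)
      fix x :: real
      have "\<sigma> - c \<le> cmod (of_real \<sigma> - Complex c x)"
        using complex_Re_le_cmod[of "of_real \<sigma> - Complex c x"] by simp
      moreover have "cmod (F (Complex c x)) \<le> C * cmod (Complex c x) powr - \<beta>" using bound[of "Complex c x"] assms by simp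
      ultimately have "norm (?g x) \<le> (C * cmod (Complex c x) powr - \<beta>) / (\<sigma> - c)"
        unfolding norm_divide using assms C0 by (intro frac_le) auto
      then show "norm (?g x) \<le> norm (C / (\<sigma> - c) * cmod (Complex c x) powr - \<beta>)" using assms C0 by simp
    qed
  qed
  let ?J = "\<lambda>R. (LINT \<omega>|lborel. indicator {-R..R} \<omega> *\<^sub>R ?g \<omega>)"
  have lim1: "(?J \<longlongrightarrow> integral\<^sup>L lborel ?g) at_top"
  proof (rule integral_dominated_convergence_at_top[OF _ _ integrable_norm[OF intg]])
    show "AE x in lborel. ((\<lambda>R. indicator {-R..R} x *\<^sub>R ?g x) \<longlongrightarrow> ?g x) at_top"
    proof (rule AE_I2)
      fix x :: real
      have "\<forall>\<^sub>F R in at_top. indicator {-R..R} x *\<^sub>R ?g x = ?g x"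
        using eventually_ge_at_top[of "\<bar>x\<bar>"] by eventually_elim (auto simp: indicator_def)
      then show "((\<lambda>R. indicator {-R..R} x *\<^sub>R ?g x) \<longlongrightarrow> ?g x) at_top"
        by (rule tendsto_eventually)
    qed
  qed (use intg in \<open>auto simp: indicator_def intro!: always_eventually\<close>)
  have est: "cmod (2 * pi * F \<sigma> - ?J R) \<le> C * R powr (- \<beta>) / R * (2 * (R + \<sigma>) + 2 * R)" if R: "R > 0" for R
  proof -
    \<comment> \<open>The right side is placed at R + \<sigma> so that all three far sides keep
      distance at least R from the pole \<sigma> as well as from the origin.\<close>
    define a1 a2 a3 a4 where "a1 = Complex c (-R)" and "a2 = Complex (R + \<sigma>) (-R)"
      and "a3 = Complex (R + \<sigma>) R" and "a4 = Complex c R"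
    have seg: "s \<in> closed_segment a1 a2 \<union> closed_segment a2 a3 \<union> closed_segment a3 a4 \<Longrightarrow>
        Re s \<ge> c \<and> R \<le> cmod s \<and> R \<le> cmod (s - of_real \<sigma>) \<and> s \<noteq> of_real \<sigma>" 
      and seg4: "s \<in> closed_segment a4 a1 \<Longrightarrow> Re s \<ge> c \<and> s \<noteq> of_real \<sigma>" for s
    proof -
      assume s: "s \<in> closed_segment a1 a2 \<union> closed_segment a2 a3 \<union> closed_segment a3 a4"
      have "Re s \<ge> c \<and> (\<bar>Im s\<bar> = R \<or> Re s = R + \<sigma>)"
        using s R assms by (auto simp: a1_def a2_def a3_def a4_def closed_segment_same_Im closed_segment_same_Re closed_segment_eq_real_ivl split: if_splits)
      then show "Re s \<ge> c \<and> R \<le> cmod s \<and> R \<le> cmod (s - of_real \<sigma>) \<and> s \<noteq> of_real \<sigma>"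
        using abs_Re_le_cmod[of s] abs_Re_le_cmod[of "s - of_real \<sigma>"] abs_Im_le_cmod[of s] abs_Im_le_cmod[of "s - of_real \<sigma>"] R assms
        by (auto simp: complex_eq_iff)
    next
      assume "s \<in> closed_segment a4 a1"
      then have "Re s = c" by (simp add: a4_def a1_def closed_segment_same_Re)
      then show "Re s \<ge> c \<and> s \<noteq> of_real \<sigma>" using assms by auto
    qed
    have contG: "continuous_on S ?G" if "\<And>s. s \<in> S \<Longrightarrow> Re s \<ge> c \<and> s \<noteq> of_real \<sigma>" for S
      by (intro continuous_intros continuous_on_subset[OF contF]) (use that assms in force)+
    have ci: "?G contour_integrable_on linepath a1 a2" "?G contour_integrable_on linepath a2 a3"
      "?G contour_integrable_on linepath a3 a4" "?G contour_integrable_on linepath a4 a1"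
      using seg seg4 assms by (auto intro!: contour_integrable_continuous_linepath contG)
    have rect: "rectpath a1 a3 = linepath a1 a2 +++ linepath a2 a3 +++ linepath a3 a4 +++ linepath a4 a1"
      by (simp add: rectpath_def Let_def a1_def a2_def a3_def a4_def)
    have "(?G has_contour_integral (2 * pi * \<i> * winding_number (rectpath a1 a3) (of_real \<sigma>) * F (of_real \<sigma>))) (rectpath a1 a3)"
    proof (rule Cauchy_integral_formula_convex_simple)
      show "convex {s. 0 < Re s}" by (rule convex_halfspace_Re_gt)
      show "of_real \<sigma> \<in> interior {s. 0 < Re s}" using assms by (simp add: interior_open open_halfspace_Re_gt)
      show "path_image (rectpath a1 a3) \<subseteq> {s. 0 < Re s} - {of_real \<sigma>}"
        using assms R by (subst path_image_rectpath) (auto simp: a1_def a3_def)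
    qed (use hol in auto)
    moreover have "winding_number (rectpath a1 a3) (of_real \<sigma>) = 1"
      using assms R by (intro winding_number_rectpath) (auto simp: a1_def a3_def in_box_complex_iff)
    ultimately have "contour_integral (rectpath a1 a3) ?G = 2 * pi * \<i> * F (of_real \<sigma>)"
      by (simp add: contour_integral_unique)
    then have sum: "contour_integral (linepath a1 a2) ?G + (contour_integral (linepath a2 a3) ?G +
        (contour_integral (linepath a3 a4) ?G + contour_integral (linepath a4 a1) ?G)) = 2 * pi * \<i> * F (of_real \<sigma>)"
      unfolding rect using ci by (simp add: contour_integrable_join)
    have left: "contour_integral (linepath a4 a1) ?G = \<i> * ?J R"
    proof -
      have "set_integrable lborel {-R..R} ?g"
        using intg by (simp add: set_integrable_def integrable_mult_indicator)
      then have "(?g has_integral ?J R) {-R..R}"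
        using set_borel_integral_eq_integral[of "{-R..R}" ?g]
        by (auto simp: has_integral_iff set_lebesgue_integral_def)
      then have "((\<lambda>\<omega>. - \<i> * ?g \<omega>) has_integral (- \<i> * ?J R)) {-R..R}" by (rule has_integral_mult_right)
      also have "(\<lambda>\<omega>. - \<i> * ?g \<omega>) = (\<lambda>\<omega>. ?G (Complex c \<omega>) * \<i>)"
      proof
        fix \<omega> :: real show "- \<i> * ?g \<omega> = ?G (Complex c \<omega>) * \<i>"
          using minus_divide_right[of "\<i> * F (Complex c \<omega>)" "of_real \<sigma> - Complex c \<omega>"] by (simp add: mult.commute)
      qed
      finally have "(?G has_contour_integral (- \<i> * ?J R)) (linepath a1 a4)"
        unfolding a1_def a4_def using has_contour_integral_linepath_vertical[OF R] by simp
      then have "(?G has_contour_integral - (- \<i> * ?J R)) (linepath a4 a1)"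
        using has_contour_integral_reversepath[OF valid_path_linepath, of ?G "- \<i> * ?J R" a1 a4]
        by (simp only: reversepath_linepath)
      then show ?thesis by (simp add: contour_integral_unique)
    qed
    define K where "K = C * R powr (- \<beta>) / R"
    have B: "cmod (?G s) \<le> K" if "s \<in> closed_segment a1 a2 \<union> closed_segment a2 a3 \<union> closed_segment a3 a4" for s
    proof -
      note s = seg[OF that]
      have "cmod (F s) \<le> C * cmod s powr - \<beta>" using bound[of s] s assms by simp
      also have "\<dots> \<le> C * R powr - \<beta>" using s R C0 assms by (intro mult_left_mono powr_mono2') auto
      finally show ?thesis unfolding norm_divide K_def using s R C0 by (intro frac_le) auto
    qed
    have K0: "0 \<le> K" using C0 R by (simp add: K_def)
    have n12: "a2 - a1 = of_real (R + \<sigma> - c)" "a3 - a2 = \<i> * of_real (2 * R)" "a4 - a3 = of_real (- (R + \<sigma> - c))"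
      by (simp_all add: a1_def a2_def a3_def a4_def complex_eq_iff)
    have nn: "cmod (a2 - a1) \<le> R + \<sigma>" "cmod (a3 - a2) \<le> 2 * R" "cmod (a4 - a3) \<le> R + \<sigma>"
      unfolding n12 norm_mult norm_of_real using assms R by auto
    have bd: "cmod (contour_integral (linepath a b) ?G) \<le> K * L"
      if "?G contour_integrable_on linepath a b" "cmod (b - a) \<le> L"
        "closed_segment a b \<subseteq> closed_segment a1 a2 \<union> closed_segment a2 a3 \<union> closed_segment a3 a4" for a b L
    proof -
      have "cmod (contour_integral (linepath a b) ?G) \<le> K * cmod (b - a)"
        using contour_integral_bound_linepath[OF that(1) K0 B] that(3) by blast
      also have "\<dots> \<le> K * L" using that(2) K0 by (rule mult_left_mono)
      finally show ?thesis .
    qed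
    let ?X = "contour_integral (linepath a1 a2) ?G" and ?Y = "contour_integral (linepath a2 a3) ?G"
      and ?Z = "contour_integral (linepath a3 a4) ?G"
    have b1: "cmod ?X \<le> K * (R + \<sigma>)" by (rule bd[OF ci(1) nn(1)]) auto
    have b2: "cmod ?Y \<le> K * (2 * R)" by (rule bd[OF ci(2) nn(2)]) auto
    have b3: "cmod ?Z \<le> K * (R + \<sigma>)" by (rule bd[OF ci(3) nn(3)]) auto
    have XYZ: "\<i> * (2 * pi * F \<sigma> - ?J R) = ?X + (?Y + ?Z)"
      using sum unfolding left by (simp add: algebra_simps)
    have "cmod (2 * pi * F \<sigma> - ?J R) = cmod (\<i> * (2 * pi * F \<sigma> - ?J R))"
      by (simp only: norm_mult[of \<i>] norm_ii mult_1)
    also have "\<dots> = cmod (?X + (?Y + ?Z))" by (simp only: XYZ)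
    also have "\<dots> \<le> cmod ?X + (cmod ?Y + cmod ?Z)"
      by (rule order_trans[OF norm_triangle_ineq add_left_mono[OF norm_triangle_ineq]])
    also have "\<dots> \<le> K * (R + \<sigma>) + (K * (2 * R) + K * (R + \<sigma>))" by (intro add_mono b1 b2 b3)
    also have "\<dots> = K * (2 * (R + \<sigma>) + 2 * R)" by (simp add: algebra_simps)
    finally show ?thesis by (simp only: K_def)
  qed
  have "((\<lambda>R. 2 * pi * F \<sigma> - ?J R) \<longlongrightarrow> 0) at_top"
  proof (rule Lim_null_comparison)
    show "\<forall>\<^sub>F R in at_top. cmod (2 * pi * F \<sigma> - ?J R) \<le> C * R powr (- \<beta>) / R * (2 * (R + \<sigma>) + 2 * R)"
      using eventually_gt_at_top[of 0] by eventually_elim (rule est)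
    have "((\<lambda>R. C * R powr (- \<beta>) * (4 + 2 * \<sigma> * (1 / R))) \<longlongrightarrow> C * 0 * (4 + 2 * \<sigma> * 0)) at_top"
      using assms by (intro tendsto_intros tendsto_neg_powr filterlim_ident tendsto_divide_0[OF tendsto_const] filterlim_at_top_imp_at_infinity) auto
    then have lim0: "((\<lambda>R. C * R powr (- \<beta>) * (4 + 2 * \<sigma> * (1 / R))) \<longlongrightarrow> 0) at_top" by simp
    show "((\<lambda>R. C * R powr (- \<beta>) / R * (2 * (R + \<sigma>) + 2 * R)) \<longlongrightarrow> 0) at_top"
    proof (rule Lim_transform_eventually[OF lim0])
      show "\<forall>\<^sub>F R in at_top. C * R powr (- \<beta>) * (4 + 2 * \<sigma> * (1 / R)) = C * R powr (- \<beta>) / R * (2 * (R + \<sigma>) + 2 * R)"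
        using eventually_gt_at_top[of 0] by eventually_elim (simp add: field_simps)
    qed
  qed
  then have "((\<lambda>R. 2 * pi * F \<sigma> - (2 * pi * F \<sigma> - ?J R)) \<longlongrightarrow> 2 * pi * F \<sigma> - 0) at_top"
    by (intro tendsto_intros)
  then have "(?J \<longlongrightarrow> 2 * pi * F \<sigma>) at_top" by simp
  then have "integral\<^sup>L lborel ?g = 2 * pi * F \<sigma>"
    using tendsto_unique[OF trivial_limit_at_top_linorder lim1] by simp
  with intg show ?thesis by (simp add: has_bochner_integral_iff)
qed

section \<open>The inversion integral on a vertical line\<close>

lemma continuous_on_Complex_line: "continuous_on UNIV (Complex c)"
  by (intro continuous_on_Complex continuous_intros)

lemma Complex_line_measurable [measurable]: "Complex c \<in> borel_measurable borel"
  by (rule borel_measurable_continuous_onI[OF continuous_on_Complex_line])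

lemma Complex_line_has_vector_derivative:
  "(Complex c has_vector_derivative \<i>) (at \<omega> within S)"
proof -
  have "Complex c = (\<lambda>\<omega>. of_real c + \<i> * of_real \<omega>)" by (auto simp: complex_eq_iff)
  then show ?thesis by (auto intro!: derivative_eq_intros)
qed

text \<open>Two powers are allowed because the second derivative of the transform is governed by one
  power near the origin and by another at infinity.\<close>

lemma integrable_on_line:
  fixes F :: "complex \<Rightarrow> complex"
  assumes "continuous_on {s. 0 < Re s} F"
    and bound: "\<And>s. 0 < Re s \<Longrightarrow> cmod (F s) \<le> C * (cmod s powr (- \<beta>1) + cmod s powr (- \<beta>2))"
    and "1 < \<beta>1" "1 < \<beta>2" "0 < c"
  shows "integrable lborel (\<lambda>\<omega>. F (Complex c \<omega>))"
proof (rule Bochner_Integration.integrable_bound)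
  show "integrable lborel (\<lambda>\<omega>. C * (cmod (Complex c \<omega>) powr (- \<beta>1) + cmod (Complex c \<omega>) powr (- \<beta>2)))"
    using line_powr_integral[OF assms(3,5)] line_powr_integral[OF assms(4,5)]
    by (auto simp: has_bochner_integral_iff)
  have "continuous_on UNIV (\<lambda>\<omega>. F (Complex c \<omega>))"
    by (rule continuous_on_compose2[OF assms(1) continuous_on_Complex_line]) (use assms in auto)
  then show "(\<lambda>\<omega>. F (Complex c \<omega>)) \<in> borel_measurable lborel"
    using borel_measurable_continuous_onI by simp
  show "AE \<omega> in lborel. norm (F (Complex c \<omega>)) \<le> norm (C * (cmod (Complex c \<omega>) powr (- \<beta>1) + cmod (Complex c \<omega>) powr (- \<beta>2)))"
  proof (rule AE_I2)
    fix \<omega> :: real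
    show "norm (F (Complex c \<omega>)) \<le> norm (C * (cmod (Complex c \<omega>) powr (- \<beta>1) + cmod (Complex c \<omega>) powr (- \<beta>2)))"
      using bound[of "Complex c \<omega>"] assms by (simp add: order_trans[OF _ abs_ge_self])
  qed
qed

text \<open>The Bromwich integral on the line with real part \<open>c\<close>, without its factor
  1/(2 pi); hence the 2 pi in the formulas below.\<close>

definition line_transform :: "(complex \<Rightarrow> complex) \<Rightarrow> real \<Rightarrow> real \<Rightarrow> complex" where
  "line_transform F c t = (LINT \<omega>|lborel. exp (Complex c \<omega> * of_real t) * F (Complex c \<omega>))"

lemma line_transform_integrable:
  fixes F :: "complex \<Rightarrow> complex"
  assumes int: "integrable lborel (\<lambda>\<omega>. F (Complex c \<omega>))"
  shows "integrable lborel (\<lambda>\<omega>. exp (Complex c \<omega> * of_real t) * F (Complex c \<omega>))"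
proof (rule Bochner_Integration.integrable_bound)
  show "integrable lborel (\<lambda>\<omega>. exp (c * t) *\<^sub>R F (Complex c \<omega>))" using int by simp
  show "(\<lambda>\<omega>. exp (Complex c \<omega> * of_real t) * F (Complex c \<omega>)) \<in> borel_measurable lborel"
    using borel_measurable_integrable[OF int] by measurable
qed (auto simp: norm_mult)

lemma line_transform_continuous:
  fixes F :: "complex \<Rightarrow> complex"
  assumes int: "integrable lborel (\<lambda>\<omega>. F (Complex c \<omega>))"
  shows "continuous_on S (line_transform F c)"
proof -
  have "isCont (line_transform F c) t" for t
    unfolding continuous_at_sequentially comp_def
  proof (intro allI impI)
    fix X assume X: "X \<longlonglongrightarrow> t"
    then obtain B where B: "\<And>n. \<bar>X n\<bar> \<le> B"
      using convergent_imp_Bseq[OF convergentI[OF X]] unfolding Bseq_def by auto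
    show "(\<lambda>n. line_transform F c (X n)) \<longlonglongrightarrow> line_transform F c t"
      unfolding line_transform_def
    proof (rule integral_dominated_convergence)
      show "integrable lborel (\<lambda>\<omega>. exp (\<bar>c\<bar> * B) * norm (F (Complex c \<omega>)))" using int by simp
      show "AE \<omega> in lborel. (\<lambda>n. exp (Complex c \<omega> * of_real (X n)) * F (Complex c \<omega>)) \<longlonglongrightarrow> exp (Complex c \<omega> * of_real t) * F (Complex c \<omega>)"
        by (intro AE_I2 tendsto_intros X)
      show "AE \<omega> in lborel. norm (exp (Complex c \<omega> * of_real (X n)) * F (Complex c \<omega>)) \<le> exp (\<bar>c\<bar> * B) * norm (F (Complex c \<omega>))" for n
      proof (rule AE_I2)
        fix \<omega> :: real
        have "c * X n \<le> \<bar>c\<bar> * \<bar>X n\<bar>" by (metis abs_ge_self abs_mult)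
        also have "\<dots> \<le> \<bar>c\<bar> * B" by (intro mult_left_mono B) auto
        finally show "norm (exp (Complex c \<omega> * of_real (X n)) * F (Complex c \<omega>)) \<le> exp (\<bar>c\<bar> * B) * norm (F (Complex c \<omega>))"
          by (simp add: norm_mult mult_right_mono)
      qed
    qed (use line_transform_integrable[OF int] in auto)
  qed
  then show ?thesis by (simp add: continuous_at_imp_continuous_on)
qed

lemma exp_kernel_measurable:
  fixes f g :: "real \<Rightarrow> complex"
  assumes [measurable]: "f \<in> borel_measurable borel" "g \<in> borel_measurable borel"
  shows "(\<lambda>p. indicator {0..} (snd p) *\<^sub>R (exp (- f (fst p) * of_real (snd p)) * g (fst p))) \<in> borel_measurable (lborel \<Otimes>\<^sub>M lborel)"
  by measurable

text \<open>By Fubini: for \<open>c < \<sigma>\<close> the integral over t of exp(-(\<sigma>-s)t) is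
  1/(\<sigma>-s), and what remains is the Cauchy integral of \<open>F\<close> over the line.\<close>

lemma line_transform_laplace:
  fixes F :: "complex \<Rightarrow> complex"
  assumes hol: "F holomorphic_on {s. 0 < Re s}"
    and bound: "\<And>s. 0 < Re s \<Longrightarrow> cmod (F s) \<le> C * cmod s powr (- \<beta>)"
    and \<beta>: "1 < \<beta>" and c: "0 < c" "c < \<sigma>"
  shows "has_bochner_integral lborel
    (\<lambda>t. indicator {0..} t *\<^sub>R (of_real (exp (- \<sigma> * t)) * line_transform F c t)) (2 * pi * F \<sigma>)"
proof -
  have int: "integrable lborel (\<lambda>\<omega>. F (Complex c \<omega>))"
    using integrable_on_line[OF holomorphic_on_imp_continuous_on[OF hol], of "C / 2" \<beta> \<beta> c] bound \<beta> c by simp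
  have Fm [measurable]: "(\<lambda>\<omega>. F (Complex c \<omega>)) \<in> borel_measurable borel"
    using borel_measurable_integrable[OF int] by simp
  let ?g = "\<lambda>\<omega> t. indicator {0..} t *\<^sub>R (exp (- (of_real \<sigma> - Complex c \<omega>) * of_real t) * F (Complex c \<omega>))"
  have inner: "has_bochner_integral lborel (?g \<omega>) (F (Complex c \<omega>) / (of_real \<sigma> - Complex c \<omega>))" for \<omega>
  proof -
    have "has_bochner_integral lborel (\<lambda>t. (indicator {0..} t *\<^sub>R exp (- (of_real \<sigma> - Complex c \<omega>) * of_real t)) * F (Complex c \<omega>))
       (1 / (of_real \<sigma> - Complex c \<omega>) * F (Complex c \<omega>))"
      by (intro has_bochner_integral_mult_left exp_laplace) (use c in auto)
    then show ?thesis by simp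
  qed
  have norm_inner: "(\<integral>t. norm (?g \<omega> t) \<partial>lborel) = norm (F (Complex c \<omega>)) / (\<sigma> - c)" for \<omega>
  proof -
    have "has_bochner_integral lborel (\<lambda>t. indicator {0..} t * exp (- (\<sigma> - c) * t)) (exp (- (\<sigma> - c) * 0) / (\<sigma> - c))"
      by (intro has_bochner_integral_HK_nonneg has_integral_exp_minus_to_infinity)
         (use c in \<open>auto simp: set_borel_measurable_def\<close>)
    then have hb: "has_bochner_integral lborel (\<lambda>t. (indicator {0..} t * exp (- (\<sigma> - c) * t)) * norm (F (Complex c \<omega>))) (exp (- (\<sigma> - c) * 0) / (\<sigma> - c) * norm (F (Complex c \<omega>)))"
      by (rule has_bochner_integral_mult_left)
    have eq: "(\<lambda>t. (indicator {0..} t * exp (- (\<sigma> - c) * t)) * norm (F (Complex c \<omega>))) = (\<lambda>t. norm (?g \<omega> t))"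
      by (auto simp: norm_mult algebra_simps)
    show ?thesis using has_bochner_integral_integral_eq[OF hb] unfolding eq by simp
  qed
  have joint: "integrable (lborel \<Otimes>\<^sub>M lborel) (case_prod ?g)"
  proof (rule lborel_pair.Fubini_integrable)
    have Lm: "(\<lambda>\<omega>. of_real \<sigma> - Complex c \<omega>) \<in> borel_measurable borel"
      by (intro borel_measurable_diff borel_measurable_const Complex_line_measurable)
    show "case_prod ?g \<in> borel_measurable (lborel \<Otimes>\<^sub>M lborel)"
      using exp_kernel_measurable[OF Lm Fm] by (simp only: case_prod_beta')
    have in1: "integrable lborel (\<lambda>\<omega>. norm (F (Complex c \<omega>)) / (\<sigma> - c))" using int by simp
    have eq1: "(\<lambda>\<omega>. \<integral>t. norm (case_prod ?g (\<omega>, t)) \<partial>lborel) = (\<lambda>\<omega>. norm (F (Complex c \<omega>)) / (\<sigma> - c))"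
      by (rule ext, subst prod.case, rule norm_inner)
    show "integrable lborel (\<lambda>\<omega>. \<integral>t. norm (case_prod ?g (\<omega>, t)) \<partial>lborel)"
      unfolding eq1 by (rule in1)
    show "AE \<omega> in lborel. integrable lborel (\<lambda>t. case_prod ?g (\<omega>, t))"
      unfolding case_prod_conv by (rule AE_I2, rule integrable.intros, rule inner)
  qed
  have eq: "(\<integral>\<omega>. ?g \<omega> t \<partial>lborel) = indicator {0..} t *\<^sub>R (of_real (exp (- \<sigma> * t)) * line_transform F c t)" for t
  proof -
    have geq: "?g \<omega> t = indicator {0..} t *\<^sub>R (of_real (exp (- \<sigma> * t)) * (exp (Complex c \<omega> * of_real t) * F (Complex c \<omega>)))" for \<omega>
    proof -
      have "- (of_real \<sigma> - Complex c \<omega>) * of_real t = of_real (- \<sigma> * t) + Complex c \<omega> * of_real t"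
        by (simp add: algebra_simps)
      then have "exp (- (of_real \<sigma> - Complex c \<omega>) * of_real t) = of_real (exp (- \<sigma> * t)) * exp (Complex c \<omega> * of_real t)"
        by (simp only: exp_add exp_of_real)
      then show ?thesis by (simp only: mult.assoc)
    qed
    show ?thesis unfolding line_transform_def geq
      by (simp only: integral_scaleR_right integral_mult_right_zero)
  qed
  have "(\<integral>t. (\<integral>\<omega>. ?g \<omega> t \<partial>lborel) \<partial>lborel) = (\<integral>\<omega>. (\<integral>t. ?g \<omega> t \<partial>lborel) \<partial>lborel)"
    by (rule lborel_pair.Fubini_integral[OF joint])
  also have "\<dots> = 2 * pi * F \<sigma>"
    using has_bochner_integral_integral_eq[OF inner] Cauchy_half_plane[OF hol bound \<beta> c]
    by (simp add: has_bochner_integral_iff)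
  finally show ?thesis
    using lborel_pair.integrable_snd[OF joint] unfolding eq by (simp add: has_bochner_integral_iff)
qed

text \<open>The weight exp(-\<sigma>t) makes \<open>u\<close> integrable, so the real version
  applies to the weighted real and imaginary parts; \<open>pr\<close> in the proof stands for
  \<open>Re\<close> or \<open>Im\<close>.\<close>

lemma Lerch_complex:
  fixes u :: "real \<Rightarrow> complex"
  assumes cont: "continuous_on {0..} u"
    and lap: "\<And>k::nat. has_bochner_integral lborel (\<lambda>t. indicator {0..} t *\<^sub>R (of_real (exp (- (\<sigma> + real k) * t)) * u t)) 0"
    and t: "0 \<le> t"
  shows "u t = 0"
proof -
  have main: "exp (- \<sigma> * t) * pr (u t) = 0" if pr: "bounded_linear pr" and prc: "\<And>a z. pr (of_real a * z) = a * pr z" for pr :: "complex \<Rightarrow> real"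
  proof (rule Lerch_real[where u = "\<lambda>t. exp (- \<sigma> * t) * pr (u t)", OF _ _ _ t])
    show "continuous_on {0..} (\<lambda>t. exp (- \<sigma> * t) * pr (u t))"
      by (intro continuous_intros bounded_linear.continuous_on[OF pr] cont)
    have *: "has_bochner_integral lborel (\<lambda>t. indicator {0..} t *\<^sub>R (exp (- (\<sigma> + real k) * t) * pr (u t))) 0" for k :: nat
    proof -
      have "pr (a *\<^sub>R (of_real b * z)) = a *\<^sub>R (b * pr z)" for a b z
        unfolding linear_scale[OF bounded_linear.linear[OF pr]] prc ..
      then show ?thesis
        using has_bochner_integral_bounded_linear[OF pr lap[of k]]
        by (simp only: linear_0[OF bounded_linear.linear[OF pr]])
    qed
    show "set_integrable lborel {0..} (\<lambda>t. exp (- \<sigma> * t) * pr (u t))"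
      using integrable.intros[OF *[of 0]] by (simp only: set_integrable_def of_nat_0 add_0_right)
    show "(LINT t:{0..}|lborel. exp (- real k * t) * (exp (- \<sigma> * t) * pr (u t))) = 0" for k
    proof -
      have "exp (- real k * t) * (exp (- \<sigma> * t) * pr (u t)) = exp (- (\<sigma> + real k) * t) * pr (u t)" for t
        by (subst mult.assoc[symmetric], subst exp_add[symmetric]) (simp add: algebra_simps)
      then show ?thesis by (simp only: set_lebesgue_integral_def has_bochner_integral_integral_eq[OF *])
    qed
  qed
  from main[OF bounded_linear_Re] main[OF bounded_linear_Im] show ?thesis by (simp add: complex_eq_iff)
qed

text \<open>Both integrations by parts are done at once: as a function of s, exp(st)(t F - F') has
  derivative exp(st)(t^2 F - F''). The boundary values at both ends of the line vanish by the decay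
  of F and F', while of F'' only integrability on the line is used.\<close>

lemma line_transform_by_parts:
  fixes F :: "complex \<Rightarrow> complex"
  assumes hol: "F holomorphic_on {s. 0 < Re s}"
    and b0: "\<And>s. 0 < Re s \<Longrightarrow> cmod (F s) \<le> C * cmod s powr (- \<beta>)"
    and b1: "\<And>s. 0 < Re s \<Longrightarrow> cmod (deriv F s) \<le> C * cmod s powr (- \<beta>)"
    and b2: "\<And>s. 0 < Re s \<Longrightarrow> cmod (deriv (deriv F) s) \<le> C * (cmod s powr (- \<beta>1) + cmod s powr (- \<beta>2))"
    and \<beta>: "1 < \<beta>" "1 < \<beta>1" "1 < \<beta>2" and c: "0 < c"
  shows "of_real (t\<^sup>2) * line_transform F c t = line_transform (deriv (deriv F)) c t"
proof -
  let ?H = "{s. 0 < Re s}"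
  have op: "open ?H" by (rule open_halfspace_Re_gt)
  have hol1: "deriv F holomorphic_on ?H" and hol2: "deriv (deriv F) holomorphic_on ?H"
    using hol by (auto intro!: holomorphic_deriv op)
  have i0: "integrable lborel (\<lambda>\<omega>. F (Complex c \<omega>))"
    using integrable_on_line[OF holomorphic_on_imp_continuous_on[OF hol], of "C / 2" \<beta> \<beta> c] b0 \<beta> c by simp
  have i2: "integrable lborel (\<lambda>\<omega>. deriv (deriv F) (Complex c \<omega>))"
    using integrable_on_line[OF holomorphic_on_imp_continuous_on[OF hol2] b2] \<beta> c by simp
  let ?P = "\<lambda>\<omega>. exp (Complex c \<omega> * of_real t) * (of_real t * F (Complex c \<omega>) - deriv F (Complex c \<omega>))"
  let ?p = "\<lambda>\<omega>. \<i> * (exp (Complex c \<omega> * of_real t) * (of_real (t\<^sup>2) * F (Complex c \<omega>)) - exp (Complex c \<omega> * of_real t) * deriv (deriv F) (Complex c \<omega>))"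
  have ip: "integrable lborel ?p"
    using line_transform_integrable[OF i0, of t] line_transform_integrable[OF i2, of t]
    by (simp add: mult.left_commute)
  have "(LBINT \<omega>=-\<infinity>..\<infinity>. ?p \<omega>) = 0 - 0"
  proof (rule interval_integral_FTC_integrable)
    fix \<omega> :: real
    have s: "Complex c \<omega> \<in> ?H" using c by simp
    have d0: "(F has_field_derivative deriv F (Complex c \<omega>)) (at (Complex c \<omega>))"
      by (rule holomorphic_derivI[OF hol op s])
    have d1: "(deriv F has_field_derivative deriv (deriv F) (Complex c \<omega>)) (at (Complex c \<omega>))"
      by (rule holomorphic_derivI[OF hol1 op s])
    have "((\<lambda>s. exp (s * of_real t) * (of_real t * F s - deriv F s)) has_field_derivative
       (exp (Complex c \<omega> * of_real t) * (of_real (t\<^sup>2) * F (Complex c \<omega>)) - exp (Complex c \<omega> * of_real t) * deriv (deriv F) (Complex c \<omega>))) (at (Complex c \<omega>))"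
      by (auto intro!: derivative_eq_intros d0 d1 simp: algebra_simps power2_eq_square)
    from field_vector_diff_chain_at[OF Complex_line_has_vector_derivative this]
    show "(?P has_vector_derivative ?p \<omega>) (at \<omega>)" by (simp add: comp_def)
    have cl: "isCont (Complex c) \<omega>" using continuous_on_Complex_line by (simp add: continuous_on_eq_continuous_at)
    have cc: "isCont (\<lambda>\<omega>. G (Complex c \<omega>)) \<omega>" if "G holomorphic_on ?H" for G :: "complex \<Rightarrow> complex"
      using isCont_o2[OF cl, of G] holomorphic_on_imp_continuous_on[OF that] s op
      by (simp add: continuous_on_eq_continuous_at)
    show "isCont ?p \<omega>" by (intro continuous_intros cc hol hol2 cl)
  next
    show "set_integrable lborel (einterval (-\<infinity>) \<infinity>) ?p" using ip by (simp add: set_integrable_def)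
    \<comment> \<open>One argument for both ends of the line: \<open>F0\<close> will be
      \<open>at_bot\<close> and \<open>at_top\<close>.\<close>
    have lim: "(?P \<longlongrightarrow> 0) F0" if F0: "filterlim (\<lambda>\<omega>. \<bar>\<omega>\<bar>) at_top F0" for F0
    proof (rule Lim_null_comparison)
      have "((\<lambda>\<omega>. exp (c * t) * (\<bar>t\<bar> + 1) * C * \<bar>\<omega>\<bar> powr (- \<beta>)) \<longlongrightarrow> exp (c * t) * (\<bar>t\<bar> + 1) * C * 0) F0"
        using \<beta> by (intro tendsto_intros tendsto_neg_powr F0) auto
      then show "((\<lambda>\<omega>. exp (c * t) * (\<bar>t\<bar> + 1) * C * \<bar>\<omega>\<bar> powr (- \<beta>)) \<longlongrightarrow> 0) F0" by simp
      have "\<forall>\<^sub>F \<omega> in F0. 1 \<le> \<bar>\<omega>\<bar>" using F0 by (simp add: filterlim_at_top)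
      then show "\<forall>\<^sub>F \<omega> in F0. norm (?P \<omega>) \<le> exp (c * t) * (\<bar>t\<bar> + 1) * C * \<bar>\<omega>\<bar> powr (- \<beta>)"
      proof eventually_elim
        case (elim \<omega>)
        let ?s = "Complex c \<omega>"
        have C0: "0 \<le> C" using b0[of 1] norm_ge_zero[of "F 1"] by (simp del: norm_ge_zero)
        have "cmod ?s powr (- \<beta>) \<le> \<bar>\<omega>\<bar> powr (- \<beta>)"
          using abs_Im_le_cmod[of ?s] elim \<beta> by (intro powr_mono2') auto
        then have C: "C * cmod ?s powr (- \<beta>) \<le> C * \<bar>\<omega>\<bar> powr (- \<beta>)" using C0 by (rule mult_left_mono)
        have "norm (of_real t * F ?s - deriv F ?s) \<le> \<bar>t\<bar> * cmod (F ?s) + cmod (deriv F ?s)"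
          using norm_triangle_ineq4[of "of_real t * F ?s" "deriv F ?s"] by (simp add: norm_mult)
        also have "\<dots> \<le> \<bar>t\<bar> * (C * \<bar>\<omega>\<bar> powr (- \<beta>)) + C * \<bar>\<omega>\<bar> powr (- \<beta>)"
          using b0[of ?s] b1[of ?s] c C by (intro add_mono mult_left_mono) auto
        also have "\<dots> = (\<bar>t\<bar> + 1) * C * \<bar>\<omega>\<bar> powr (- \<beta>)" by (simp add: algebra_simps)
        finally have "exp (c * t) * norm (of_real t * F ?s - deriv F ?s) \<le> exp (c * t) * ((\<bar>t\<bar> + 1) * C * \<bar>\<omega>\<bar> powr (- \<beta>))"
          by (rule mult_left_mono) simp
        then show ?case by (simp add: norm_mult mult.assoc)
      qed
    qed
    show "((?P \<circ> real_of_ereal) \<longlongrightarrow> 0) (at_right (-\<infinity>))"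
      unfolding ereal_tendsto_simps
    proof (rule lim)
      show "filterlim (\<lambda>\<omega>::real. \<bar>\<omega>\<bar>) at_top at_bot"
        unfolding filterlim_at_top
      proof
        fix Z :: real
        show "\<forall>\<^sub>F \<omega> in at_bot. Z \<le> \<bar>\<omega>\<bar>"
          using eventually_le_at_bot[of "- Z"] by eventually_elim auto
      qed
    qed
    show "((?P \<circ> real_of_ereal) \<longlongrightarrow> 0) (at_left \<infinity>)"
      unfolding ereal_tendsto_simps by (rule lim[OF filterlim_abs_real])
  qed simp
  then have "(LINT \<omega>|lborel. ?p \<omega>) = 0"
    by (simp add: interval_lebesgue_integral_def set_lebesgue_integral_def)
  then have "\<i> * (of_real (t\<^sup>2) * line_transform F c t - line_transform (deriv (deriv F)) c t) = 0"
    unfolding line_transform_def using line_transform_integrable[OF i0, of t] line_transform_integrable[OF i2, of t]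
    by (simp add: mult.left_commute[of "exp _"] del: mult_eq_0_iff)
  then show ?thesis by simp
qed

text \<open>The inversion integral does not depend on the abscissa \<open>c\<close>; the decay comes from integrating
  by parts twice and taking \<open>c = 1 / t\<close>.\<close>

theorem laplace_decay:
  fixes F :: "complex \<Rightarrow> complex" and u :: "real \<Rightarrow> complex"
  assumes hol: "F holomorphic_on {s. 0 < Re s}"
    and b0: "\<And>s. 0 < Re s \<Longrightarrow> cmod (F s) \<le> C * cmod s powr (- \<beta>)"
    and b1: "\<And>s. 0 < Re s \<Longrightarrow> cmod (deriv F s) \<le> C * cmod s powr (- \<beta>)"
    and b2: "\<And>s. 0 < Re s \<Longrightarrow> cmod (deriv (deriv F) s) \<le> C * (cmod s powr (- \<beta>1) + cmod s powr (- \<beta>2))"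
    and \<beta>: "1 < \<beta>" "1 < \<beta>1" "1 < \<beta>2"
    and cont: "continuous_on {0..} u"
    and lap: "\<And>\<sigma>. \<sigma>0 \<le> \<sigma> \<Longrightarrow> has_bochner_integral lborel (\<lambda>t. indicator {0..} t *\<^sub>R (of_real (exp (- \<sigma> * t)) * u t)) (F \<sigma>)"
  shows "\<exists>K. \<forall>t\<ge>1. cmod (u t) \<le> K * (t powr (\<beta>1 - 3) + t powr (\<beta>2 - 3))"
    and "\<And>\<sigma>. 0 < \<sigma> \<Longrightarrow> has_bochner_integral lborel (\<lambda>t. indicator {0..} t *\<^sub>R (of_real (exp (- \<sigma> * t)) * u t)) (F \<sigma>)"
proof -
  have i0: "integrable lborel (\<lambda>\<omega>. F (Complex c \<omega>))" if "0 < c" for c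
    using integrable_on_line[OF holomorphic_on_imp_continuous_on[OF hol], of "C / 2" \<beta> \<beta> c] b0 \<beta> that by simp
  \<comment> \<open>The inversion integral and 2 pi u have the same transform at all large \<sigma>,
    so the uniqueness theorem identifies them. As this works for every positive \<open>c\<close>,
    the abscissa may later depend on t.\<close>
  have eq: "line_transform F c t = of_real (2 * pi) * u t" if c: "0 < c" and t: "0 \<le> t" for c t
  proof -
    have "line_transform F c t - of_real (2 * pi) * u t = 0"
    proof (rule Lerch_complex[where u = "\<lambda>t. line_transform F c t - of_real (2 * pi) * u t"
          and \<sigma> = "max \<sigma>0 (c + 1)", OF _ _ t])
      show "continuous_on {0..} (\<lambda>t. line_transform F c t - of_real (2 * pi) * u t)"
        by (intro continuous_intros cont line_transform_continuous i0 c)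
      fix k :: nat
      let ?\<sigma> = "max \<sigma>0 (c + 1) + real k"
      have "has_bochner_integral lborel (\<lambda>t. indicator {0..} t *\<^sub>R (of_real (exp (- ?\<sigma> * t)) * line_transform F c t)
           - of_real (2 * pi) * (indicator {0..} t *\<^sub>R (of_real (exp (- ?\<sigma> * t)) * u t)))
          (2 * pi * F ?\<sigma> - of_real (2 * pi) * F ?\<sigma>)"
        by (intro has_bochner_integral_diff has_bochner_integral_mult_right lap line_transform_laplace[OF hol b0 \<beta>(1) c]) auto
      then show "has_bochner_integral lborel (\<lambda>t. indicator {0..} t *\<^sub>R (of_real (exp (- ?\<sigma> * t)) * (line_transform F c t - of_real (2 * pi) * u t))) 0"
        by (simp add: algebra_simps)
    qed
    then show ?thesis by simp
  qed
  \<comment> \<open>Placing the line at \<sigma>/2 carries the transform formula from the abscissas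
    above \<open>\<sigma>0\<close> to every positive one.\<close>
  show "has_bochner_integral lborel (\<lambda>t. indicator {0..} t *\<^sub>R (of_real (exp (- \<sigma> * t)) * u t)) (F \<sigma>)" if "0 < \<sigma>" for \<sigma>
  proof -
    have "has_bochner_integral lborel (\<lambda>t. (1 / of_real (2 * pi)) * (indicator {0..} t *\<^sub>R (of_real (exp (- \<sigma> * t)) * line_transform F (\<sigma> / 2) t))) ((1 / of_real (2 * pi)) * (2 * pi * F \<sigma>))"
      by (intro has_bochner_integral_mult_right line_transform_laplace[OF hol b0 \<beta>(1)]) (use that in auto)
    moreover have "(\<lambda>t. (1 / of_real (2 * pi)) * (indicator {0..} t *\<^sub>R (of_real (exp (- \<sigma> * t)) * line_transform F (\<sigma> / 2) t))) = (\<lambda>t. indicator {0..} t *\<^sub>R (of_real (exp (- \<sigma> * t)) * u t))"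
    proof
      fix t
      show "(1 / of_real (2 * pi)) * (indicator {0..} t *\<^sub>R (of_real (exp (- \<sigma> * t)) * line_transform F (\<sigma> / 2) t)) = indicator {0..} t *\<^sub>R (of_real (exp (- \<sigma> * t)) * u t)"
        using that by (cases "0 \<le> t") (simp_all add: eq)
    qed
    ultimately show ?thesis by simp
  qed
  define I1 where "I1 = (LINT \<omega>|lborel. cmod (Complex 1 \<omega>) powr (- \<beta>1))"
  define I2 where "I2 = (LINT \<omega>|lborel. cmod (Complex 1 \<omega>) powr (- \<beta>2))"
  have I: "0 \<le> I1" "0 \<le> I2" by (simp_all add: I1_def I2_def)
  have C0: "0 \<le> C" using b0[of 1] norm_ge_zero[of "F 1"] by (simp del: norm_ge_zero)
  \<comment> \<open>\<open>exp 1\<close> is the modulus of exp(st) on the line with real part 1/t,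
    and \<open>2 * pi\<close> comes from the inversion formula.\<close>
  let ?K = "exp 1 * C * (I1 + I2) / (2 * pi)"
  have "cmod (u t) \<le> ?K * (t powr (\<beta>1 - 3) + t powr (\<beta>2 - 3))" if t: "1 \<le> t" for t
  proof -
    let ?c = "1 / t" and ?D = "deriv (deriv F)"
    have c: "0 < ?c" using t by simp
    have hol2: "?D holomorphic_on {s. 0 < Re s}"
      using hol by (auto intro!: holomorphic_deriv open_halfspace_Re_gt)
    have i2: "integrable lborel (\<lambda>\<omega>. ?D (Complex ?c \<omega>))"
      using integrable_on_line[OF holomorphic_on_imp_continuous_on[OF hol2] b2] \<beta> c by simp
    have bi: "has_bochner_integral lborel (\<lambda>\<omega>. exp 1 * C * (cmod (Complex ?c \<omega>) powr (- \<beta>1) + cmod (Complex ?c \<omega>) powr (- \<beta>2)))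
       (exp 1 * C * (?c powr (1 - \<beta>1) * I1 + ?c powr (1 - \<beta>2) * I2))"
      unfolding I1_def I2_def by (intro has_bochner_integral_mult_right has_bochner_integral_add line_powr_integral \<beta> c)
    have "t\<^sup>2 * (2 * pi * cmod (u t)) = cmod (of_real (t\<^sup>2) * line_transform F ?c t)"
      using eq[OF c, of t] t by (simp add: norm_mult norm_power)
    also have "\<dots> = cmod (line_transform ?D ?c t)"
      using line_transform_by_parts[OF hol b0 b1 b2 \<beta> c] by simp
    also have "\<dots> \<le> (LINT \<omega>|lborel. exp 1 * C * (cmod (Complex ?c \<omega>) powr (- \<beta>1) + cmod (Complex ?c \<omega>) powr (- \<beta>2)))"
      unfolding line_transform_def
    proof (rule Bochner_Integration.integral_norm_bound_integral)
      show "integrable lborel (\<lambda>\<omega>. exp (Complex ?c \<omega> * of_real t) * ?D (Complex ?c \<omega>))" by (rule line_transform_integrable[OF i2])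
      fix \<omega> :: real
      show "norm (exp (Complex ?c \<omega> * of_real t) * ?D (Complex ?c \<omega>)) \<le> exp 1 * C * (cmod (Complex ?c \<omega>) powr (- \<beta>1) + cmod (Complex ?c \<omega>) powr (- \<beta>2))"
        using b2[of "Complex ?c \<omega>"] c t by (simp add: norm_mult mult.assoc)
    qed (use bi in \<open>simp add: has_bochner_integral_iff\<close>)
    also have "\<dots> = exp 1 * C * (t powr (\<beta>1 - 1) * I1 + t powr (\<beta>2 - 1) * I2)"
      using has_bochner_integral_integral_eq[OF bi] t by (simp add: powr_divide powr_diff field_simps)
    also have "\<dots> \<le> exp 1 * C * ((t powr (\<beta>1 - 1) + t powr (\<beta>2 - 1)) * (I1 + I2))"
      using C0 I by (intro mult_left_mono) (auto simp: algebra_simps)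
    also have "\<dots> = t\<^sup>2 * (2 * pi * (?K * (t powr (\<beta>1 - 3) + t powr (\<beta>2 - 3))))"
    proof -
      have p: "t powr (b - 1) = t\<^sup>2 * t powr (b - 3)" for b
        using t powr_add[of t 2 "b - 3"] by simp
      show ?thesis unfolding p by (simp add: field_simps)
    qed
    finally have A: "t\<^sup>2 * (2 * pi * cmod (u t)) \<le> t\<^sup>2 * (2 * pi * (?K * (t powr (\<beta>1 - 3) + t powr (\<beta>2 - 3))))" .
    have "2 * pi * cmod (u t) \<le> 2 * pi * (?K * (t powr (\<beta>1 - 3) + t powr (\<beta>2 - 3)))"
      by (rule mult_left_le_imp_le[OF A]) (use t in simp)
    then show ?thesis by (rule mult_left_le_imp_le) simp
  qed
  then show "\<exists>K. \<forall>t\<ge>1. cmod (u t) \<le> K * (t powr (\<beta>1 - 3) + t powr (\<beta>2 - 3))" by blast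
qed

section \<open>The characteristic function\<close>

text \<open>The characteristic function for b = 0. The parameter b shifts only the fractional power
  and leaves the delay factor as it is.\<close>

definition delay_symbol :: "real \<Rightarrow> real \<Rightarrow> complex \<Rightarrow> real \<Rightarrow> complex \<Rightarrow> complex" where
  "delay_symbol \<alpha> \<tau> l b s = (s + of_real b) powr of_real \<alpha> - l * exp (- s * of_real \<tau>)"

lemma cmod_powr_of_real: "cmod (s powr of_real a) = cmod s powr a"
  by (simp add: norm_powr_real_powr')

lemma cmod_exp_delay_le: "0 \<le> Re s \<Longrightarrow> 0 \<le> \<tau> \<Longrightarrow> cmod (exp (- s * of_real \<tau>)) \<le> 1"
  by simp

text \<open>At a zero, l = exp(\<alpha> Ln s + s\<tau>). Since Re s >= 0, comparing moduli gives
  |s|^\<alpha> <= |l|, so the region bounds \<tau>|s| by |Arg l| - \<alpha> pi/2. Since |Arg s| <=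
  pi/2, the imaginary part of the exponent is then smaller in modulus than |Arg l|, which is at most
  pi. It must therefore be the principal argument of l, a contradiction.\<close>

lemma delay_symbol_nonzero:
  assumes \<alpha>: "0 < \<alpha>" "\<alpha> < 1" and \<tau>: "0 < \<tau>" and l: "l \<in> stability_region \<alpha> \<tau>" and s: "0 \<le> Re s"
  shows "delay_symbol \<alpha> \<tau> l 0 s \<noteq> 0"
proof
  assume eq: "delay_symbol \<alpha> \<tau> l 0 s = 0"
  let ?A = "\<bar>Arg l\<bar> - \<alpha> * pi / 2"
  have l0: "l \<noteq> 0" and lt: "cmod l < (?A / \<tau>) powr \<alpha>" and A: "0 < ?A" and Api: "\<bar>Arg l\<bar> \<le> pi"
    using l by (auto simp: stability_region_def)
  have s0: "s \<noteq> 0"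
  proof
    assume "s = 0" then show False using eq l0 \<alpha> by (simp add: delay_symbol_def)
  qed
  have "s powr of_real \<alpha> = l * exp (- s * of_real \<tau>)" using eq by (simp add: delay_symbol_def)
  then have "s powr of_real \<alpha> * exp (s * of_real \<tau>) = l" by (simp add: exp_minus field_simps)
  then have l_eq: "l = exp (of_real \<alpha> * Ln s + s * of_real \<tau>)"
    using s0 by (simp add: powr_def exp_add)
  have "cmod s powr \<alpha> * 1 \<le> cmod s powr \<alpha> * exp (Re s * \<tau>)" using s \<tau> by (intro mult_left_mono) auto
  also have "\<dots> = exp (\<alpha> * ln (cmod s) + Re s * \<tau>)" using s0 by (simp add: powr_def exp_add)
  also have "\<dots> = cmod l"
  proof -
    have "Re (of_real \<alpha> * Ln s + s * of_real \<tau>) = \<alpha> * ln (cmod s) + Re s * \<tau>" using s0 by simp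
    then show ?thesis by (simp only: l_eq norm_exp_eq_Re)
  qed
  also note lt
  finally have "cmod s powr \<alpha> < (?A / \<tau>) powr \<alpha>" by simp
  moreover have "0 < ?A / \<tau>" using A \<tau> by simp
  ultimately have sl: "cmod s < ?A / \<tau>" using s0 \<alpha>(1) by (smt (verit) powr_mono2 zero_less_norm_iff)
  let ?p = "\<alpha> * Im (Ln s) + Im s * \<tau>"
  have "\<bar>Im (Ln s)\<bar> \<le> pi / 2" using Re_Ln_pos_le[OF s0] s by simp
  then have "\<alpha> * \<bar>Im (Ln s)\<bar> \<le> \<alpha> * (pi / 2)" using \<alpha> by (intro mult_left_mono) auto
  moreover have "\<bar>Im s\<bar> * \<tau> < ?A"
  proof -
    have "\<bar>Im s\<bar> * \<tau> \<le> cmod s * \<tau>" using abs_Im_le_cmod \<tau> by (intro mult_right_mono) auto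
    also have "\<dots> < ?A" using sl \<tau> by (simp add: field_simps)
    finally show ?thesis .
  qed
  moreover have "\<bar>?p\<bar> \<le> \<alpha> * \<bar>Im (Ln s)\<bar> + \<bar>Im s\<bar> * \<tau>"
    using abs_triangle_ineq[of "\<alpha> * Im (Ln s)" "Im s * \<tau>"] \<alpha> \<tau> by (simp add: abs_mult)
  ultimately have p: "\<bar>?p\<bar> < \<bar>Arg l\<bar>" by simp
  then have "Arg l = ?p"
    unfolding l_eq using Api by (subst Arg_exp) (auto simp: l_eq[symmetric])
  with p show False by simp
qed

text \<open>On the half disc of radius \<open>M\<close> the absence of zeros and compactness give a
  positive minimum. \<open>M\<close> is chosen so that outside |s|^\<alpha> >= 2|l|, where the power
  dominates the delay term. The constant bound is meant for small s, the power bound for large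
  s.\<close>

lemma delay_symbol_lower_bound:
  assumes \<alpha>: "0 < \<alpha>" "\<alpha> < 1" and \<tau>: "0 < \<tau>" and l: "l \<in> stability_region \<alpha> \<tau>"
  shows "\<exists>\<kappa>>0. \<forall>s. 0 \<le> Re s \<longrightarrow> \<kappa> \<le> cmod (delay_symbol \<alpha> \<tau> l 0 s) \<and> \<kappa> * cmod s powr \<alpha> \<le> cmod (delay_symbol \<alpha> \<tau> l 0 s)"
proof -
  let ?e = "delay_symbol \<alpha> \<tau> l 0"
  have l0: "l \<noteq> 0" using l by (auto simp: stability_region_def)
  define M where "M = (2 * cmod l) powr (1 / \<alpha>)"
  have M\<alpha>: "M powr \<alpha> = 2 * cmod l" using \<alpha> by (simp add: M_def powr_powr)
  let ?K = "cball 0 M \<inter> {s. 0 \<le> Re s}"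
  have "continuous_on ?K (\<lambda>s. cmod (?e s))"
    unfolding delay_symbol_def using \<alpha> by (intro continuous_intros) auto
  moreover have "compact ?K" by (intro compact_Int_closed closed_halfspace_Re_ge) auto
  moreover have "0 \<in> ?K" by (simp add: M_def)
  then have "?K \<noteq> {}" by blast
  ultimately obtain s0 where s0: "s0 \<in> ?K" "\<And>s. s \<in> ?K \<Longrightarrow> cmod (?e s0) \<le> cmod (?e s)"
    using continuous_attains_inf[of ?K "\<lambda>s. cmod (?e s)"] by blast
  define k where "k = cmod (?e s0)"
  have k: "0 < k" using delay_symbol_nonzero[OF \<alpha> \<tau> l] s0(1) by (auto simp: k_def)
  have lp: "0 < cmod l" using l0 by simp
  have small: "k \<le> cmod (?e s) \<and> k / (2 * cmod l) * cmod s powr \<alpha> \<le> cmod (?e s)" if "s \<in> ?K" for s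
  proof -
    have "cmod s powr \<alpha> \<le> M powr \<alpha>" using that \<alpha> by (intro powr_mono2) auto
    then have "k / (2 * cmod l) * cmod s powr \<alpha> \<le> k / (2 * cmod l) * (2 * cmod l)"
      unfolding M\<alpha> using k by (intro mult_left_mono) auto
    also have "\<dots> = k" using l0 by simp
    finally show ?thesis using s0(2)[OF that] by (auto simp: k_def)
  qed
  have large: "cmod l \<le> cmod (?e s) \<and> 1 / 2 * cmod s powr \<alpha> \<le> cmod (?e s)" if "s \<notin> ?K" "0 \<le> Re s" for s
  proof -
    have "M < cmod s" using that by auto
    then have "M powr \<alpha> \<le> cmod s powr \<alpha>" using \<alpha> by (intro powr_mono2) (auto simp: M_def)
    then have a: "2 * cmod l \<le> cmod s powr \<alpha>" by (simp add: M\<alpha>)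
    have "cmod (l * exp (- s * of_real \<tau>)) \<le> cmod l * 1"
      unfolding norm_mult using cmod_exp_delay_le[OF that(2)] \<tau> by (intro mult_left_mono) auto
    moreover have "cmod (s powr of_real \<alpha>) - cmod (l * exp (- s * of_real \<tau>)) \<le> cmod (?e s)"
      unfolding delay_symbol_def using norm_triangle_ineq2 by simp
    ultimately show ?thesis using a by (auto simp: cmod_powr_of_real)
  qed
  define \<kappa> where "\<kappa> = min (min k (k / (2 * cmod l))) (min (cmod l) (1 / 2))"
  have k1: "\<kappa> \<le> k" "\<kappa> \<le> k / (2 * cmod l)" "\<kappa> \<le> cmod l" "\<kappa> \<le> 1 / 2" by (auto simp: \<kappa>_def)
  have "0 < \<kappa>" using k lp by (simp add: \<kappa>_def)
  moreover have "\<kappa> \<le> cmod (?e s) \<and> \<kappa> * cmod s powr \<alpha> \<le> cmod (?e s)" if "0 \<le> Re s" for s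
  proof (cases "s \<in> ?K")
    case True
    show ?thesis using small[OF True] k1(1) mult_right_mono[OF k1(2), of "cmod s powr \<alpha>"] by auto
  next
    case False
    show ?thesis using large[OF False that] k1(3) mult_right_mono[OF k1(4), of "cmod s powr \<alpha>"] by auto
  qed
  ultimately show ?thesis by blast
qed

text \<open>With b^\<alpha> = 2|l| the shifted power is at least twice the delay term on the whole
  closed half-plane, whatever the argument of l.\<close>

lemma damped_symbol_lower_bound:
  assumes \<alpha>: "0 < \<alpha>" and \<tau>: "0 < \<tau>" and b: "0 < b" "b powr \<alpha> = 2 * cmod l" and s: "0 \<le> Re s"
  shows "cmod l \<le> cmod (delay_symbol \<alpha> \<tau> l b s) \<and> 1 / 2 * cmod s powr \<alpha> \<le> cmod (delay_symbol \<alpha> \<tau> l b s)"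
proof -
  have "Re s + b \<le> cmod (s + of_real b)" using complex_Re_le_cmod[of "s + of_real b"] by simp
  then have "b \<le> cmod (s + of_real b)" using s by simp
  then have a: "2 * cmod l \<le> cmod (s + of_real b) powr \<alpha>"
    unfolding b(2)[symmetric] using \<alpha> b by (intro powr_mono2) auto
  have "cmod s \<le> cmod (s + of_real b)"
    unfolding cmod_def using s b by (intro real_sqrt_le_mono add_right_mono power_mono) auto
  then have c: "cmod s powr \<alpha> \<le> cmod (s + of_real b) powr \<alpha>" using \<alpha> by (intro powr_mono2) auto
  have "cmod (l * exp (- s * of_real \<tau>)) \<le> cmod l * 1"
    unfolding norm_mult using cmod_exp_delay_le[OF s] \<tau> by (intro mult_left_mono) auto
  moreover have "cmod ((s + of_real b) powr of_real \<alpha>) - cmod (l * exp (- s * of_real \<tau>)) \<le> cmod (delay_symbol \<alpha> \<tau> l b s)"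
    unfolding delay_symbol_def using norm_triangle_ineq2 by simp
  ultimately show ?thesis using a c by (auto simp: cmod_powr_of_real)
qed

section \<open>Derivatives of the symbol and differences of reciprocals\<close>

definition delay_symbol_d1 :: "real \<Rightarrow> real \<Rightarrow> complex \<Rightarrow> real \<Rightarrow> complex \<Rightarrow> complex" where
  "delay_symbol_d1 \<alpha> \<tau> l b s =
     of_real \<alpha> * (s + of_real b) powr of_real (\<alpha> - 1) + l * of_real \<tau> * exp (- s * of_real \<tau>)"

definition delay_symbol_d2 :: "real \<Rightarrow> real \<Rightarrow> complex \<Rightarrow> real \<Rightarrow> complex \<Rightarrow> complex" where
  "delay_symbol_d2 \<alpha> \<tau> l b s =
     of_real (\<alpha> * (\<alpha> - 1)) * (s + of_real b) powr of_real (\<alpha> - 2) - l * of_real (\<tau>\<^sup>2) * exp (- s * of_real \<tau>)"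

lemma delay_symbol_has_derivs:
  assumes "0 < Re s" "0 \<le> b"
  shows "(delay_symbol \<alpha> \<tau> l b has_field_derivative delay_symbol_d1 \<alpha> \<tau> l b s) (at s)"
    and "(delay_symbol_d1 \<alpha> \<tau> l b has_field_derivative delay_symbol_d2 \<alpha> \<tau> l b s) (at s)"
proof -
  have nn: "s + of_real b \<notin> \<real>\<^sub>\<le>\<^sub>0" using assms by (auto simp: complex_nonpos_Reals_iff)
  have pw: "((\<lambda>s. (s + of_real b) powr of_real a) has_field_derivative of_real a * (s + of_real b) powr of_real (a - 1)) (at s)" for a
  proof -
    have "((\<lambda>s. (s + of_real b) powr of_real a) has_field_derivative (of_real a * (s + of_real b) powr (of_real a - 1)) * 1) (at s)"
      by (rule DERIV_chain2[where f = "\<lambda>z. z powr of_real a" and g = "\<lambda>s. s + of_real b", OF has_field_derivative_powr[OF nn]])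
         (auto intro!: derivative_eq_intros)
    then show ?thesis by simp
  qed
  have ex: "((\<lambda>s. exp (- s * of_real \<tau>)) has_field_derivative - of_real \<tau> * exp (- s * of_real \<tau>)) (at s)"
    by (auto intro!: derivative_eq_intros)
  show "(delay_symbol \<alpha> \<tau> l b has_field_derivative delay_symbol_d1 \<alpha> \<tau> l b s) (at s)"
    unfolding delay_symbol_def[abs_def] delay_symbol_d1_def
    using DERIV_diff[OF pw[of \<alpha>] DERIV_cmult[OF ex, of l]] by (simp add: mult.assoc)
  have "\<alpha> - 1 - 1 = \<alpha> - 2" by simp
  then show "(delay_symbol_d1 \<alpha> \<tau> l b has_field_derivative delay_symbol_d2 \<alpha> \<tau> l b s) (at s)"
    unfolding delay_symbol_d1_def[abs_def] delay_symbol_d2_def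
    using DERIV_add[OF DERIV_cmult[OF pw[of "\<alpha> - 1"], of "of_real \<alpha>"] DERIV_cmult[OF ex, of "l * of_real \<tau>"]]
    by (simp add: mult.assoc power2_eq_square)
qed

lemma reciprocal_derivs:
  fixes e d :: "complex \<Rightarrow> complex"
  assumes "(e has_field_derivative d s) (at s)" "(d has_field_derivative dd) (at s)" "e s \<noteq> 0"
  shows "((\<lambda>s. 1 / e s) has_field_derivative - (d s * (1 / e s)\<^sup>2)) (at s)"
    and "((\<lambda>s. - (d s * (1 / e s)\<^sup>2)) has_field_derivative 2 * (d s)\<^sup>2 * (1 / e s) ^ 3 - dd * (1 / e s)\<^sup>2) (at s)"
proof -
  show 1: "((\<lambda>s. 1 / e s) has_field_derivative - (d s * (1 / e s)\<^sup>2)) (at s)"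
    using assms by (auto intro!: derivative_eq_intros simp: power2_eq_square)
  show "((\<lambda>s. - (d s * (1 / e s)\<^sup>2)) has_field_derivative 2 * (d s)\<^sup>2 * (1 / e s) ^ 3 - dd * (1 / e s)\<^sup>2) (at s)"
    by (rule derivative_eq_intros 1 assms refl)+ (simp add: algebra_simps power2_eq_square power3_eq_cube)
qed

text \<open>Pure algebra: \<open>Q\<close> stands for a reciprocal symbol, \<open>d\<close> and
  \<open>dd\<close> for derivatives of the symbol. Telescoping puts one difference into every
  summand. The differences of derivatives are small enough only together with two factors
  \<open>Qb\<close>, hence the weights in \<open>D\<close>.\<close>

lemma difference_bounds:
  fixes Q0 Qb d0 db dd0 ddb :: complex
  assumes Q: "cmod Q0 \<le> K" "cmod Qb \<le> K" "cmod (Q0 - Qb) \<le> m"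
    and d: "cmod d0 \<le> L" "cmod db \<le> L" "cmod dd0 \<le> L"
    and D: "(cmod Qb)\<^sup>2 * cmod (d0 - db) \<le> m" "(cmod Qb)\<^sup>2 * cmod (dd0 - ddb) \<le> m"
    and nn: "0 \<le> m"
  shows "cmod (- (d0 * Q0\<^sup>2) - - (db * Qb\<^sup>2)) \<le> (2 * K * L + 1) * m"
    and "cmod ((2 * d0\<^sup>2 * Q0 ^ 3 - dd0 * Q0\<^sup>2) - (2 * db\<^sup>2 * Qb ^ 3 - ddb * Qb\<^sup>2)) \<le> (6 * K\<^sup>2 * L\<^sup>2 + 4 * K * L + 2 * K * L + 1) * m"
proof -
  have K: "0 \<le> K" and L: "0 \<le> L" using Q(1) d(1) norm_ge_zero order_trans by blast+
  have sq: "cmod (Q0\<^sup>2 - Qb\<^sup>2) \<le> 2 * K * m"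
  proof -
    have "Q0\<^sup>2 - Qb\<^sup>2 = (Q0 + Qb) * (Q0 - Qb)" by (simp add: power2_eq_square algebra_simps)
    then have "cmod (Q0\<^sup>2 - Qb\<^sup>2) = cmod (Q0 + Qb) * cmod (Q0 - Qb)" by (simp only: norm_mult)
    also have "\<dots> \<le> (2 * K) * m"
      using Q norm_triangle_ineq[of Q0 Qb] K by (intro mult_mono) auto
    finally show ?thesis .
  qed
  have cb: "cmod (Q0 ^ 3 - Qb ^ 3) \<le> 3 * K\<^sup>2 * m"
  proof -
    have "Q0 ^ 3 - Qb ^ 3 = (Q0 * Q0 + Q0 * Qb + Qb * Qb) * (Q0 - Qb)" by (simp add: power3_eq_cube algebra_simps)
    then have "cmod (Q0 ^ 3 - Qb ^ 3) = cmod (Q0 * Q0 + Q0 * Qb + Qb * Qb) * cmod (Q0 - Qb)" by (simp only: norm_mult)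
    also have "\<dots> \<le> (3 * K\<^sup>2) * m"
    proof (intro mult_mono Q(3))
      have "cmod (Q0 * Q0 + Q0 * Qb + Qb * Qb) \<le> cmod (Q0 * Q0) + cmod (Q0 * Qb) + cmod (Qb * Qb)"
        by (intro norm_triangle_le order_refl add_right_mono norm_triangle_ineq)
      also have "\<dots> \<le> K * K + K * K + K * K" unfolding norm_mult using Q K by (intro add_mono mult_mono) auto
      finally show "cmod (Q0 * Q0 + Q0 * Qb + Qb * Qb) \<le> 3 * K\<^sup>2" by (simp add: power2_eq_square)
    qed (use K in auto)
    finally show ?thesis .
  qed
  have "- (d0 * Q0\<^sup>2) - - (db * Qb\<^sup>2) = - (d0 * (Q0\<^sup>2 - Qb\<^sup>2) + Qb\<^sup>2 * (d0 - db))" by (simp add: algebra_simps)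
  then have "cmod (- (d0 * Q0\<^sup>2) - - (db * Qb\<^sup>2)) = cmod (d0 * (Q0\<^sup>2 - Qb\<^sup>2) + Qb\<^sup>2 * (d0 - db))" by (simp only: norm_minus_cancel)
  also have "\<dots> \<le> cmod d0 * cmod (Q0\<^sup>2 - Qb\<^sup>2) + (cmod Qb)\<^sup>2 * cmod (d0 - db)"
    by (rule order_trans[OF norm_triangle_ineq]) (simp add: norm_mult norm_power)
  also have "\<dots> \<le> L * (2 * K * m) + m"
    using sq d D L by (intro add_mono mult_mono D) auto
  finally show "cmod (- (d0 * Q0\<^sup>2) - - (db * Qb\<^sup>2)) \<le> (2 * K * L + 1) * m" by (simp add: algebra_simps)
  let ?T1 = "2 * (d0\<^sup>2 * (Q0 ^ 3 - Qb ^ 3))" and ?T2 = "2 * (Qb ^ 3 * ((d0 - db) * (d0 + db)))"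
    and ?T3 = "dd0 * (Q0\<^sup>2 - Qb\<^sup>2)" and ?T4 = "Qb\<^sup>2 * (dd0 - ddb)"
  have "(2 * d0\<^sup>2 * Q0 ^ 3 - dd0 * Q0\<^sup>2) - (2 * db\<^sup>2 * Qb ^ 3 - ddb * Qb\<^sup>2) = (?T1 + ?T2) - (?T3 + ?T4)"
    by (simp add: algebra_simps power2_eq_square)
  then have "cmod ((2 * d0\<^sup>2 * Q0 ^ 3 - dd0 * Q0\<^sup>2) - (2 * db\<^sup>2 * Qb ^ 3 - ddb * Qb\<^sup>2)) = cmod ((?T1 + ?T2) - (?T3 + ?T4))"
    by (rule arg_cong)
  also have "\<dots> \<le> (cmod ?T1 + cmod ?T2) + (cmod ?T3 + cmod ?T4)"
    by (rule order_trans[OF norm_triangle_ineq4 add_mono[OF norm_triangle_ineq norm_triangle_ineq]])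
  also have "\<dots> \<le> (2 * (L\<^sup>2 * (3 * K\<^sup>2 * m)) + 2 * (K * m * (2 * L))) + (L * (2 * K * m) + m)"
  proof (intro add_mono)
    show "cmod ?T1 \<le> 2 * (L\<^sup>2 * (3 * K\<^sup>2 * m))"
    proof -
      have "(cmod d0)\<^sup>2 * cmod (Q0 ^ 3 - Qb ^ 3) \<le> L\<^sup>2 * (3 * K\<^sup>2 * m)"
        using cb d(1) L by (intro mult_mono power_mono) auto
      then show ?thesis by (simp add: norm_mult norm_power mult_ac)
    qed
    have "cmod Qb * ((cmod Qb)\<^sup>2 * cmod (d0 - db)) * cmod (d0 + db) \<le> K * m * (2 * L)"
      using Q D(1) K L nn d norm_triangle_ineq[of d0 db] by (intro mult_mono) auto
    then show "cmod ?T2 \<le> 2 * (K * m * (2 * L))"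
      unfolding norm_mult norm_power power3_eq_cube power2_eq_square by (simp add: mult_ac)
    show "cmod ?T3 \<le> L * (2 * K * m)" unfolding norm_mult using sq d L by (intro mult_mono) auto
    show "cmod ?T4 \<le> m" unfolding norm_mult norm_power by (rule D(2))
  qed
  also have "\<dots> = (6 * K\<^sup>2 * L\<^sup>2 + 4 * K * L + 2 * K * L + 1) * m" by (simp add: algebra_simps)
  finally show "cmod ((2 * d0\<^sup>2 * Q0 ^ 3 - dd0 * Q0\<^sup>2) - (2 * db\<^sup>2 * Qb ^ 3 - ddb * Qb\<^sup>2)) \<le> (6 * K\<^sup>2 * L\<^sup>2 + 4 * K * L + 2 * K * L + 1) * m" .
qed

text \<open>The mean value inequality on the segment from s to s + b. Moving to the right increases
  the modulus, and the exponent a - 1 is not positive, so the derivative is largest at s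
  itself.\<close>

lemma powr_line_difference:
  assumes "0 < Re s" "0 \<le> b" "a \<le> 1" "0 \<le> a"
  shows "cmod ((s + of_real b) powr of_real a - s powr of_real a) \<le> a * cmod s powr (a - 1) * b"
proof -
  have ge: "cmod s \<le> cmod z \<and> z \<notin> \<real>\<^sub>\<le>\<^sub>0" if z: "z \<in> closed_segment s (s + of_real b)" for z
  proof -
    obtain u where u: "0 \<le> u" "z = s + of_real (u * b)"
      using z by (auto simp: closed_segment_def algebra_simps scaleR_conv_of_real)
    have "0 \<le> u * b" using u assms by simp
    then have "cmod s \<le> cmod z"
      unfolding cmod_def u(2) using assms by (intro real_sqrt_le_mono add_right_mono power_mono) auto
    moreover have "Re z = Re s + u * b" by (simp add: u(2))
    then have "0 < Re z" using assms(1) \<open>0 \<le> u * b\<close> by linarith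
    ultimately show ?thesis by (auto simp: complex_nonpos_Reals_iff)
  qed
  have s0: "0 < cmod s" using assms(1) by auto
  have "cmod ((\<lambda>z. z powr of_real a) (s + of_real b) - (\<lambda>z. z powr of_real a) s) \<le> (a * cmod s powr (a - 1)) * cmod ((s + of_real b) - s)"
  proof (rule field_differentiable_bound[of "closed_segment s (s + of_real b)"])
    fix z assume z: "z \<in> closed_segment s (s + of_real b)"
    show "((\<lambda>z. z powr of_real a) has_field_derivative of_real a * z powr (of_real a - 1)) (at z within closed_segment s (s + of_real b))"
      by (rule DERIV_subset[OF has_field_derivative_powr]) (use ge[OF z] in auto)
    have "of_real a - 1 = (of_real (a - 1) :: complex)" by simp
    then have "norm (of_real a * z powr (of_real a - 1)) = a * cmod z powr (a - 1)"
      using assms by (simp only: norm_mult cmod_powr_of_real norm_of_real abs_of_nonneg)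
    also have "\<dots> \<le> a * cmod s powr (a - 1)"
      using ge[OF z] s0 assms by (intro mult_left_mono powr_mono2') auto
    finally show "norm (of_real a * z powr (of_real a - 1)) \<le> a * cmod s powr (a - 1)" .
  qed auto
  then show ?thesis using assms by simp
qed

lemma delay_symbol_d_bounds:
  assumes \<alpha>: "0 < \<alpha>" "\<alpha> < 1" and \<tau>: "0 < \<tau>" and s: "0 < Re s" and b: "0 \<le> b"
  shows "cmod (delay_symbol_d1 \<alpha> \<tau> l b s) \<le> cmod s powr (\<alpha> - 1) + cmod l * \<tau>"
    and "cmod (delay_symbol_d2 \<alpha> \<tau> l b s) \<le> cmod s powr (\<alpha> - 2) + cmod l * \<tau>\<^sup>2"
    and "cmod (delay_symbol_d1 \<alpha> \<tau> l 0 s - delay_symbol_d1 \<alpha> \<tau> l b s) \<le> 2 * cmod s powr (\<alpha> - 1)"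
    and "cmod (delay_symbol_d2 \<alpha> \<tau> l 0 s - delay_symbol_d2 \<alpha> \<tau> l b s) \<le> 2 * cmod s powr (\<alpha> - 2)"
proof -
  have s0: "0 < cmod s" using s by auto
  have le: "cmod s \<le> cmod (s + of_real b)" if "0 \<le> b" for b
    unfolding cmod_def using s that by (intro real_sqrt_le_mono add_right_mono power_mono) auto
  have E: "cmod (exp (- s * of_real \<tau>)) \<le> 1" using cmod_exp_delay_le[of s \<tau>] s \<tau> by simp
  have p1: "cmod (of_real \<alpha> * (s + of_real b) powr of_real (\<alpha> - 1)) \<le> cmod s powr (\<alpha> - 1)" if "0 \<le> b" for b
  proof -
    have "cmod (s + of_real b) powr (\<alpha> - 1) \<le> cmod s powr (\<alpha> - 1)" using le[OF that] s0 \<alpha> by (intro powr_mono2') auto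
    then have "\<alpha> * cmod (s + of_real b) powr (\<alpha> - 1) \<le> 1 * cmod s powr (\<alpha> - 1)" using \<alpha> by (intro mult_mono) auto
    then show ?thesis using \<alpha> by (simp only: norm_mult cmod_powr_of_real norm_of_real abs_of_pos mult_1)
  qed
  have p2: "cmod (of_real (\<alpha> * (\<alpha> - 1)) * (s + of_real b) powr of_real (\<alpha> - 2)) \<le> cmod s powr (\<alpha> - 2)" if "0 \<le> b" for b
  proof -
    have a1: "\<bar>\<alpha> * (\<alpha> - 1)\<bar> \<le> 1" using \<alpha> mult_le_one[of \<alpha> "1 - \<alpha>"] by (simp add: abs_mult)
    have "cmod (s + of_real b) powr (\<alpha> - 2) \<le> cmod s powr (\<alpha> - 2)" using le[OF that] s0 \<alpha> by (intro powr_mono2') auto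
    then have "\<bar>\<alpha> * (\<alpha> - 1)\<bar> * cmod (s + of_real b) powr (\<alpha> - 2) \<le> 1 * cmod s powr (\<alpha> - 2)"
      using a1 by (intro mult_mono) auto
    then show ?thesis by (simp only: norm_mult cmod_powr_of_real norm_of_real mult_1)
  qed
  have q1: "cmod (l * of_real \<tau> * exp (- s * of_real \<tau>)) \<le> cmod l * \<tau>"
    unfolding norm_mult norm_of_real using mult_left_mono[OF E, of "cmod l * \<tau>"] \<tau> by simp
  have q2: "cmod (l * of_real (\<tau>\<^sup>2) * exp (- s * of_real \<tau>)) \<le> cmod l * \<tau>\<^sup>2"
    unfolding norm_mult norm_of_real using mult_left_mono[OF E, of "cmod l * \<tau>\<^sup>2"] \<tau> by simp
  show "cmod (delay_symbol_d1 \<alpha> \<tau> l b s) \<le> cmod s powr (\<alpha> - 1) + cmod l * \<tau>"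
    unfolding delay_symbol_d1_def by (rule order_trans[OF norm_triangle_ineq add_mono[OF p1[OF b] q1]])
  show "cmod (delay_symbol_d2 \<alpha> \<tau> l b s) \<le> cmod s powr (\<alpha> - 2) + cmod l * \<tau>\<^sup>2"
    unfolding delay_symbol_d2_def by (rule order_trans[OF norm_triangle_ineq4 add_mono[OF p2[OF b] q2]])
  have "delay_symbol_d1 \<alpha> \<tau> l 0 s - delay_symbol_d1 \<alpha> \<tau> l b s =
     of_real \<alpha> * (s + of_real 0) powr of_real (\<alpha> - 1) - of_real \<alpha> * (s + of_real b) powr of_real (\<alpha> - 1)"
    by (simp only: delay_symbol_d1_def add_diff_cancel_right)
  also have "cmod \<dots> \<le> cmod s powr (\<alpha> - 1) + cmod s powr (\<alpha> - 1)"
    by (rule order_trans[OF norm_triangle_ineq4 add_mono[OF p1 p1[OF b]]]) simp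
  finally show "cmod (delay_symbol_d1 \<alpha> \<tau> l 0 s - delay_symbol_d1 \<alpha> \<tau> l b s) \<le> 2 * cmod s powr (\<alpha> - 1)" by simp
  have "delay_symbol_d2 \<alpha> \<tau> l 0 s - delay_symbol_d2 \<alpha> \<tau> l b s =
     of_real (\<alpha> * (\<alpha> - 1)) * (s + of_real 0) powr of_real (\<alpha> - 2) - of_real (\<alpha> * (\<alpha> - 1)) * (s + of_real b) powr of_real (\<alpha> - 2)"
    by (simp only: delay_symbol_d2_def diff_diff_eq2 diff_add_cancel)
  also have "cmod \<dots> \<le> cmod s powr (\<alpha> - 2) + cmod s powr (\<alpha> - 2)"
    by (rule order_trans[OF norm_triangle_ineq4 add_mono[OF p2 p2[OF b]]]) simp
  finally show "cmod (delay_symbol_d2 \<alpha> \<tau> l 0 s - delay_symbol_d2 \<alpha> \<tau> l b s) \<le> 2 * cmod s powr (\<alpha> - 2)" by simp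
qed

text \<open>The delay factor cancels in the difference of the two symbols, so the difference of the
  reciprocals gains a full power of \<open>s\<close> at infinity; this holds for no single reciprocal when
  \<open>\<alpha> \<le> 1 / 2\<close>.\<close>

lemma symbol_difference_bounds:
  assumes \<alpha>: "0 < \<alpha>" "\<alpha> < 1" and \<tau>: "0 < \<tau>" and l: "l \<in> stability_region \<alpha> \<tau>"
    and b: "0 < b" "b powr \<alpha> = 2 * cmod l"
  defines "F \<equiv> \<lambda>s. 1 / delay_symbol \<alpha> \<tau> l 0 s - 1 / delay_symbol \<alpha> \<tau> l b s"
  shows "F holomorphic_on {s. 0 < Re s}"
    and "\<exists>C. \<forall>s. 0 < Re s \<longrightarrow> cmod (F s) \<le> C * cmod s powr (- (1 + \<alpha>)) \<and>
        cmod (deriv F s) \<le> C * cmod s powr (- (1 + \<alpha>)) \<and>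
        cmod (deriv (deriv F) s) \<le> C * (cmod s powr (- (2 - \<alpha>)) + cmod s powr (- (1 + \<alpha>)))"
proof -
  let ?H = "{s. 0 < Re s}"
  let ?e = "delay_symbol \<alpha> \<tau> l" and ?d = "delay_symbol_d1 \<alpha> \<tau> l" and ?dd = "delay_symbol_d2 \<alpha> \<tau> l"
  let ?F1 = "\<lambda>s. - (?d 0 s * (1 / ?e 0 s)\<^sup>2) - - (?d b s * (1 / ?e b s)\<^sup>2)"
  let ?F2 = "\<lambda>s. (2 * (?d 0 s)\<^sup>2 * (1 / ?e 0 s) ^ 3 - ?dd 0 s * (1 / ?e 0 s)\<^sup>2) - (2 * (?d b s)\<^sup>2 * (1 / ?e b s) ^ 3 - ?dd b s * (1 / ?e b s)\<^sup>2)"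
  have op: "open ?H" by (rule open_halfspace_Re_gt)
  have lp: "0 < cmod l" using l by (auto simp: stability_region_def)
  obtain \<kappa>0 where \<kappa>0: "0 < \<kappa>0" "\<And>s. 0 \<le> Re s \<Longrightarrow> \<kappa>0 \<le> cmod (?e 0 s) \<and> \<kappa>0 * cmod s powr \<alpha> \<le> cmod (?e 0 s)"
    using delay_symbol_lower_bound[OF \<alpha> \<tau> l] by blast
  \<comment> \<open>One constant for both symbols: \<open>\<kappa>0\<close> serves the undamped one,
    |l| and 1/2 the damped one.\<close>
  define \<kappa> where "\<kappa> = min \<kappa>0 (min (cmod l) (1 / 2))"
  have \<kappa>: "0 < \<kappa>" "\<kappa> \<le> \<kappa>0" "\<kappa> \<le> cmod l" "\<kappa> \<le> 1 / 2" using \<kappa>0 lp by (auto simp: \<kappa>_def)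
  have low: "\<kappa> \<le> cmod (?e c s) \<and> \<kappa> * cmod s powr \<alpha> \<le> cmod (?e c s)" if c: "c = 0 \<or> c = b" and s: "0 < Re s" for c s
    using c
  proof
    assume "c = 0"
    then show ?thesis using \<kappa>0(2)[of s] s \<kappa>(2) mult_right_mono[OF \<kappa>(2), of "cmod s powr \<alpha>"] by auto
  next
    assume "c = b"
    then show ?thesis using damped_symbol_lower_bound[OF \<alpha>(1) \<tau> b, of s] s \<kappa>(3) mult_right_mono[OF \<kappa>(4), of "cmod s powr \<alpha>"] by auto
  qed
  define K where "K = 1 / \<kappa>"
  have K: "0 < K" using \<kappa> by (simp add: K_def)
  have nz: "?e c s \<noteq> 0" if "c = 0 \<or> c = b" "0 < Re s" for c s
    using low[OF that] \<kappa>(1) by auto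
  have Q: "cmod (1 / ?e c s) \<le> K" "cmod (1 / ?e c s) \<le> K * cmod s powr (- \<alpha>)" if "c = 0 \<or> c = b" "0 < Re s" for c s
  proof -
    have s0: "0 < cmod s powr \<alpha>" using that by auto
    have ep: "0 < cmod (?e c s)" using nz[OF that] by simp
    show "cmod (1 / ?e c s) \<le> K"
      unfolding norm_divide K_def norm_one using low[OF that] \<kappa>(1) ep by (intro divide_left_mono mult_pos_pos) auto
    have "cmod (1 / ?e c s) \<le> 1 / (\<kappa> * cmod s powr \<alpha>)"
      unfolding norm_divide norm_one using low[OF that] \<kappa>(1) s0 by (intro divide_left_mono mult_pos_pos) auto
    then show "cmod (1 / ?e c s) \<le> K * cmod s powr (- \<alpha>)" by (simp add: K_def powr_minus divide_simps)
  qed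
  have D1: "(F has_field_derivative ?F1 s) (at s)" if s: "0 < Re s" for s
    unfolding F_def using s b
    by (intro DERIV_diff reciprocal_derivs(1)[OF delay_symbol_has_derivs] nz) auto
  have D2: "(?F1 has_field_derivative ?F2 s) (at s)" if s: "0 < Re s" for s
    using s b by (intro DERIV_diff reciprocal_derivs(2)[OF delay_symbol_has_derivs] nz) auto
  show "F holomorphic_on ?H"
    unfolding holomorphic_on_open[OF op] using D1 by blast
  have dF: "deriv F s = ?F1 s" if "0 < Re s" for s by (rule DERIV_imp_deriv[OF D1[OF that]])
  have ddF: "deriv (deriv F) s = ?F2 s" if s: "0 < Re s" for s
  proof (rule DERIV_imp_deriv)
    show "(deriv F has_field_derivative ?F2 s) (at s)"
      by (rule has_field_derivative_transform_within_open[OF D2[OF s] op]) (use s dF in auto)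
  qed
  \<comment> \<open>\<open>L\<close> collects the coefficients of the derivative bounds. In
    \<open>M\<close> the factor \<open>b + 2\<close> dominates both b, from the mean value estimate
    of the powers, and 2, from the differences of the derivatives.\<close>
  define L where "L = 2 + cmod l * \<tau> + cmod l * \<tau>\<^sup>2"
  define M where "M = K\<^sup>2 * (b + 2)"
  have LM: "0 < L" "0 \<le> M" "0 \<le> cmod l * \<tau>" "0 \<le> cmod l * \<tau>\<^sup>2"
    using \<tau> b by (auto simp: L_def M_def intro!: add_pos_nonneg)
  define C1 where "C1 = M + 2 * K"
  define C2 where "C2 = (2 * K * L + 1) * M + 2 * L * K\<^sup>2"
  define C3 where "C3 = (6 * K\<^sup>2 * L\<^sup>2 + 4 * K * L + 2 * K * L + 1) * M + 2 * (2 * L\<^sup>2 * K ^ 3 + L * K\<^sup>2)"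
  have C0: "0 \<le> C1" "0 \<le> C2" "0 \<le> C3" unfolding C1_def C2_def C3_def using K LM by (auto intro!: add_nonneg_nonneg mult_nonneg_nonneg)
  have main: "cmod (F s) \<le> C1 * cmod s powr (- (1 + \<alpha>)) \<and> cmod (?F1 s) \<le> C2 * cmod s powr (- (1 + \<alpha>)) \<and>
      cmod (?F2 s) \<le> C3 * (cmod s powr (- (2 - \<alpha>)) + cmod s powr (- (1 + \<alpha>)))" if s: "0 < Re s" for s
  proof -
    define r where "r = cmod s"
    have r: "0 < r" using s by (auto simp: r_def)
    note db = delay_symbol_d_bounds[OF \<alpha> \<tau> s, folded r_def]
    have b0: "0 \<le> b" using b by simp
    define x where "x = r powr (- (1 + \<alpha>))"
    define y where "y = r powr (- (2 - \<alpha>))"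
    have xy: "0 < x" "0 < y" using r by (auto simp: x_def y_def)
    have QK: "cmod (1 / ?e c s) \<le> K" "cmod (1 / ?e c s) \<le> K * r powr (- \<alpha>)" if "c = 0 \<or> c = b" for c
      using Q[OF that s] by (auto simp: r_def)
    show ?thesis
    proof (cases "1 \<le> r")
      \<comment> \<open>At infinity each reciprocal contributes |s|^(-\<alpha>) and the difference
        of the powers |s|^(\<alpha>-1), in total |s|^(-1-\<alpha>). The differences of the
        derivatives reach the same order.\<close>
      case True
      have pa: "r powr (\<alpha> - 1) \<le> 1" "r powr (\<alpha> - 2) \<le> 1" using True \<alpha> by (auto intro!: powr_le_one_le simp: powr_le1 ge_one_powr_ge_zero powr_nonneg_iff intro: order_trans[OF powr_mono[of _ 0 r]])
      have prod: "(r powr (- \<alpha>))\<^sup>2 * r powr (\<alpha> - 1) = x"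
      proof -
        have "- \<alpha> + - \<alpha> + (\<alpha> - 1) = - (1 + \<alpha>)" by simp
        then show ?thesis by (simp only: x_def power2_eq_square powr_add[symmetric])
      qed
      have a12: "r powr (\<alpha> - 2) \<le> r powr (\<alpha> - 1)" using True by (intro powr_mono) auto
      have Qb2: "(cmod (1 / ?e b s))\<^sup>2 \<le> K\<^sup>2 * (r powr (- \<alpha>))\<^sup>2"
        using power_mono[OF QK(2)[of b], of 2] by (simp add: power_mult_distrib)
      have FM: "cmod (1 / ?e 0 s - 1 / ?e b s) \<le> M * x"
      proof -
        have "1 / ?e 0 s - 1 / ?e b s = (1 / ?e 0 s) * (1 / ?e b s) * (?e b s - ?e 0 s)"
          using nz[of 0 s] nz[of b s] s by (simp add: field_simps)
        also have "?e b s - ?e 0 s = (s + of_real b) powr of_real \<alpha> - s powr of_real \<alpha>"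
          by (simp add: delay_symbol_def)
        finally have "cmod (1 / ?e 0 s - 1 / ?e b s) = cmod (1 / ?e 0 s) * cmod (1 / ?e b s) * cmod ((s + of_real b) powr of_real \<alpha> - s powr of_real \<alpha>)"
          by (simp only: norm_mult)
        also have "\<dots> \<le> (K * r powr (- \<alpha>)) * (K * r powr (- \<alpha>)) * (\<alpha> * r powr (\<alpha> - 1) * b)"
          using powr_line_difference[OF s b0, of \<alpha>] QK(2)[of 0] QK(2)[of b] \<alpha> K
          by (intro mult_mono) (auto simp: r_def)
        also have "\<dots> = K\<^sup>2 * (\<alpha> * b) * ((r powr (- \<alpha>))\<^sup>2 * r powr (\<alpha> - 1))" by (simp only: power2_eq_square mult_ac)
        also have "\<dots> \<le> K\<^sup>2 * (b + 2) * x"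
        proof -
          have "\<alpha> * b \<le> 1 * b" using \<alpha> b by (intro mult_right_mono) auto
          then show ?thesis unfolding prod using xy by (intro mult_right_mono mult_left_mono) auto
        qed
        finally show ?thesis by (simp only: M_def)
      qed
      have two: "(cmod (1 / ?e b s))\<^sup>2 * z \<le> M * x" if z: "z \<le> 2 * r powr (\<alpha> - 1)" "0 \<le> z" for z
      proof -
        have "(cmod (1 / ?e b s))\<^sup>2 * z \<le> (K\<^sup>2 * (r powr (- \<alpha>))\<^sup>2) * (2 * r powr (\<alpha> - 1))"
          using Qb2 z by (intro mult_mono) auto
        also have "\<dots> = K\<^sup>2 * 2 * ((r powr (- \<alpha>))\<^sup>2 * r powr (\<alpha> - 1))" by (simp only: mult_ac)
        also have "\<dots> \<le> K\<^sup>2 * (b + 2) * x" unfolding prod using xy b by (intro mult_right_mono mult_left_mono) auto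
        finally show ?thesis by (simp only: M_def)
      qed
      have dL: "cmod (?d 0 s) \<le> L" "cmod (?d b s) \<le> L" "cmod (?dd 0 s) \<le> L"
        using db(1)[of 0 l] db(1)[OF b0, of l] db(2)[of 0 l] pa LM unfolding L_def by linarith+
      have t2: "cmod (?dd 0 s - ?dd b s) \<le> 2 * r powr (\<alpha> - 1)" using db(4)[OF b0, of l] a12 by simp
      have mx: "0 \<le> M * x" using LM xy by simp
      note diffb = difference_bounds[OF QK(1) QK(1) FM dL two[OF db(3)[OF b0]] two[OF t2] mx]
      have "cmod (F s) \<le> C1 * x"
      proof -
        have "M * x \<le> C1 * x" unfolding C1_def using K xy by (intro mult_right_mono) auto
        then show ?thesis using FM unfolding F_def by (rule order_trans[rotated])
      qed
      moreover have "cmod (?F1 s) \<le> C2 * x"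
      proof -
        have "cmod (?F1 s) \<le> (2 * K * L + 1) * (M * x)" by (rule diffb(1)) auto
        also have "\<dots> \<le> C2 * x" using K LM xy by (simp add: C2_def algebra_simps)
        finally show ?thesis .
      qed
      moreover have "cmod (?F2 s) \<le> C3 * (y + x)"
      proof -
        have "cmod (?F2 s) \<le> (6 * K\<^sup>2 * L\<^sup>2 + 4 * K * L + 2 * K * L + 1) * (M * x)" by (rule diffb(2)) auto
        also have "\<dots> = ((6 * K\<^sup>2 * L\<^sup>2 + 4 * K * L + 2 * K * L + 1) * M) * x" by simp
        also have "\<dots> \<le> C3 * x" unfolding C3_def using K LM xy by (intro mult_right_mono) auto
        also have "\<dots> \<le> C3 * (y + x)" using C0 xy by (intro mult_left_mono) auto
        finally show ?thesis .
      qed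
      ultimately show ?thesis by (simp only: x_def y_def r_def)
    next
      \<comment> \<open>Near the origin the difference brings no gain, and both summands are
        estimated separately with bounded reciprocals. The worst term is the second derivative of
        the symbol, of order |s|^(\<alpha>-2); the squared first derivative, of order
        |s|^(2\<alpha>-2), is absorbed by it.\<close>
      case False
      then have r1: "r \<le> 1" by simp
      have one_le: "1 \<le> r powr a" if "a \<le> 0" for a using powr_mono'[of a 0 r] that r r1 by simp
      have pm: "r powr a \<le> r powr a'" if "a' \<le> a" for a a' using powr_mono'[of a' a r] that r r1 by simp
      have dL: "cmod (?d c s) \<le> L * r powr (\<alpha> - 1)" "cmod (?dd c s) \<le> L * y" if "0 \<le> c" for c
      proof -
        have "cmod l * \<tau> * 1 \<le> cmod l * \<tau> * r powr (\<alpha> - 1)" using one_le[of "\<alpha> - 1"] \<alpha> LM by (intro mult_left_mono) auto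
        moreover have "0 \<le> r powr (\<alpha> - 1)" "0 \<le> cmod l * \<tau>\<^sup>2 * r powr (\<alpha> - 1)" by auto
        ultimately show "cmod (?d c s) \<le> L * r powr (\<alpha> - 1)" using db(1)[OF that, of l] unfolding L_def distrib_right by linarith
        have yy: "r powr (\<alpha> - 2) = y" by (simp add: y_def)
        have "cmod l * \<tau>\<^sup>2 * 1 \<le> cmod l * \<tau>\<^sup>2 * y" unfolding yy[symmetric] using one_le[of "\<alpha> - 2"] \<alpha> LM by (intro mult_left_mono) auto
        moreover have "0 \<le> cmod l * \<tau> * y" using LM xy by simp
        ultimately show "cmod (?dd c s) \<le> L * y" using db(2)[OF that, of l, unfolded yy] xy unfolding L_def distrib_right by linarith
      qed
      have "cmod (F s) \<le> C1 * x"
      proof -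
        have "cmod (F s) \<le> K + K" unfolding F_def by (rule order_trans[OF norm_triangle_ineq4 add_mono[OF QK(1) QK(1)]]) auto
        also have "\<dots> \<le> 2 * K * x" using one_le[of "- (1 + \<alpha>)"] \<alpha> K by (simp add: x_def)
        also have "\<dots> \<le> C1 * x" using LM xy by (simp add: C1_def)
        finally show ?thesis .
      qed
      moreover have "cmod (?F1 s) \<le> C2 * x"
      proof -
        have t: "cmod (- (?d c s * (1 / ?e c s)\<^sup>2)) \<le> L * x * K\<^sup>2" if c: "c = 0 \<or> c = b" for c
        proof -
          have "cmod (?d c s) \<le> L * r powr (\<alpha> - 1)" using dL(1)[of c] c b0 by auto
          also have "\<dots> \<le> L * x" unfolding x_def using LM \<alpha> by (intro mult_left_mono pm) auto
          finally have "cmod (?d c s) * (cmod (1 / ?e c s))\<^sup>2 \<le> L * x * K\<^sup>2"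
            using QK(1)[OF c] LM xy by (intro mult_mono power_mono) auto
          then show ?thesis by (simp only: norm_minus_cancel norm_mult norm_power)
        qed
        have "cmod (?F1 s) \<le> L * x * K\<^sup>2 + L * x * K\<^sup>2" by (rule order_trans[OF norm_triangle_ineq4 add_mono[OF t t]]) auto
        also have "\<dots> = (2 * L * K\<^sup>2) * x" by simp
        also have "\<dots> \<le> C2 * x" unfolding C2_def using K LM xy by (intro mult_right_mono) auto
        finally show ?thesis .
      qed
      moreover have "cmod (?F2 s) \<le> C3 * (y + x)"
      proof -
        have t: "cmod (2 * (?d c s)\<^sup>2 * (1 / ?e c s) ^ 3 - ?dd c s * (1 / ?e c s)\<^sup>2) \<le> (2 * L\<^sup>2 * K ^ 3 + L * K\<^sup>2) * y" if c: "c = 0 \<or> c = b" for c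
        proof -
          have c0: "0 \<le> c" using c b0 by auto
          have "(r powr (\<alpha> - 1))\<^sup>2 = r powr (2 * \<alpha> - 2)" using r by (simp add: power2_eq_square flip: powr_add)
          also have "\<dots> \<le> y" unfolding y_def using \<alpha> by (intro pm) auto
          finally have sq: "(r powr (\<alpha> - 1))\<^sup>2 \<le> y" .
          have "(cmod (?d c s))\<^sup>2 \<le> (L * r powr (\<alpha> - 1))\<^sup>2" using dL(1)[OF c0] by (intro power_mono) auto
          also have "\<dots> \<le> L\<^sup>2 * y" unfolding power_mult_distrib using sq by (intro mult_left_mono) auto
          finally have d2: "(cmod (?d c s))\<^sup>2 \<le> L\<^sup>2 * y" .
          have a1: "2 * (cmod (?d c s))\<^sup>2 * cmod (1 / ?e c s) ^ 3 \<le> 2 * (L\<^sup>2 * y) * K ^ 3"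
            using d2 QK(1)[OF c] xy by (intro mult_mono power_mono) auto
          have a2: "cmod (?dd c s) * (cmod (1 / ?e c s))\<^sup>2 \<le> L * y * K\<^sup>2"
            using dL(2)[OF c0] QK(1)[OF c] LM xy by (intro mult_mono power_mono) auto
          have "cmod (2 * (?d c s)\<^sup>2 * (1 / ?e c s) ^ 3 - ?dd c s * (1 / ?e c s)\<^sup>2) \<le> cmod (2 * (?d c s)\<^sup>2 * (1 / ?e c s) ^ 3) + cmod (?dd c s * (1 / ?e c s)\<^sup>2)"
            by (rule norm_triangle_ineq4)
          also have "\<dots> = 2 * (cmod (?d c s))\<^sup>2 * cmod (1 / ?e c s) ^ 3 + cmod (?dd c s) * (cmod (1 / ?e c s))\<^sup>2"
            by (simp only: norm_mult norm_power norm_numeral)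
          also have "\<dots> \<le> 2 * (L\<^sup>2 * y) * K ^ 3 + L * y * K\<^sup>2" by (rule add_mono[OF a1 a2])
          also have "\<dots> = (2 * L\<^sup>2 * K ^ 3 + L * K\<^sup>2) * y" by (simp add: algebra_simps)
          finally show ?thesis .
        qed
        have "cmod (?F2 s) \<le> (2 * L\<^sup>2 * K ^ 3 + L * K\<^sup>2) * y + (2 * L\<^sup>2 * K ^ 3 + L * K\<^sup>2) * y"
          by (rule order_trans[OF norm_triangle_ineq4 add_mono[OF t t]]) auto
        also have "\<dots> = (2 * (2 * L\<^sup>2 * K ^ 3 + L * K\<^sup>2)) * y" by simp
        also have "\<dots> \<le> C3 * y" unfolding C3_def using K LM xy by (intro mult_right_mono) (auto intro!: add_nonneg_nonneg mult_nonneg_nonneg)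
        also have "\<dots> \<le> C3 * (y + x)" using C0 xy by (intro mult_left_mono) auto
        finally show ?thesis .
      qed
      ultimately show ?thesis by (simp only: x_def y_def r_def)
    qed
  qed
  define C where "C = C1 + C2 + C3"
  have CC: "C1 \<le> C" "C2 \<le> C" "C3 \<le> C" using C0 by (auto simp: C_def)
  have "cmod (F s) \<le> C * cmod s powr (- (1 + \<alpha>)) \<and> cmod (deriv F s) \<le> C * cmod s powr (- (1 + \<alpha>)) \<and>
        cmod (deriv (deriv F) s) \<le> C * (cmod s powr (- (2 - \<alpha>)) + cmod s powr (- (1 + \<alpha>)))" if s: "0 < Re s" for s
  proof -
    have p: "0 \<le> cmod s powr (- (1 + \<alpha>))" "0 \<le> cmod s powr (- (2 - \<alpha>)) + cmod s powr (- (1 + \<alpha>))" by simp_all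
    show ?thesis
      unfolding dF[OF s] ddF[OF s]
      using main[OF s] mult_right_mono[OF CC(1) p(1)] mult_right_mono[OF CC(2) p(1)] mult_right_mono[OF CC(3) p(2)]
      by (meson order_trans)
  qed
  then show "\<exists>C. \<forall>s. 0 < Re s \<longrightarrow> cmod (F s) \<le> C * cmod s powr (- (1 + \<alpha>)) \<and>
        cmod (deriv F s) \<le> C * cmod s powr (- (1 + \<alpha>)) \<and>
        cmod (deriv (deriv F) s) \<le> C * (cmod s powr (- (2 - \<alpha>)) + cmod s powr (- (1 + \<alpha>)))" by blast
qed

section \<open>Integrability of the resolvent\<close>

lemma delay_symbol_of_real:
  "0 \<le> \<sigma> + b \<Longrightarrow> delay_symbol \<alpha> \<tau> l b (of_real \<sigma>) = of_real ((\<sigma> + b) powr \<alpha>) - l * of_real (exp (- \<sigma> * \<tau>))"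
  unfolding delay_symbol_def of_real_add[symmetric] powr_of_real
  by (simp add: exp_of_real[symmetric])

text \<open>Write the resolvent as r = (r - w) + w with the damped series w for b^\<alpha> = 2|l|.
  The second part is integrable because its transform converges at \<sigma> = 0; the first is
  continuous, hence bounded on [0,1], and has an integrable power tail. The value of the integral is
  the limit of the transform as \<sigma> tends to 0.\<close>

theorem delay_ml_resolvent:
  assumes \<alpha>: "0 < \<alpha>" "\<alpha> < 1" and \<tau>: "0 < \<tau>" and l: "l \<in> stability_region \<alpha> \<tau>"
  shows "has_bochner_integral lborel (delay_ml \<alpha> \<tau> l 0) (- (1 / l))"
proof -
  let ?r = "delay_ml \<alpha> \<tau> l 0"
  have lp: "0 < cmod l" using l by (auto simp: stability_region_def)
  define b where "b = (2 * cmod l) powr (1 / \<alpha>)"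
  have b: "0 < b" "b powr \<alpha> = 2 * cmod l" using lp \<alpha> by (auto simp: b_def powr_powr)
  let ?w = "delay_ml \<alpha> \<tau> l b"
  let ?f = "\<lambda>t. ?r t - ?w t"
  define F where "F = (\<lambda>s. 1 / delay_symbol \<alpha> \<tau> l 0 s - 1 / delay_symbol \<alpha> \<tau> l b s)"
  have hol: "F holomorphic_on {s. 0 < Re s}"
    unfolding F_def by (rule symbol_difference_bounds(1)[OF \<alpha> \<tau> l b])
  obtain C where C: "\<And>s. 0 < Re s \<Longrightarrow> cmod (F s) \<le> C * cmod s powr (- (1 + \<alpha>))"
      "\<And>s. 0 < Re s \<Longrightarrow> cmod (deriv F s) \<le> C * cmod s powr (- (1 + \<alpha>))"
      "\<And>s. 0 < Re s \<Longrightarrow> cmod (deriv (deriv F) s) \<le> C * (cmod s powr (- (2 - \<alpha>)) + cmod s powr (- (1 + \<alpha>)))"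
    using symbol_difference_bounds(2)[OF \<alpha> \<tau> l b] unfolding F_def by blast
  have lap: "has_bochner_integral lborel (\<lambda>t. of_real (exp (- \<sigma> * t)) * delay_ml \<alpha> \<tau> l c t) (1 / delay_symbol \<alpha> \<tau> l c (of_real \<sigma>))"
    if "0 \<le> \<sigma>" "0 < \<sigma> + c" "cmod l < (\<sigma> + c) powr \<alpha>" for \<sigma> c
  proof -
    have "cmod l * exp (- \<sigma> * \<tau>) \<le> cmod l * 1" using that \<tau> by (intro mult_left_mono) auto
    then have "cmod l * exp (- \<sigma> * \<tau>) < (\<sigma> + c) powr \<alpha>" using that by simp
    then show ?thesis
      using delay_ml_laplace[OF \<alpha>(1) \<tau> that(2)] that by (simp only: delay_symbol_of_real[of \<sigma> c] less_imp_le)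
  qed
  have lapw: "has_bochner_integral lborel (\<lambda>t. of_real (exp (- \<sigma> * t)) * ?w t) (1 / delay_symbol \<alpha> \<tau> l b (of_real \<sigma>))"
    if \<sigma>: "0 \<le> \<sigma>" for \<sigma>
  proof (rule lap[OF \<sigma>])
    have "b powr \<alpha> \<le> (\<sigma> + b) powr \<alpha>" using \<sigma> b \<alpha> by (intro powr_mono2) auto
    then show "cmod l < (\<sigma> + b) powr \<alpha>" using b(2) lp by linarith
  qed (use b \<sigma> in auto)
  \<comment> \<open>From \<open>\<sigma>0\<close> on, |l| < \<sigma>^\<alpha>, so the undamped
    series can be transformed term by term; \<open>laplace_decay\<close> then continues the formula
    for the difference to all \<sigma> > 0.\<close>
  define \<sigma>0 where "\<sigma>0 = (cmod l + 1) powr (1 / \<alpha>)"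
  have \<sigma>0: "0 < \<sigma>0" "\<sigma>0 powr \<alpha> = cmod l + 1"
    using \<alpha> add_nonneg_pos[of "cmod l" 1] by (auto simp: \<sigma>0_def powr_powr)
  have ind: "indicator {0..} t *\<^sub>R (of_real (exp (- \<sigma> * t)) * ?f t) = of_real (exp (- \<sigma> * t)) * ?f t" for t \<sigma>
    by (cases "0 \<le> t") (auto simp: delay_ml_nonpos[OF \<tau>])
  have lapf0: "has_bochner_integral lborel (\<lambda>t. indicator {0..} t *\<^sub>R (of_real (exp (- \<sigma> * t)) * ?f t)) (F (of_real \<sigma>))"
    if \<sigma>: "\<sigma>0 \<le> \<sigma>" for \<sigma>
    unfolding ind unfolding right_diff_distrib F_def
  proof (rule has_bochner_integral_diff[OF lap lapw])
    have "\<sigma>0 powr \<alpha> \<le> \<sigma> powr \<alpha>" using \<sigma> \<sigma>0 \<alpha> by (intro powr_mono2) auto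
    then show "cmod l < (\<sigma> + 0) powr \<alpha>" using \<sigma>0(2) by simp
  qed (use \<sigma> \<sigma>0 in auto)
  have contf: "continuous_on {0..} ?f"
    using continuous_delay_ml_diff[OF \<alpha>(1) \<tau>, of b l] b continuous_on_subset by fastforce
  note ld = laplace_decay[OF hol C, of ?f \<sigma>0]
  have lapf: "has_bochner_integral lborel (\<lambda>t. indicator {0..} t *\<^sub>R (of_real (exp (- \<sigma> * t)) * ?f t)) (F (of_real \<sigma>))"
    if "0 < \<sigma>" for \<sigma>
    by (rule ld(2)) (use \<alpha> contf lapf0 that in auto)
  \<comment> \<open>The exponents are -(1+\<alpha>) and -(2-\<alpha>). Both lie below -1, the first
    because \<alpha> > 0 and the second because \<alpha> < 1.\<close>
  have "\<exists>K. \<forall>t\<ge>1. cmod (?f t) \<le> K * (t powr (2 - \<alpha> - 3) + t powr (1 + \<alpha> - 3))"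
    by (rule ld(1)) (use \<alpha> contf lapf0 in auto)
  then obtain K where K: "\<And>t. 1 \<le> t \<Longrightarrow> cmod (?f t) \<le> K * (t powr (- (1 + \<alpha>)) + t powr (- (2 - \<alpha>)))"
    by (auto simp: algebra_simps)
  obtain B where B: "\<And>t. t \<in> {0..1} \<Longrightarrow> cmod (?f t) \<le> B"
  proof -
    have "compact (?f ` {0..1})" by (intro compact_continuous_image continuous_on_subset[OF contf]) auto
    then have "bounded (?f ` {0..1})" by (rule compact_imp_bounded)
    then obtain a where "\<forall>x\<in>?f ` {0..1}. norm x \<le> a" unfolding bounded_iff by blast
    then show ?thesis using that[of a] by blast
  qed
  have intf: "integrable lborel ?f"
  proof (rule Bochner_Integration.integrable_bound)
    show "integrable lborel (\<lambda>t::real. \<bar>B\<bar> * indicator {0..1} t + \<bar>K\<bar> * (indicator {1..} t * t powr (- (1 + \<alpha>)) + indicator {1..} t * t powr (- (2 - \<alpha>))))"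
      using integrable_powr_tail[of "1 + \<alpha>"] integrable_powr_tail[of "2 - \<alpha>"] \<alpha> by (intro Bochner_Integration.integrable_add integrable_mult_right) auto
    show "?f \<in> borel_measurable lborel" by measurable
    show "AE t in lborel. norm (?f t) \<le> norm (\<bar>B\<bar> * indicator {0..1} t + \<bar>K\<bar> * (indicator {1..} t * t powr (- (1 + \<alpha>)) + indicator {1..} t * t powr (- (2 - \<alpha>))))"
    proof (rule AE_I2)
      fix t :: real
      have nn: "0 \<le> \<bar>B\<bar> * indicator {0..1} t + \<bar>K\<bar> * (indicator {1..} t * t powr (- (1 + \<alpha>)) + indicator {1..} t * t powr (- (2 - \<alpha>)))"
        by simp
      consider "t \<le> 0" | "0 \<le> t" "t < 1" | "1 \<le> t" by linarith
      then have "norm (?f t) \<le> \<bar>B\<bar> * indicator {0..1} t + \<bar>K\<bar> * (indicator {1..} t * t powr (- (1 + \<alpha>)) + indicator {1..} t * t powr (- (2 - \<alpha>)))"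
      proof cases
        case 1
        then show ?thesis using nn by (simp add: delay_ml_nonpos[OF \<tau>] del: add_nonneg_nonneg)
      next
        case 2
        then show ?thesis using B[of t] by (simp add: indicator_def)
      next
        case 3
        have "K * (t powr (- (1 + \<alpha>)) + t powr (- (2 - \<alpha>))) \<le> \<bar>K\<bar> * (t powr (- (1 + \<alpha>)) + t powr (- (2 - \<alpha>)))"
          by (intro mult_right_mono) auto
        with K[OF 3] have KK: "norm (?f t) \<le> \<bar>K\<bar> * (t powr (- (1 + \<alpha>)) + t powr (- (2 - \<alpha>)))"
          by (rule order_trans)
        have i1: "indicator {1..} t = (1::real)" using 3 by simp
        have "0 \<le> \<bar>B\<bar> * indicator {0..1} t" by simp
        then show ?thesis unfolding i1 mult_1 using KK by (rule add_increasing)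
      qed
      then show "norm (?f t) \<le> norm (\<bar>B\<bar> * indicator {0..1} t + \<bar>K\<bar> * (indicator {1..} t * t powr (- (1 + \<alpha>)) + indicator {1..} t * t powr (- (2 - \<alpha>))))"
        unfolding real_norm_def using abs_ge_self order_trans by blast
    qed
  qed
  have intw: "integrable lborel ?w"
    using lapw[of 0] by (simp add: has_bochner_integral_iff)
  have intr: "integrable lborel ?r"
    using Bochner_Integration.integrable_add[OF intf intw] by simp
  have lapr: "(LINT t|lborel. of_real (exp (- \<sigma> * t)) * ?r t) = 1 / delay_symbol \<alpha> \<tau> l 0 (of_real \<sigma>)" if \<sigma>: "0 < \<sigma>" for \<sigma>
  proof -
    have "has_bochner_integral lborel (\<lambda>t. of_real (exp (- \<sigma> * t)) * ?f t + of_real (exp (- \<sigma> * t)) * ?w t) (F (of_real \<sigma>) + 1 / delay_symbol \<alpha> \<tau> l b (of_real \<sigma>))"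
      by (rule has_bochner_integral_add[OF lapf[OF \<sigma>, unfolded ind] lapw]) (use \<sigma> in simp)
    moreover have "(\<lambda>t. of_real (exp (- \<sigma> * t)) * ?f t + of_real (exp (- \<sigma> * t)) * ?w t) = (\<lambda>t. of_real (exp (- \<sigma> * t)) * ?r t)"
      by (simp add: right_diff_distrib)
    ultimately show ?thesis by (simp add: has_bochner_integral_iff F_def)
  qed
  \<comment> \<open>An Abelian limit: along this sequence the transform tends to the integral of the
    resolvent by dominated convergence, and to 1/(0 - l) by its closed form.\<close>
  let ?s = "\<lambda>n. inverse (real (Suc n))"
  have s0: "?s \<longlonglongrightarrow> 0" by (rule LIMSEQ_inverse_real_of_nat)
  have lim1: "(\<lambda>n. LINT t|lborel. of_real (exp (- ?s n * t)) * ?r t) \<longlonglongrightarrow> (LINT t|lborel. ?r t)"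
  proof (rule integral_dominated_convergence)
    show "integrable lborel (\<lambda>t. norm (?r t))" using intr by simp
    show "AE t in lborel. (\<lambda>n. of_real (exp (- ?s n * t)) * ?r t) \<longlonglongrightarrow> ?r t"
    proof (rule AE_I2)
      fix t :: real
      have "(\<lambda>n. of_real (exp (- ?s n * t)) * ?r t) \<longlonglongrightarrow> of_real (exp (- 0 * t)) * ?r t"
        by (intro tendsto_intros s0)
      then show "(\<lambda>n. of_real (exp (- ?s n * t)) * ?r t) \<longlonglongrightarrow> ?r t" by simp
    qed
    show "AE t in lborel. norm (of_real (exp (- ?s n * t)) * ?r t) \<le> norm (?r t)" for n
    proof (rule AE_I2)
      fix t :: real
      show "norm (of_real (exp (- ?s n * t)) * ?r t) \<le> norm (?r t)"
      proof (cases "0 \<le> t")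
        case True
        then have "exp (- ?s n * t) \<le> 1" by simp
        then show ?thesis unfolding norm_mult norm_of_real using mult_right_mono[of "exp (- ?s n * t)" 1 "norm (?r t)"] by simp
      qed (simp add: delay_ml_nonpos[OF \<tau>])
    qed
    show "(\<lambda>t. of_real (exp (- ?s n * t)) * ?r t) \<in> borel_measurable lborel" for n by measurable
  qed (use intr in auto)
  have "(\<lambda>n. 1 / delay_symbol \<alpha> \<tau> l 0 (of_real (?s n))) \<longlonglongrightarrow> 1 / (of_real 0 - l * of_real (exp (- 0 * \<tau>)))"
  proof -
    have "(\<lambda>n. (?s n + 0) powr \<alpha>) \<longlonglongrightarrow> 0" using tendsto_zero_powrI[OF s0 tendsto_const _ \<alpha>(1)] by simp
    then have "(\<lambda>n. 1 / (of_real ((?s n + 0) powr \<alpha>) - l * of_real (exp (- ?s n * \<tau>)))) \<longlonglongrightarrow> 1 / (of_real 0 - l * of_real (exp (- 0 * \<tau>)))"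
      using lp by (intro tendsto_intros s0) auto
    moreover have "delay_symbol \<alpha> \<tau> l 0 (of_real (?s n)) = of_real ((?s n + 0) powr \<alpha>) - l * of_real (exp (- ?s n * \<tau>))" for n
      by (rule delay_symbol_of_real) simp
    ultimately show ?thesis by (simp only:)
  qed
  moreover have "(\<lambda>n. LINT t|lborel. of_real (exp (- ?s n * t)) * ?r t) = (\<lambda>n. 1 / delay_symbol \<alpha> \<tau> l 0 (of_real (?s n)))"
    by (rule ext, rule lapr) simp
  ultimately have "(\<lambda>n. LINT t|lborel. of_real (exp (- ?s n * t)) * ?r t) \<longlonglongrightarrow> - (1 / l)" by simp
  then have "(LINT t|lborel. ?r t) = - (1 / l)" using lim1 LIMSEQ_unique by blast
  with intr show ?thesis by (simp add: has_bochner_integral_iff)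
qed

section \<open>The integral equation of the resolvent\<close>

lemma rl_kernel_shift_convolution:
  assumes "0 < a" "0 < b"
  shows "has_bochner_integral lborel (\<lambda>s. rl_kernel a (t - s) * rl_kernel b (s - c)) (rl_kernel (a + b) (t - c))"
proof -
  have "has_bochner_integral lborel (\<lambda>s. rl_kernel a (t - c - (- c + 1 * s)) * rl_kernel b (- c + 1 * s)) (rl_kernel (a + b) (t - c) /\<^sub>R \<bar>1\<bar>)"
    using rl_kernel_convolution[OF assms, of "t - c"]
    by (subst (asm) lborel_has_bochner_integral_real_affine_iff[where t = "- c" and c = 1]) simp_all
  then show ?thesis by simp
qed

text \<open>Convolution with the kernel of order \<alpha> raises the order of term \<open>j\<close>
  by \<alpha>, and the delay moves its start by \<tau>; up to the factor \<open>l\<close> it becomes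
  term \<open>j + 1\<close>. The kernel itself is term 0.\<close>

lemma delay_ml_volterra:
  assumes \<alpha>: "0 < \<alpha>" and \<tau>: "0 < \<tau>"
  shows "\<exists>I. has_bochner_integral lborel (\<lambda>s. of_real (rl_kernel \<alpha> (t - s)) * delay_ml \<alpha> \<tau> l 0 (s - \<tau>)) I \<and>
     delay_ml \<alpha> \<tau> l 0 t = of_real (rl_kernel \<alpha> t) + l * I"
proof -
  obtain n where n: "t < real n * \<tau>" using ex_delay_steps[OF \<tau>] by blast
  let ?I = "\<Sum>j<n. l ^ j * of_real (rl_kernel (\<alpha> + real (Suc j) * \<alpha>) (t - (\<tau> + real j * \<tau>)))"
  have "has_bochner_integral lborel (\<lambda>s. \<Sum>j<n. l ^ j * of_real (rl_kernel \<alpha> (t - s) * rl_kernel (real (Suc j) * \<alpha>) (s - (\<tau> + real j * \<tau>)))) ?I"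
    using \<alpha> by (intro has_bochner_integral_sum has_bochner_integral_mult_right has_bochner_integral_of_real rl_kernel_shift_convolution) auto
  moreover have "(\<lambda>s. \<Sum>j<n. l ^ j * of_real (rl_kernel \<alpha> (t - s) * rl_kernel (real (Suc j) * \<alpha>) (s - (\<tau> + real j * \<tau>)))) =
     (\<lambda>s. of_real (rl_kernel \<alpha> (t - s)) * delay_ml \<alpha> \<tau> l 0 (s - \<tau>))"
  proof
    fix s
    show "(\<Sum>j<n. l ^ j * of_real (rl_kernel \<alpha> (t - s) * rl_kernel (real (Suc j) * \<alpha>) (s - (\<tau> + real j * \<tau>)))) =
      of_real (rl_kernel \<alpha> (t - s)) * delay_ml \<alpha> \<tau> l 0 (s - \<tau>)"
    proof (cases "s < t")
      case False
      then show ?thesis by (simp add: rl_kernel_nonpos_eq)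
    next
      case True
      then have "s - \<tau> \<le> real n * \<tau>" using n \<tau> by simp
      then have "delay_ml \<alpha> \<tau> l 0 (s - \<tau>) = (\<Sum>j<n. delay_ml_term \<alpha> \<tau> l 0 j (s - \<tau>))"
        by (rule delay_ml_finite(2)[OF \<tau>])
      then show ?thesis by (simp add: sum_distrib_left delay_ml_term_def algebra_simps)
    qed
  qed
  moreover have "delay_ml \<alpha> \<tau> l 0 t = of_real (rl_kernel \<alpha> t) + l * ?I"
  proof -
    \<comment> \<open>One term more than under the integral: index 0 is split off as the kernel, and
      the remaining n terms match the convolved ones.\<close>
    have "t \<le> real (Suc n) * \<tau>" using n \<tau> by (simp add: algebra_simps)
    then have "delay_ml \<alpha> \<tau> l 0 t = (\<Sum>j<Suc n. delay_ml_term \<alpha> \<tau> l 0 j t)" by (rule delay_ml_finite(2)[OF \<tau>])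
    also have "\<dots> = delay_ml_term \<alpha> \<tau> l 0 0 t + (\<Sum>j<n. delay_ml_term \<alpha> \<tau> l 0 (Suc j) t)" by (rule sum.lessThan_Suc_shift)
    also have "delay_ml_term \<alpha> \<tau> l 0 0 t = of_real (rl_kernel \<alpha> t)" by (simp add: delay_ml_term_def)
    also have "(\<Sum>j<n. delay_ml_term \<alpha> \<tau> l 0 (Suc j) t) = l * ?I"
      by (simp add: sum_distrib_left delay_ml_term_def algebra_simps)
    finally show ?thesis .
  qed
  ultimately show ?thesis by (intro exI[of _ ?I] conjI) (simp only:)+
qed

section \<open>Convolution with an integrable kernel\<close>

text \<open>The moving argument is placed on \<open>G\<close> and not on \<open>r\<close>: for
  bounded \<open>G\<close> the integrand then has a majorant M|r| independent of \<open>t\<close>,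
  while \<open>r\<close> may be unbounded. The indicator discards \<open>G\<close> at negative
  times.\<close>

definition causal_conv :: "(real \<Rightarrow> complex) \<Rightarrow> (real \<Rightarrow> complex) \<Rightarrow> real \<Rightarrow> complex" where
  "causal_conv r G t = (LINT u|lborel. r u * (indicator {0..} (t - u) *\<^sub>R G (t - u)))"

lemma causal_conv_integrand_bound:
  fixes r G :: "real \<Rightarrow> complex"
  assumes "\<And>s. 0 \<le> s \<Longrightarrow> norm (G s) \<le> M"
  shows "norm (r u * (indicator {0..} (t - u) *\<^sub>R G (t - u))) \<le> \<bar>M\<bar> * norm (r u)"
proof -
  have "norm (indicator {0..} (t - u) *\<^sub>R G (t - u)) \<le> \<bar>M\<bar>"
    using assms[of "t - u"] by (auto simp: indicator_def)
  then have "norm (r u) * norm (indicator {0..} (t - u) *\<^sub>R G (t - u)) \<le> norm (r u) * \<bar>M\<bar>" by (rule mult_left_mono) simp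
  then show ?thesis unfolding norm_mult by (simp add: mult.commute)
qed

lemma causal_conv_integrand_integrable:
  fixes r G :: "real \<Rightarrow> complex"
  assumes r: "integrable lborel r" and G: "G \<in> borel_measurable borel" "\<And>s. 0 \<le> s \<Longrightarrow> norm (G s) \<le> M"
  shows "integrable lborel (\<lambda>u. r u * (indicator {0..} (t - u) *\<^sub>R G (t - u)))"
proof (rule Bochner_Integration.integrable_bound)
  show "integrable lborel (\<lambda>u. \<bar>M\<bar> * norm (r u))" using r by simp
  have [measurable]: "r \<in> borel_measurable borel" using borel_measurable_integrable[OF r] by simp
  note G(1)[measurable]
  show "(\<lambda>u. r u * (indicator {0..} (t - u) *\<^sub>R G (t - u))) \<in> borel_measurable lborel" by measurable
  show "AE u in lborel. norm (r u * (indicator {0..} (t - u) *\<^sub>R G (t - u))) \<le> norm (\<bar>M\<bar> * norm (r u))"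
  proof (rule AE_I2)
    fix u
    show "norm (r u * (indicator {0..} (t - u) *\<^sub>R G (t - u))) \<le> norm (\<bar>M\<bar> * norm (r u))"
      using causal_conv_integrand_bound[where G = G and M = M and r = r and u = u and t = t, OF G(2)]
      by (simp only: real_norm_def abs_mult abs_idempotent abs_norm_cancel)
  qed
qed

lemma causal_conv_norm_le:
  assumes r: "integrable lborel r" and G: "G \<in> borel_measurable borel" "\<And>s. 0 \<le> s \<Longrightarrow> norm (G s) \<le> M" and M: "0 \<le> M"
  shows "norm (causal_conv r G t) \<le> M * (LINT u|lborel. norm (r u))"
proof -
  have "norm (causal_conv r G t) \<le> (LINT u|lborel. M * norm (r u))"
    unfolding causal_conv_def
  proof (rule Bochner_Integration.integral_norm_bound_integral)
    show "integrable lborel (\<lambda>u. r u * (indicator {0..} (t - u) *\<^sub>R G (t - u)))"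
      by (rule causal_conv_integrand_integrable[OF r G])
    show "norm (r u * (indicator {0..} (t - u) *\<^sub>R G (t - u))) \<le> M * norm (r u)" for u
      using causal_conv_integrand_bound[where G = G and M = M and r = r and u = u and t = t, OF G(2)] M
      by (simp only: abs_of_nonneg)
  qed (use r in simp)
  then show ?thesis by simp
qed

lemma causal_conv_diff:
  assumes r: "integrable lborel r" and G: "G \<in> borel_measurable borel" "\<And>s. 0 \<le> s \<Longrightarrow> norm (G s) \<le> M"
    and H: "H \<in> borel_measurable borel" "\<And>s. 0 \<le> s \<Longrightarrow> norm (H s) \<le> M'"
  shows "causal_conv r G t - causal_conv r H t = causal_conv r (\<lambda>s. G s - H s) t"
proof -
  have "causal_conv r G t - causal_conv r H t = (LINT u|lborel. r u * (indicator {0..} (t - u) *\<^sub>R G (t - u)) - r u * (indicator {0..} (t - u) *\<^sub>R H (t - u)))"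
    unfolding causal_conv_def
    by (rule Bochner_Integration.integral_diff[symmetric]; rule causal_conv_integrand_integrable[OF r]) (use G H in auto)
  also have "\<dots> = causal_conv r (\<lambda>s. G s - H s) t"
    unfolding causal_conv_def by (simp only: right_diff_distrib scaleR_diff_right)
  finally show ?thesis .
qed

lemma causal_conv_nonpos:
  assumes "\<And>u. u \<le> 0 \<Longrightarrow> r u = 0" "t \<le> 0"
  shows "causal_conv r G t = 0"
proof -
  have "r u * (indicator {0..} (t - u) *\<^sub>R G (t - u)) = 0" for u
    using assms by (cases "u \<le> 0") (auto simp: indicator_def)
  then show ?thesis unfolding causal_conv_def by (simp only: integral_zero)
qed

lemma causal_conv_continuous:
  assumes r: "integrable lborel r" and G: "continuous_on UNIV G" "\<And>s. 0 \<le> s \<Longrightarrow> norm (G s) \<le> M"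
  shows "continuous_on UNIV (causal_conv r G)"
proof -
  have Gm: "G \<in> borel_measurable borel" by (rule borel_measurable_continuous_onI[OF G(1)])
  have "isCont (causal_conv r G) t" for t
    unfolding continuous_at_sequentially comp_def
  proof (intro allI impI)
    fix X assume X: "X \<longlonglongrightarrow> t"
    show "(\<lambda>n. causal_conv r G (X n)) \<longlonglongrightarrow> causal_conv r G t"
      unfolding causal_conv_def
    proof (rule integral_dominated_convergence)
      show "integrable lborel (\<lambda>u. \<bar>M\<bar> * norm (r u))" using r by simp
      show "AE u in lborel. norm (r u * (indicator {0..} (X n - u) *\<^sub>R G (X n - u))) \<le> \<bar>M\<bar> * norm (r u)" for n
        by (intro AE_I2 causal_conv_integrand_bound G(2))
      show "AE u in lborel. (\<lambda>n. r u * (indicator {0..} (X n - u) *\<^sub>R G (X n - u))) \<longlonglongrightarrow> r u * (indicator {0..} (t - u) *\<^sub>R G (t - u))"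
      \<comment> \<open>The indicator jumps at u = t, so pointwise convergence is claimed off this
        null set.\<close>
      proof (rule AE_mp[OF AE_lborel_singleton[of t]], rule AE_I2, rule impI)
        fix u assume u: "u \<noteq> t"
        have Xu: "(\<lambda>n. X n - u) \<longlonglongrightarrow> t - u" by (intro tendsto_intros X)
        have GX: "(\<lambda>n. G (X n - u)) \<longlonglongrightarrow> G (t - u)"
          using isCont_tendsto_compose[OF _ Xu, of G] G(1) by (simp add: continuous_on_eq_continuous_at)
        have "\<forall>\<^sub>F n in sequentially. indicator {0..} (X n - u) = (indicator {0..} (t - u) :: real)"
        proof (cases "u < t")
          case True
          then show ?thesis using order_tendstoD(1)[OF Xu, of 0] by (auto elim!: eventually_mono)
        next
          case False
          then show ?thesis using order_tendstoD(2)[OF Xu, of 0] u by (auto elim!: eventually_mono)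
        qed
        then have "(\<lambda>n. indicator {0..} (X n - u) :: real) \<longlonglongrightarrow> indicator {0..} (t - u)" by (rule tendsto_eventually)
        then show "(\<lambda>n. r u * (indicator {0..} (X n - u) *\<^sub>R G (X n - u))) \<longlonglongrightarrow> r u * (indicator {0..} (t - u) *\<^sub>R G (t - u))"
          by (intro tendsto_intros GX)
      qed
    qed (use causal_conv_integrand_integrable[OF r Gm G(2)] in \<open>auto intro: borel_measurable_integrable\<close>)
  qed
  then show ?thesis by (simp add: continuous_at_imp_continuous_on)
qed

text \<open>Integrability of \<open>r\<close> over the whole half-line enters here: a single
  majorant serves all t, and the limit of \<open>G\<close> gets multiplied by the total integral of
  \<open>r\<close>.\<close>

lemma causal_conv_tendsto:
  assumes r: "integrable lborel r" and G: "G \<in> borel_measurable borel" "\<And>s. 0 \<le> s \<Longrightarrow> norm (G s) \<le> M"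
    and lim: "(G \<longlongrightarrow> L) at_top"
  shows "(causal_conv r G \<longlongrightarrow> (LINT u|lborel. r u) * L) at_top"
proof -
  have "((\<lambda>t. causal_conv r G t) \<longlongrightarrow> (LINT u|lborel. r u * L)) at_top"
    unfolding causal_conv_def
  proof (rule integral_dominated_convergence_at_top)
    show "integrable lborel (\<lambda>u. \<bar>M\<bar> * norm (r u))" using r by simp
    show "\<forall>\<^sub>F t in at_top. AE u in lborel. norm (r u * (indicator {0..} (t - u) *\<^sub>R G (t - u))) \<le> \<bar>M\<bar> * norm (r u)"
      by (intro always_eventually allI AE_I2 causal_conv_integrand_bound G(2))
    show "AE u in lborel. ((\<lambda>t. r u * (indicator {0..} (t - u) *\<^sub>R G (t - u))) \<longlongrightarrow> r u * L) at_top"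
    proof (rule AE_I2)
      fix u :: real
      have "filterlim (\<lambda>t. t - u) at_top at_top"
        using filterlim_tendsto_add_at_top[OF tendsto_const[of "- u"] filterlim_ident] by simp
      then have "((\<lambda>t. G (t - u)) \<longlongrightarrow> L) at_top" by (rule filterlim_compose[OF lim])
      then have l1: "((\<lambda>t. r u * G (t - u)) \<longlongrightarrow> r u * L) at_top" by (intro tendsto_intros)
      have "\<forall>\<^sub>F t in at_top. r u * G (t - u) = r u * (indicator {0..} (t - u) *\<^sub>R G (t - u))"
        using eventually_ge_at_top[of u] by eventually_elim simp
      then show "((\<lambda>t. r u * (indicator {0..} (t - u) *\<^sub>R G (t - u))) \<longlongrightarrow> r u * L) at_top"
        by (rule Lim_transform_eventually[OF l1])
    qed
    show "(\<lambda>u. r u * L) \<in> borel_measurable lborel" using borel_measurable_integrable[OF r] by simp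
    show "(\<lambda>u. r u * (indicator {0..} (t - u) *\<^sub>R G (t - u))) \<in> borel_measurable lborel" for t
      using causal_conv_integrand_integrable[OF r G] by (rule borel_measurable_integrable)
  qed
  then show ?thesis by simp
qed

lemma causal_conv_alt:
  "causal_conv r G t = (LINT s|lborel. r (t - s) * (indicator {0..} s *\<^sub>R G s))"
proof -
  have "causal_conv r G t = \<bar>-1\<bar> *\<^sub>R (LINT s|lborel. r (t + (-1) * s) * (indicator {0..} (t - (t + (-1) * s)) *\<^sub>R G (t - (t + (-1) * s))))"
    unfolding causal_conv_def by (rule lborel_integral_real_affine) simp
  then show ?thesis by simp
qed

lemma convolution_kernel_measurable:
  fixes k r G :: "real \<Rightarrow> complex"
  assumes [measurable]: "k \<in> borel_measurable borel" "r \<in> borel_measurable borel" "G \<in> borel_measurable borel"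
  shows "(\<lambda>p. k (fst p) * (r (fst p - c - snd p) * G (snd p))) \<in> borel_measurable (lborel \<Otimes>\<^sub>M lborel)"
  by measurable

lemma rl_kernel_integrable_segment:
  assumes "0 < \<alpha>"
  shows "integrable lborel (\<lambda>s. indicator {0..} s * rl_kernel \<alpha> (t - s))"
proof (rule Bochner_Integration.integrable_bound)
  have "integrable lborel (\<lambda>s. exp (- 1 * s) * rl_kernel \<alpha> s)"
    using rl_kernel_laplace[OF assms, of 1] by (simp add: has_bochner_integral_iff)
  then have "integrable lborel (\<lambda>s. exp (- 1 * (t + (-1) * s)) * rl_kernel \<alpha> (t + (-1) * s))"
    by (rule lborel_integrable_real_affine) simp
  then show "integrable lborel (\<lambda>s. exp \<bar>t\<bar> * (exp (s - t) * rl_kernel \<alpha> (t - s)))" by simp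
  show "(\<lambda>s. indicator {0..} s * rl_kernel \<alpha> (t - s)) \<in> borel_measurable lborel" by measurable
  show "AE s in lborel. norm (indicator {0..} s * rl_kernel \<alpha> (t - s)) \<le> norm (exp \<bar>t\<bar> * (exp (s - t) * rl_kernel \<alpha> (t - s)))"
  proof (rule AE_I2)
    fix s :: real
    have k: "0 \<le> rl_kernel \<alpha> (t - s)" by (rule rl_kernel_nonneg[OF assms])
    have "indicator {0..} s \<le> exp (\<bar>t\<bar> + (s - t))" by (auto simp: indicator_def)
    then have "indicator {0..} s * rl_kernel \<alpha> (t - s) \<le> exp (\<bar>t\<bar> + (s - t)) * rl_kernel \<alpha> (t - s)"
      using k by (rule mult_right_mono)
    then show "norm (indicator {0..} s * rl_kernel \<alpha> (t - s)) \<le> norm (exp \<bar>t\<bar> * (exp (s - t) * rl_kernel \<alpha> (t - s)))"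
      using k by (simp add: exp_add mult.assoc abs_mult)
  qed
qed

text \<open>Variation of constants. For the kernel k of order \<alpha> the Volterra equation says
  that k convolved with l r(. - \<tau>) is r - k. Convolving with \<open>G\<close> and exchanging
  the integrals turns this into the equation for \<open>z\<close>.\<close>

theorem resolvent_equation:
  assumes \<alpha>: "0 < \<alpha>" and \<tau>: "0 < \<tau>" and rint: "integrable lborel (delay_ml \<alpha> \<tau> l 0)"
    and G: "G \<in> borel_measurable borel" "\<And>s. 0 \<le> s \<Longrightarrow> norm (G s) \<le> M"
  defines "z \<equiv> causal_conv (delay_ml \<alpha> \<tau> l 0) G"
  shows "has_bochner_integral lborel (\<lambda>s. indicator {0..} s *\<^sub>R (of_real (rl_kernel \<alpha> (t - s)) * (l * z (s - \<tau>) + G s))) (z t)"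
proof -
  let ?r = "delay_ml \<alpha> \<tau> l 0"
  define k where "k = (\<lambda>s. complex_of_real (indicator {0..} s * rl_kernel \<alpha> (t - s)))"
  define g where "g = (\<lambda>s. indicator {0..} s *\<^sub>R G s)"
  have km: "k \<in> borel_measurable borel" unfolding k_def by measurable
  have gm: "g \<in> borel_measurable borel" unfolding g_def using G(1) by measurable
  have gM: "norm (g s) \<le> \<bar>M\<bar>" for s using G(2)[of s] by (auto simp: g_def indicator_def)
  have kint: "integrable lborel k" unfolding k_def by (rule integrable_of_real[OF rl_kernel_integrable_segment[OF \<alpha>]])
  have z_alt: "z s = (LINT u|lborel. ?r (s - u) * g u)" for s
    unfolding z_def g_def by (rule causal_conv_alt)
  have z0: "z s = 0" if "s \<le> 0" for s
    unfolding z_def by (rule causal_conv_nonpos) (use that delay_ml_nonpos[OF \<tau>] in auto)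
  let ?R = "LINT u|lborel. norm (?r u)"
  have rs: "has_bochner_integral lborel (\<lambda>u. norm (?r (s - u))) ?R" for s
  proof -
    have "has_bochner_integral lborel (\<lambda>u. norm (?r u)) ?R" using rint by (simp add: has_bochner_integral_iff)
    then have "has_bochner_integral lborel (\<lambda>u. norm (?r (s + (-1) * u))) (?R /\<^sub>R \<bar>-1\<bar>)"
      by (subst (asm) lborel_has_bochner_integral_real_affine_iff[where t = s and c = "-1"]) auto
    then show ?thesis by simp
  qed
  have ri: "integrable lborel (\<lambda>u. ?r (s - u) * g u)" for s
  proof (rule Bochner_Integration.integrable_bound)
    show "integrable lborel (\<lambda>u. norm (?r (s - u)) * \<bar>M\<bar>)" using rs[of s] by (auto simp: has_bochner_integral_iff)
    show "(\<lambda>u. ?r (s - u) * g u) \<in> borel_measurable lborel" using gm by measurable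
    show "AE u in lborel. norm (?r (s - u) * g u) \<le> norm (norm (?r (s - u)) * \<bar>M\<bar>)"
      unfolding norm_mult using gM by (auto intro!: AE_I2 mult_left_mono)
  qed
  have rn: "(LINT u|lborel. norm (?r (s - u) * g u)) \<le> ?R * \<bar>M\<bar>" for s
  proof -
    have "(LINT u|lborel. norm (?r (s - u) * g u)) \<le> (LINT u|lborel. norm (?r (s - u)) * \<bar>M\<bar>)"
    proof (intro integral_mono integrable_norm ri)
      show "integrable lborel (\<lambda>u. norm (?r (s - u)) * \<bar>M\<bar>)" using rs[of s] by (auto simp: has_bochner_integral_iff)
      show "norm (?r (s - u) * g u) \<le> norm (?r (s - u)) * \<bar>M\<bar>" for u
        unfolding norm_mult using gM by (rule mult_left_mono) simp
    qed
    also have "\<dots> = ?R * \<bar>M\<bar>" using rs[of s] by (simp add: has_bochner_integral_iff)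
    finally show ?thesis .
  qed
  let ?H = "\<lambda>s u. k s * (?r (s - \<tau> - u) * g u)"
  have meas: "case_prod ?H \<in> borel_measurable (lborel \<Otimes>\<^sub>M lborel)"
    using convolution_kernel_measurable[OF km delay_ml_measurable[of \<alpha> \<tau> l 0] gm, of \<tau>] by (simp only: case_prod_beta')
  have joint: "integrable (lborel \<Otimes>\<^sub>M lborel) (case_prod ?H)"
  proof (rule lborel_pair.Fubini_integrable[OF meas])
    show "integrable lborel (\<lambda>s. LINT u|lborel. norm (case_prod ?H (s, u)))"
    proof (rule Bochner_Integration.integrable_bound)
      show "integrable lborel (\<lambda>s. norm (k s) * (?R * \<bar>M\<bar>))" using kint by simp
      show "(\<lambda>s. LINT u|lborel. norm (case_prod ?H (s, u))) \<in> borel_measurable lborel"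
        using meas by (intro lborel.borel_measurable_lebesgue_integral) (simp add: case_prod_beta')
      show "AE s in lborel. norm (LINT u|lborel. norm (case_prod ?H (s, u))) \<le> norm (norm (k s) * (?R * \<bar>M\<bar>))"
      proof (rule AE_I2)
        fix s
        have "(LINT u|lborel. norm (case_prod ?H (s, u))) = norm (k s) * (LINT u|lborel. norm (?r (s - \<tau> - u) * g u))"
          unfolding prod.case norm_mult[of "k s"] by simp
        also have "\<dots> \<le> norm (k s) * (?R * \<bar>M\<bar>)" by (intro mult_left_mono rn) simp
        finally have "(LINT u|lborel. norm (case_prod ?H (s, u))) \<le> norm (k s) * (?R * \<bar>M\<bar>)" .
        moreover have "0 \<le> (LINT u|lborel. norm (case_prod ?H (s, u)))" by (rule Bochner_Integration.integral_nonneg) simp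
        ultimately show "norm (LINT u|lborel. norm (case_prod ?H (s, u))) \<le> norm (norm (k s) * (?R * \<bar>M\<bar>))"
          unfolding real_norm_def by linarith
      qed
    qed
    show "AE s in lborel. integrable lborel (\<lambda>u. case_prod ?H (s, u))"
      unfolding prod.case using ri by (intro AE_I2 integrable_mult_right)
  qed
  have inner_u: "(LINT u|lborel. ?H s u) = k s * z (s - \<tau>)" for s
    unfolding z_alt by simp
  have inner_s: "l * (LINT s|lborel. ?H s u) = (?r (t - u) - of_real (rl_kernel \<alpha> (t - u))) * g u" for u
  proof (cases "0 \<le> u")
    case False
    then show ?thesis by (simp add: g_def)
  next
    case True
    obtain I where I: "has_bochner_integral lborel (\<lambda>s. of_real (rl_kernel \<alpha> (t - u - s)) * ?r (s - \<tau>)) I"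
        "?r (t - u) = of_real (rl_kernel \<alpha> (t - u)) + l * I"
      using delay_ml_volterra[OF \<alpha> \<tau>, of "t - u" l] by blast
    have "has_bochner_integral lborel (\<lambda>s. of_real (rl_kernel \<alpha> (t - u - (- u + 1 * s))) * ?r (- u + 1 * s - \<tau>)) (I /\<^sub>R \<bar>1\<bar>)"
      using I(1) by (subst (asm) lborel_has_bochner_integral_real_affine_iff[where t = "- u" and c = 1]) simp_all
    moreover have "(\<lambda>s. of_real (rl_kernel \<alpha> (t - u - (- u + 1 * s))) * ?r (- u + 1 * s - \<tau>)) = (\<lambda>s. k s * ?r (s - \<tau> - u))"
    proof
      fix s
      show "of_real (rl_kernel \<alpha> (t - u - (- u + 1 * s))) * ?r (- u + 1 * s - \<tau>) = k s * ?r (s - \<tau> - u)"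
      proof (cases "0 \<le> s")
        case True
        then show ?thesis by (simp add: k_def algebra_simps)
      next
        \<comment> \<open>The restriction of \<open>k\<close> to s >= 0 loses nothing: for s < 0 and
          u >= 0 the argument of the resolvent is negative.\<close>
        case False
        then have "?r (s - \<tau> - u) = 0" using True \<tau> by (intro delay_ml_nonpos[OF \<tau>]) simp
        then show ?thesis by (simp add: algebra_simps)
      qed
    qed
    ultimately have "(LINT s|lborel. k s * ?r (s - \<tau> - u)) = I" by (simp add: has_bochner_integral_iff)
    then have "(LINT s|lborel. ?H s u) = I * g u" by (simp add: mult.assoc[symmetric])
    then show ?thesis using I(2) by simp
  qed
  have swap: "(LINT u|lborel. (LINT s|lborel. ?H s u)) = (LINT s|lborel. (LINT u|lborel. ?H s u))"
    by (rule lborel_pair.Fubini_integral[OF joint])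
  have kg: "integrable lborel (\<lambda>u. of_real (rl_kernel \<alpha> (t - u)) * g u)"
  proof (rule Bochner_Integration.integrable_bound)
    show "integrable lborel (\<lambda>u. norm (k u) * \<bar>M\<bar>)" using kint by simp
    show "(\<lambda>u. of_real (rl_kernel \<alpha> (t - u)) * g u) \<in> borel_measurable lborel" using gm by measurable
    show "AE u in lborel. norm (of_real (rl_kernel \<alpha> (t - u)) * g u) \<le> norm (norm (k u) * \<bar>M\<bar>)"
    proof (rule AE_I2)
      fix u
      have "of_real (rl_kernel \<alpha> (t - u)) * g u = k u * g u" by (auto simp: k_def g_def indicator_def)
      then have "norm (of_real (rl_kernel \<alpha> (t - u)) * g u) = norm (k u) * norm (g u)" by (simp only: norm_mult)
      also have "\<dots> \<le> norm (k u) * \<bar>M\<bar>" using gM by (rule mult_left_mono) simp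
      finally show "norm (of_real (rl_kernel \<alpha> (t - u)) * g u) \<le> norm (norm (k u) * \<bar>M\<bar>)" by simp
    qed
  qed
  have kz: "has_bochner_integral lborel (\<lambda>s. l * (k s * z (s - \<tau>))) (z t - (LINT u|lborel. of_real (rl_kernel \<alpha> (t - u)) * g u))"
  proof -
    have A: "integrable lborel (\<lambda>s. l * (k s * z (s - \<tau>)))"
      using lborel_pair.integrable_fst[OF joint] unfolding inner_u by simp
    have "(LINT s|lborel. l * (k s * z (s - \<tau>))) = (LINT u|lborel. l * (LINT s|lborel. ?H s u))"
      using swap unfolding inner_u by simp
    also have "\<dots> = (LINT u|lborel. ?r (t - u) * g u - of_real (rl_kernel \<alpha> (t - u)) * g u)"
      unfolding inner_s by (simp only: left_diff_distrib)
    also have "\<dots> = z t - (LINT u|lborel. of_real (rl_kernel \<alpha> (t - u)) * g u)"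
      unfolding z_alt[of t] by (rule Bochner_Integration.integral_diff[OF ri kg])
    finally show ?thesis using A unfolding has_bochner_integral_iff by blast
  qed
  have "has_bochner_integral lborel (\<lambda>s. l * (k s * z (s - \<tau>)) + of_real (rl_kernel \<alpha> (t - s)) * g s)
     (z t - (LINT u|lborel. of_real (rl_kernel \<alpha> (t - u)) * g u) + (LINT u|lborel. of_real (rl_kernel \<alpha> (t - u)) * g u))"
    by (intro has_bochner_integral_add kz has_bochner_integral_integrable kg)
  moreover have "(\<lambda>s. l * (k s * z (s - \<tau>)) + of_real (rl_kernel \<alpha> (t - s)) * g s) =
     (\<lambda>s. indicator {0..} s *\<^sub>R (of_real (rl_kernel \<alpha> (t - s)) * (l * z (s - \<tau>) + G s)))"
    by (auto simp: k_def g_def indicator_def algebra_simps)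
  ultimately show ?thesis by simp
qed

section \<open>The perturbed system\<close>

lemma norm_vec_le_bound:
  fixes v :: "complex ^ 'd"
  assumes "\<And>i. norm (v $ i) \<le> b i"
  shows "norm v \<le> (\<Sum>i\<in>UNIV. b i)"
proof -
  have "norm v \<le> (\<Sum>i\<in>UNIV. norm (v $ i))" unfolding norm_vec_def by (rule L2_set_le_sum) simp
  also have "\<dots> \<le> (\<Sum>i\<in>UNIV. b i)" by (intro sum_mono assms)
  finally show ?thesis .
qed

text \<open>The unknown is sought as y = \<psi> + z, where z vanishes on the history and is the
  convolution of the resolvents with a forcing term. Half of the radius \<open>\<rho>\<close> is
  reserved for the data through the bound on \<open>\<Psi>\<close>, the other half for the
  perturbation. The factor 2 in the bound on \<open>\<kappa>\<close> counts the present and the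
  delayed argument, and the same bound yields the contraction constant 1/2.\<close>

theorem perturbed_fixed_point:
  fixes \<Lambda> :: "'d::finite \<Rightarrow> complex" and \<Phi> :: "complex ^ 'd \<Rightarrow> complex ^ 'd \<Rightarrow> complex ^ 'd"
    and \<psi> :: "real \<Rightarrow> complex ^ 'd"
  assumes \<alpha>: "0 < \<alpha>" "\<alpha> < 1" and \<tau>: "0 < \<tau>" and \<Lambda>: "\<And>i. \<Lambda> i \<in> stability_region \<alpha> \<tau>"
  defines "R \<equiv> \<lambda>i. LINT t|lborel. cmod (delay_ml \<alpha> \<tau> (\<Lambda> i) 0 t)"
  assumes \<kappa>: "0 \<le> \<kappa>" "2 * \<kappa> * (\<Sum>i\<in>UNIV. R i) \<le> 1 / 2" and \<rho>: "0 < \<rho>"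
    and \<Phi>0: "\<Phi> 0 0 = 0"
    and \<Phi>: "\<And>u v u' v' i. norm u \<le> \<rho> \<Longrightarrow> norm v \<le> \<rho> \<Longrightarrow> norm u' \<le> \<rho> \<Longrightarrow> norm v' \<le> \<rho> \<Longrightarrow>
        norm (\<Phi> u v $ i - \<Phi> u' v' $ i) \<le> \<kappa> * (norm (u - u') + norm (v - v'))"
    and \<psi>: "continuous_on UNIV \<psi>" "\<And>t. norm (\<psi> t) \<le> \<Psi>" "\<And>t. 0 \<le> t \<Longrightarrow> \<psi> t = \<psi> 0"
    and \<Psi>: "\<Psi> * (1 + (\<Sum>i\<in>UNIV. R i * cmod (\<Lambda> i))) \<le> \<rho> / 2"
  obtains y where "continuous_on UNIV y" "\<And>t. norm (y t) \<le> \<rho>" "(y \<longlongrightarrow> 0) at_top"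
    "\<And>t. t \<le> 0 \<Longrightarrow> y t = \<psi> t"
    "\<And>t i. 0 \<le> t \<Longrightarrow> has_bochner_integral lborel
       (\<lambda>s. indicator {0..} s *\<^sub>R (of_real (rl_kernel \<alpha> (t - s)) * (\<Lambda> i * y (s - \<tau>) $ i + \<Phi> (y s) (y (s - \<tau>)) $ i)))
       (y t $ i - \<psi> 0 $ i)"
proof -
  let ?r = "\<lambda>i. delay_ml \<alpha> \<tau> (\<Lambda> i) 0"
  have rint: "integrable lborel (?r i)" and rval: "(LINT t|lborel. ?r i t) = - (1 / \<Lambda> i)" for i
    using delay_ml_resolvent[OF \<alpha> \<tau> \<Lambda>[of i]] by (simp_all add: has_bochner_integral_iff)
  have \<Lambda>0: "\<Lambda> i \<noteq> 0" for i using \<Lambda>[of i] by (auto simp: stability_region_def)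
  have R0: "0 \<le> R i" for i by (simp add: R_def)
  have \<Psi>0: "0 \<le> \<Psi>" using \<psi>(2)[of 0] norm_ge_zero order_trans by blast
  \<comment> \<open>Since y = \<psi> + z and the resolvent reproduces only z, the delayed \<psi>
    belongs to the forcing. As \<psi> is constant after 0, this part of the forcing does not tend to
    0.\<close>
  define G where "G = (\<lambda>y i s. \<Lambda> i * \<psi> (s - \<tau>) $ i + \<Phi> (y s) (y (s - \<tau>)) $ i)"
  define T where "T = (\<lambda>y t. \<chi> i. \<psi> t $ i + causal_conv (?r i) (G y i) t)"
  \<comment> \<open>The limit 0 is built into the space, so attraction comes with the fixed point;
    it survives uniform limits, which keeps the space complete.\<close>
  define S where "S = {f :: real \<Rightarrow>\<^sub>C (complex ^ 'd). (\<forall>t. norm (apply_bcontfun f t) \<le> \<rho>) \<and> (apply_bcontfun f \<longlongrightarrow> 0) at_top}"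
  have \<psi>i: "continuous_on UNIV (\<lambda>t. \<psi> t $ i)" "norm (\<psi> t $ i) \<le> \<Psi>" for i t
    using \<psi>(1) order_trans[OF Finite_Cartesian_Product.norm_nth_le \<psi>(2)] by (auto intro!: continuous_intros)
  have \<Phi>b: "norm (\<Phi> u v $ i) \<le> \<kappa> * (norm u + norm v)" if "norm u \<le> \<rho>" "norm v \<le> \<rho>" for u v i
    using \<Phi>[OF that, of 0 0 i] \<rho> \<Phi>0 by simp
  have G_cont: "continuous_on UNIV (G y i)" if y: "continuous_on UNIV y" "\<And>t. norm (y t) \<le> \<rho>" for y i
  proof -
    have "isCont (\<lambda>s. \<Phi> (y s) (y (s - \<tau>)) $ i) t" for t
      unfolding isCont_def
    proof (rule LIM_zero_cancel, rule Lim_null_comparison)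
      show "\<forall>\<^sub>F s in at t. norm (\<Phi> (y s) (y (s - \<tau>)) $ i - \<Phi> (y t) (y (t - \<tau>)) $ i) \<le> \<kappa> * (norm (y s - y t) + norm (y (s - \<tau>) - y (t - \<tau>)))"
        by (intro always_eventually allI \<Phi> y)
      have c1: "(\<lambda>s. y s) \<midarrow>t\<rightarrow> y t" using y(1) by (simp add: continuous_on_def)
      have "continuous_on UNIV (\<lambda>s. y (s - \<tau>))" by (rule continuous_on_compose2[OF y(1)]) (auto intro!: continuous_intros)
      then have c2: "(\<lambda>s. y (s - \<tau>)) \<midarrow>t\<rightarrow> y (t - \<tau>)" by (simp add: continuous_on_def)
      have "((\<lambda>s. \<kappa> * (norm (y s - y t) + norm (y (s - \<tau>) - y (t - \<tau>)))) \<longlongrightarrow> \<kappa> * (norm (y t - y t) + norm (y (t - \<tau>) - y (t - \<tau>)))) (at t)"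
        by (intro tendsto_intros c1 c2)
      then show "((\<lambda>s. \<kappa> * (norm (y s - y t) + norm (y (s - \<tau>) - y (t - \<tau>)))) \<longlongrightarrow> 0) (at t)" by simp
    qed
    then have c1: "continuous_on UNIV (\<lambda>s. \<Phi> (y s) (y (s - \<tau>)) $ i)" by (simp add: continuous_at_imp_continuous_on)
    have c2: "continuous_on UNIV (\<lambda>s. \<psi> (s - \<tau>) $ i)"
      by (rule continuous_on_compose2[OF \<psi>i(1)]) (auto intro!: continuous_intros)
    show ?thesis unfolding G_def by (rule continuous_on_add[OF continuous_on_mult[OF continuous_on_const c2] c1])
  qed
  have G_bound: "norm (G y i s) \<le> cmod (\<Lambda> i) * \<Psi> + 2 * \<kappa> * \<rho>" if y: "\<And>t. norm (y t) \<le> \<rho>" for y i s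
  proof -
    have "norm (G y i s) \<le> norm (\<Lambda> i * \<psi> (s - \<tau>) $ i) + norm (\<Phi> (y s) (y (s - \<tau>)) $ i)"
      unfolding G_def by (rule norm_triangle_ineq)
    also have "\<dots> \<le> cmod (\<Lambda> i) * \<Psi> + \<kappa> * (\<rho> + \<rho>)"
      unfolding norm_mult using \<psi>i(2) y \<kappa>(1)
      by (intro add_mono mult_left_mono order_trans[OF \<Phi>b[OF y y]]) auto
    finally show ?thesis by simp
  qed
  have G_meas: "G y i \<in> borel_measurable borel" if "continuous_on UNIV y" "\<And>t. norm (y t) \<le> \<rho>" for y i
    by (rule borel_measurable_continuous_onI[OF G_cont[OF that]])
  have T_cont: "continuous_on UNIV (T y)" if y: "continuous_on UNIV y" "\<And>t. norm (y t) \<le> \<rho>" for y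
    unfolding T_def
    by (rule continuous_on_vec_lambda, rule continuous_on_add[OF \<psi>i(1) causal_conv_continuous[OF rint G_cont[OF y] G_bound[OF y(2)]]])
  have T_bound: "norm (T y t) \<le> \<rho>" if y: "continuous_on UNIV y" "\<And>t. norm (y t) \<le> \<rho>" for y t
  proof -
    have "norm (T y t - \<psi> t) \<le> (\<Sum>i\<in>UNIV. (cmod (\<Lambda> i) * \<Psi> + 2 * \<kappa> * \<rho>) * R i)"
    proof (rule norm_vec_le_bound)
      fix i
      have "norm (causal_conv (?r i) (G y i) t) \<le> (cmod (\<Lambda> i) * \<Psi> + 2 * \<kappa> * \<rho>) * R i"
        unfolding R_def by (rule causal_conv_norm_le[OF rint G_meas[OF y] G_bound[OF y(2)]]) (use \<kappa> \<rho> \<Psi>0 in auto)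
      then show "norm ((T y t - \<psi> t) $ i) \<le> (cmod (\<Lambda> i) * \<Psi> + 2 * \<kappa> * \<rho>) * R i" by (simp add: T_def)
    qed
    also have "\<dots> = \<Psi> * (\<Sum>i\<in>UNIV. R i * cmod (\<Lambda> i)) + (2 * \<kappa> * (\<Sum>i\<in>UNIV. R i)) * \<rho>"
      unfolding sum_distrib_left sum_distrib_right sum.distrib[symmetric] by (intro sum.cong refl) (simp add: algebra_simps)
    also have "\<dots> \<le> \<Psi> * (\<Sum>i\<in>UNIV. R i * cmod (\<Lambda> i)) + 1 / 2 * \<rho>"
      using \<kappa>(2) \<rho> by (intro add_left_mono mult_right_mono) auto
    finally have a: "norm (T y t - \<psi> t) \<le> \<Psi> * (\<Sum>i\<in>UNIV. R i * cmod (\<Lambda> i)) + 1 / 2 * \<rho>" .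
    have "norm (T y t) \<le> norm (\<psi> t) + norm (T y t - \<psi> t)" by (rule norm_triangle_sub)
    also have "\<dots> \<le> \<Psi> * 1 + (\<Psi> * (\<Sum>i\<in>UNIV. R i * cmod (\<Lambda> i)) + 1 / 2 * \<rho>)" using \<psi>(2)[of t] a by simp
    also have "\<dots> = \<Psi> * (1 + (\<Sum>i\<in>UNIV. R i * cmod (\<Lambda> i))) + 1 / 2 * \<rho>" by (simp only: distrib_left add.assoc)
    finally show ?thesis using \<Psi> by linarith
  qed
  \<comment> \<open>The limit vanishes because the resolvent has integral \<open>- 1 / \<Lambda> i\<close>.\<close>
  have T_lim: "(T y \<longlongrightarrow> 0) at_top" if y: "continuous_on UNIV y" "\<And>t. norm (y t) \<le> \<rho>" and y0: "(y \<longlongrightarrow> 0) at_top" for y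
  proof (rule vec_tendstoI)
    fix i
    have shift: "filterlim (\<lambda>t::real. t - \<tau>) at_top at_top"
      using filterlim_tendsto_add_at_top[OF tendsto_const[of "- \<tau>"] filterlim_ident] by simp
    have \<psi>ev: "\<forall>\<^sub>F s in at_top. \<psi> 0 $ i = \<psi> s $ i"
      by (rule eventually_mono[OF eventually_ge_at_top[of 0]]) (drule \<psi>(3), simp only:)
    have \<psi>lim: "((\<lambda>s. \<psi> s $ i) \<longlongrightarrow> \<psi> 0 $ i) at_top"
      by (rule Lim_transform_eventually[OF tendsto_const \<psi>ev])
    have "((\<lambda>s. \<Phi> (y s) (y (s - \<tau>)) $ i) \<longlongrightarrow> 0) at_top"
    proof (rule Lim_null_comparison)
      show "\<forall>\<^sub>F s in at_top. norm (\<Phi> (y s) (y (s - \<tau>)) $ i) \<le> \<kappa> * (norm (y s) + norm (y (s - \<tau>)))"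
        by (intro always_eventually allI \<Phi>b y)
      have "((\<lambda>s. \<kappa> * (norm (y s) + norm (y (s - \<tau>)))) \<longlongrightarrow> \<kappa> * (norm (0 :: complex ^ 'd) + norm (0 :: complex ^ 'd))) at_top"
        by (intro tendsto_intros y0 filterlim_compose[OF y0 shift])
      then show "((\<lambda>s. \<kappa> * (norm (y s) + norm (y (s - \<tau>)))) \<longlongrightarrow> 0) at_top" by simp
    qed
    then have Glim: "(G y i \<longlongrightarrow> \<Lambda> i * \<psi> 0 $ i + 0) at_top"
      unfolding G_def by (intro tendsto_intros filterlim_compose[OF \<psi>lim shift])
    have "((\<lambda>t. \<psi> t $ i + causal_conv (?r i) (G y i) t) \<longlongrightarrow> \<psi> 0 $ i + (LINT u|lborel. ?r i u) * (\<Lambda> i * \<psi> 0 $ i + 0)) at_top"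
      by (intro tendsto_add \<psi>lim causal_conv_tendsto[OF rint G_meas[OF y] G_bound[OF y(2)] Glim])
    then show "((\<lambda>t. T y t $ i) \<longlongrightarrow> 0 $ i) at_top" using \<Lambda>0[of i] by (simp add: T_def rval)
  qed
  have contb: "continuous_on UNIV (apply_bcontfun f)" for f :: "real \<Rightarrow>\<^sub>C (complex ^ 'd)"
    using apply_bcontfun[of f] by (simp add: bcontfun_def)
  define TB where "TB = (\<lambda>f. Bcontfun (T (apply_bcontfun f)))"
  have TB: "apply_bcontfun (TB f) = T (apply_bcontfun f)" if "f \<in> S" for f
    unfolding TB_def
  proof (rule Bcontfun_inverse)
    have "bounded (range (T (apply_bcontfun f)))"
      unfolding bounded_iff using T_bound[OF contb] that by (auto simp: S_def)
    then show "T (apply_bcontfun f) \<in> bcontfun"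
      using T_cont[OF contb] that by (auto simp: S_def bcontfun_def)
  qed
  have "closed S"
    unfolding closed_sequential_limits
  proof (intro allI impI, elim conjE)
    fix f :: "nat \<Rightarrow> real \<Rightarrow>\<^sub>C (complex ^ 'd)" and l
    assume fS: "\<forall>n. f n \<in> S" and lim: "f \<longlonglongrightarrow> l"
    have dle: "norm (apply_bcontfun (f n) t - apply_bcontfun l t) \<le> dist (f n) l" for n t
      using dist_bounded[of "f n" t l] by (simp add: dist_norm)
    have "norm (apply_bcontfun l t) \<le> \<rho>" for t
    proof (rule Lim_bounded)
      have "(\<lambda>n. apply_bcontfun (f n) t - apply_bcontfun l t) \<longlonglongrightarrow> 0"
        by (rule Lim_null_comparison[OF _ tendsto_dist_iff[THEN iffD1, OF lim]]) (simp add: dle)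
      then have "(\<lambda>n. apply_bcontfun (f n) t) \<longlonglongrightarrow> apply_bcontfun l t" by (rule LIM_zero_cancel)
      then show "(\<lambda>n. norm (apply_bcontfun (f n) t)) \<longlonglongrightarrow> norm (apply_bcontfun l t)" by (rule tendsto_norm)
      show "\<forall>n\<ge>0. norm (apply_bcontfun (f n) t) \<le> \<rho>" using fS by (auto simp: S_def)
    qed
    moreover have "(apply_bcontfun l \<longlongrightarrow> 0) at_top"
    proof (rule tendstoI)
      fix e :: real assume e: "0 < e"
      obtain n where n: "dist (f n) l < e / 2" using metric_LIMSEQ_D[OF lim, of "e / 2"] e by force
      have "\<forall>\<^sub>F t in at_top. dist (apply_bcontfun (f n) t) 0 < e / 2"
        using fS e by (intro tendstoD) (auto simp: S_def)
      then show "\<forall>\<^sub>F t in at_top. dist (apply_bcontfun l t) 0 < e"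
      proof eventually_elim
        case (elim t)
        have "norm (apply_bcontfun l t) \<le> norm (apply_bcontfun (f n) t) + norm (apply_bcontfun (f n) t - apply_bcontfun l t)"
          using norm_triangle_ineq4[of "apply_bcontfun (f n) t" "apply_bcontfun (f n) t - apply_bcontfun l t"] by simp
        then show ?case using elim dle[of n t] n by simp
      qed
    qed
    ultimately show "l \<in> S" by (simp add: S_def)
  qed
  then have complete: "complete S" by (simp add: complete_eq_closed)
  have "0 \<in> S" using \<rho> by (simp add: S_def)
  then have ne: "S \<noteq> {}" by blast
  have maps: "TB ` S \<subseteq> S"
  proof
    fix f' assume "f' \<in> TB ` S"
    then obtain f where f: "f \<in> S" "f' = TB f" by blast
    then have fb: "\<And>t. norm (apply_bcontfun f t) \<le> \<rho>" "(apply_bcontfun f \<longlongrightarrow> 0) at_top" by (auto simp: S_def)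
    show "f' \<in> S" unfolding f(2) S_def using TB[OF f(1)] T_bound[OF contb fb(1)] T_lim[OF contb fb] by simp
  qed
  have lip: "dist (TB f) (TB f') \<le> 1 / 2 * dist f f'" if f: "f \<in> S" "f' \<in> S" for f f'
  proof (rule dist_bound)
    fix t
    let ?y = "apply_bcontfun f" and ?y' = "apply_bcontfun f'"
    have yb: "norm (?y t) \<le> \<rho>" "norm (?y' t) \<le> \<rho>" for t using f by (auto simp: S_def)
    have dle: "norm (?y t - ?y' t) \<le> dist f f'" for t
      using dist_bounded[of f t f'] by (simp add: dist_norm)
    have "norm (T ?y t - T ?y' t) \<le> (\<Sum>i\<in>UNIV. 2 * \<kappa> * dist f f' * R i)"
    proof (rule norm_vec_le_bound)
      fix i
      have "(T ?y t - T ?y' t) $ i = causal_conv (?r i) (\<lambda>s. G ?y i s - G ?y' i s) t"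
        using causal_conv_diff[OF rint G_meas[OF contb yb(1)] G_bound[OF yb(1)] G_meas[OF contb yb(2)] G_bound[OF yb(2)]]
        by (simp add: T_def)
      also have "norm \<dots> \<le> 2 * \<kappa> * dist f f' * R i"
        unfolding R_def
      proof (rule causal_conv_norm_le[OF rint])
        show "(\<lambda>s. G ?y i s - G ?y' i s) \<in> borel_measurable borel"
          by (intro borel_measurable_diff G_meas contb yb)
        fix s
        have "G ?y i s - G ?y' i s = \<Phi> (?y s) (?y (s - \<tau>)) $ i - \<Phi> (?y' s) (?y' (s - \<tau>)) $ i" by (simp add: G_def)
        also have "norm \<dots> \<le> \<kappa> * (norm (?y s - ?y' s) + norm (?y (s - \<tau>) - ?y' (s - \<tau>)))" by (intro \<Phi> yb)
        also have "\<dots> \<le> \<kappa> * (dist f f' + dist f f')" using \<kappa>(1) by (intro mult_left_mono add_mono dle)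
        finally show "norm (G ?y i s - G ?y' i s) \<le> 2 * \<kappa> * dist f f'" by simp
      qed (use \<kappa> in simp)
      finally show "norm ((T ?y t - T ?y' t) $ i) \<le> 2 * \<kappa> * dist f f' * R i" .
    qed
    also have "\<dots> = (2 * \<kappa> * (\<Sum>i\<in>UNIV. R i)) * dist f f'"
      unfolding sum_distrib_left sum_distrib_right by (intro sum.cong refl) (simp only: mult_ac)
    also have "\<dots> \<le> 1 / 2 * dist f f'" using \<kappa>(2) by (intro mult_right_mono) auto
    finally show "dist (apply_bcontfun (TB f) t) (apply_bcontfun (TB f') t) \<le> 1 / 2 * dist f f'"
      by (simp add: TB[OF f(1)] TB[OF f(2)] dist_norm)
  qed
  have "\<exists>!f\<in>S. TB f = f" by (rule Banach_fix[OF complete ne _ _ maps lip]) auto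
  then obtain f where f: "f \<in> S" "TB f = f" by blast
  define y where "y = apply_bcontfun f"
  have yb: "\<And>t. norm (y t) \<le> \<rho>" "(y \<longlongrightarrow> 0) at_top" and yc: "continuous_on UNIV y"
    using f(1) contb by (auto simp: y_def S_def)
  have yT: "y = T y" unfolding y_def using TB[OF f(1)] f(2) by simp
  have yi: "y t $ i = \<psi> t $ i + causal_conv (?r i) (G y i) t" for t i
    using arg_cong[OF yT, of "\<lambda>h. h t $ i"] by (simp add: T_def)
  have cc0: "causal_conv (?r i) (G y i) t = 0" if "t \<le> 0" for i t
    by (rule causal_conv_nonpos[OF _ that]) (simp add: delay_ml_nonpos[OF \<tau>])
  show thesis
  proof (rule that[OF yc yb])
    show "y t = \<psi> t" if "t \<le> 0" for t using that by (simp add: Finite_Cartesian_Product.vec_eq_iff yi cc0)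
    fix t :: real and i assume t: "0 \<le> t"
    have eq: "\<Lambda> i * causal_conv (?r i) (G y i) (s - \<tau>) + G y i s = \<Lambda> i * y (s - \<tau>) $ i + \<Phi> (y s) (y (s - \<tau>)) $ i" for s
      unfolding yi[of "s - \<tau>"] by (simp add: G_def algebra_simps)
    have "y t $ i - \<psi> 0 $ i = causal_conv (?r i) (G y i) t" using \<psi>(3)[OF t] by (simp add: yi)
    then show "has_bochner_integral lborel
       (\<lambda>s. indicator {0..} s *\<^sub>R (of_real (rl_kernel \<alpha> (t - s)) * (\<Lambda> i * y (s - \<tau>) $ i + \<Phi> (y s) (y (s - \<tau>)) $ i)))
       (y t $ i - \<psi> 0 $ i)"
      using resolvent_equation[OF \<alpha>(1) \<tau> rint[of i] G_meas[OF yc yb(1), of i] G_bound[OF yb(1)], of t] unfolding eq by simp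
  qed
qed

section \<open>Arbitrary norms and the Lipschitz modulus\<close>

lemma is_norm_equivalence:
  fixes N :: "'a::euclidean_space \<Rightarrow> real"
  assumes "is_norm N"
  obtains c1 c2 where "0 < c1" "0 < c2" "\<And>x. N x \<le> c1 * norm x" "\<And>x. norm x \<le> c2 * N x"
proof -
  have pos: "0 \<le> N x" and zero: "N x = 0 \<longleftrightarrow> x = 0" and sc: "N (c *\<^sub>R x) = \<bar>c\<bar> * N x"
    and tri: "N (x + y) \<le> N x + N y" for x y c
    using assms by (auto simp: is_norm_def)
  have Nsum: "N (\<Sum>b\<in>B. f b) \<le> (\<Sum>b\<in>B. N (f b))" if "finite B" for B and f :: "'a \<Rightarrow> 'a"
    using that
  proof induction
    case empty then show ?case using zero[of 0] by simp
  next
    case (insert b B)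
    then show ?case using tri[of "f b" "sum f B"] by simp
  qed
  define C where "C = (\<Sum>b\<in>Basis. N b) + 1"
  have C: "0 < C" unfolding C_def by (intro add_nonneg_pos sum_nonneg pos) simp
  have up: "N x \<le> C * norm x" for x
  proof -
    have "N x = N (\<Sum>b\<in>Basis. (x \<bullet> b) *\<^sub>R b)" by (simp add: euclidean_representation)
    also have "\<dots> \<le> (\<Sum>b\<in>Basis. N ((x \<bullet> b) *\<^sub>R b))" by (rule Nsum) simp
    also have "\<dots> \<le> (\<Sum>b\<in>Basis. norm x * N b)"
      unfolding sc by (intro sum_mono mult_right_mono pos Basis_le_norm)
    also have "\<dots> = norm x * (\<Sum>b\<in>Basis. N b)" by (simp only: sum_distrib_left)
    also have "\<dots> \<le> C * norm x" by (simp add: C_def algebra_simps)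
    finally show ?thesis .
  qed
  have "C-lipschitz_on UNIV N"
  proof (rule lipschitz_onI)
    fix x y
    have "N x \<le> N y + N (x - y)" using tri[of y "x - y"] by simp
    moreover have "N y \<le> N x + N (x - y)" using tri[of x "y - x"] sc[of "-1" "x - y"] by simp
    ultimately show "dist (N x) (N y) \<le> C * dist x y" using up[of "x - y"] by (simp add: dist_norm)
  qed (use C in simp)
  then have cont: "continuous_on (sphere 0 1) N" by (intro continuous_on_subset[OF lipschitz_on_continuous_on]) auto
  obtain b :: 'a where "b \<in> Basis" using nonempty_Basis by blast
  then have "b \<in> sphere 0 1" by simp
  then have "sphere (0::'a) 1 \<noteq> {}" by blast
  then obtain x0 where x0: "x0 \<in> sphere 0 1" "\<And>x. x \<in> sphere 0 1 \<Longrightarrow> N x0 \<le> N x"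
    using continuous_attains_inf[OF compact_sphere _ cont] by blast
  have "x0 \<noteq> 0" using x0(1) by auto
  then have N0: "0 < N x0" using pos[of x0] zero[of x0] by linarith
  have "norm x \<le> 1 / N x0 * N x" for x
  proof (cases "x = 0")
    case False
    have "N x0 \<le> N ((1 / norm x) *\<^sub>R x)" by (rule x0(2)) (use False in simp)
    then have "N x0 * norm x \<le> N x" using False by (simp add: sc field_simps)
    then show ?thesis using N0 by (simp add: field_simps)
  qed (use pos in simp)
  then show thesis using that[of C "1 / N x0"] C N0 up by simp
qed

text \<open>Smallness of the extended-real supremum makes it finite, hence a genuine Lipschitz
  constant; equal pairs, which the supremum leaves out, satisfy the estimate trivially.\<close>

lemma lipschitz_modulus_small:
  assumes N: "is_norm N" and lim: "((\<lambda>r. lipschitz_modulus N g r) \<longlongrightarrow> 0) (at_right 0)" and \<eta>: "0 < \<eta>"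
  obtains r where "0 < r" "\<And>u v u' v'. N u < r \<Longrightarrow> N v < r \<Longrightarrow> N u' < r \<Longrightarrow> N v' < r \<Longrightarrow>
    N (g u v - g u' v') \<le> \<eta> * (N (u - u') + N (v - v'))"
proof -
  have "\<forall>\<^sub>F r in at_right 0. lipschitz_modulus N g r < ereal \<eta>"
    using order_tendstoD(2)[OF lim, of "ereal \<eta>"] \<eta> by simp
  then obtain b where b: "0 < b" "\<And>r. 0 < r \<Longrightarrow> r < b \<Longrightarrow> lipschitz_modulus N g r < ereal \<eta>"
    unfolding eventually_at_right_field by blast
  define r where "r = b / 2"
  have r: "0 < r" "lipschitz_modulus N g r < ereal \<eta>" using b by (auto simp: r_def)
  have pos: "0 \<le> N x" and zero: "N x = 0 \<longleftrightarrow> x = 0" for x using N by (auto simp: is_norm_def)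
  have "N (g u v - g u' v') \<le> \<eta> * (N (u - u') + N (v - v'))"
    if "N u < r" "N v < r" "N u' < r" "N v' < r" for u v u' v'
  proof (cases "(u, v) = (u', v')")
    case True
    then show ?thesis using zero[of 0] by simp
  next
    case False
    let ?d = "N (u - u') + N (v - v')"
    have d: "0 < ?d"
      using False pos[of "u - u'"] pos[of "v - v'"] zero[of "u - u'"] zero[of "v - v'"] by (cases "u = u'") auto
    have "ereal (N (g u v - g u' v') / ?d) \<le> lipschitz_modulus N g r"
      unfolding lipschitz_modulus_def using that False by (intro Sup_upper) blast
    then have "ereal (N (g u v - g u' v') / ?d) < ereal \<eta>" using r(2) by (rule le_less_trans)
    then have "N (g u v - g u' v') / ?d < \<eta>" by simp
    then show ?thesis using d by (simp add: field_simps)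
  qed
  then show thesis using that r(1) by blast
qed

section \<open>Uniqueness of solutions\<close>

lemma has_integral_kernel_segment:
  fixes \<alpha> :: real
  assumes "0 < \<alpha>" "a \<le> t"
  shows "((\<lambda>s. (t - s) powr (\<alpha> - 1)) has_integral ((t - a) powr \<alpha> / \<alpha>)) {a..t}"
proof -
  have "((\<lambda>s. (t - s) powr (\<alpha> - 1)) has_integral ((\<lambda>s. - ((t - s) powr \<alpha> / \<alpha>)) t - (\<lambda>s. - ((t - s) powr \<alpha> / \<alpha>)) a)) {a..t}"
  proof (rule fundamental_theorem_of_calculus_interior[OF assms(2)])
    show "continuous_on {a..t} (\<lambda>s. - ((t - s) powr \<alpha> / \<alpha>))"
      using assms by (intro continuous_intros continuous_on_powr') auto
    fix s assume s: "s \<in> {a<..<t}"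
    have "((\<lambda>s. - ((t - s) powr \<alpha> / \<alpha>)) has_real_derivative (t - s) powr (\<alpha> - 1)) (at s)"
      using s assms by (auto intro!: derivative_eq_intros simp: field_simps)
    then show "((\<lambda>s. - ((t - s) powr \<alpha> / \<alpha>)) has_vector_derivative (t - s) powr (\<alpha> - 1)) (at s)"
      by (simp add: has_real_derivative_iff_has_vector_derivative)
  qed
  then show ?thesis using assms by simp
qed

text \<open>Only \<open>x\<close> is known to stay in the ball where \<open>g\<close> is Lipschitz.
  Agreement up to the last time \<open>t0\<close> puts \<open>y\<close> there too, and continuity
  keeps it there slightly longer. On a short interval the weakly singular integral contracts the
  difference, so the agreement extends beyond \<open>t0\<close>.\<close>

lemma solution_unique:
  fixes A :: "real ^ 'd ^ 'd"
  assumes \<alpha>: "0 < \<alpha>" and \<tau>: "0 < \<tau>" and T: "0 < T" and \<eta>: "0 \<le> \<eta>"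
    and lip: "\<And>u v u' v'. norm u < r \<Longrightarrow> norm v < r \<Longrightarrow> norm u' < r \<Longrightarrow> norm v' < r \<Longrightarrow>
      norm (g u v - g u' v') \<le> \<eta> * (norm (u - u') + norm (v - v'))"
    and x: "solution_on \<alpha> \<tau> A g \<phi> T x" and xr: "\<And>t. t \<in> {-\<tau>..T} \<Longrightarrow> norm (x t) < r"
    and y: "solution_on \<alpha> \<tau> A g \<phi> T y"
  shows "\<forall>t\<in>{-\<tau>..T}. y t = x t"
proof -
  let ?f = "\<lambda>x t s. (t - s) powr (\<alpha> - 1) *\<^sub>R (A *v x (s - \<tau>) + g (x s) (x (s - \<tau>)))"
  have cx: "continuous_on {-\<tau>..T} x" and cy: "continuous_on {-\<tau>..T} y"
    using x y by (auto simp: solution_on_def)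
  have xint: "?f x t integrable_on {0..t}" "x t = \<phi> 0 + (1 / Gamma \<alpha>) *\<^sub>R integral {0..t} (?f x t)"
    and yint: "?f y t integrable_on {0..t}" "y t = \<phi> 0 + (1 / Gamma \<alpha>) *\<^sub>R integral {0..t} (?f y t)" if "t \<in> {0..T}" for t
    using x y that by (auto simp: solution_on_def set_lebesgue_integral_eq_integral(1))
  define Z where "Z = {t \<in> {0..T}. \<forall>s\<in>{-\<tau>..t}. y s = x s}"
  have hist: "y s = x s" if "s \<in> {-\<tau>..0}" for s using x y that by (auto simp: solution_on_def)
  have Z0: "0 \<in> Z" using hist T by (auto simp: Z_def)
  have Zb: "bdd_above Z" by (auto simp: Z_def bdd_above_def)
  define t0 where "t0 = Sup Z"
  have t0: "0 \<le> t0" "t0 \<le> T" unfolding t0_def using Z0 Zb by (auto intro!: cSup_upper cSup_least simp: Z_def)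
  have before: "y s = x s" if "-\<tau> \<le> s" "s < t0" for s
  proof -
    have "s < Sup Z" using that by (simp add: t0_def)
    then obtain t where "t \<in> Z" "s < t" by (rule less_cSupE) (use Z0 in auto)
    then show ?thesis using that by (auto simp: Z_def)
  qed
  have eq0: "y s = x s" if s: "s \<in> {-\<tau>..t0}" for s
  proof (cases "s < t0")
    case True then show ?thesis using before s by simp
  next
    case False
    then have st: "s = t0" using s by simp
    show ?thesis
    proof (cases "t0 = 0")
      case True then show ?thesis using hist st \<tau> by simp
    next
      case False
      have tt: "- \<tau> < t0" using t0 \<tau> by simp
      have l1: "(x \<longlongrightarrow> x t0) (at_left t0)" "(y \<longlongrightarrow> y t0) (at_left t0)"
        unfolding at_within_Icc_at_left[OF tt, symmetric]
        using continuous_on_subset[OF cx, of "{- \<tau>..t0}"] continuous_on_subset[OF cy, of "{- \<tau>..t0}"] t0 tt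
        by (auto simp: continuous_on_def)
      have "\<forall>\<^sub>F s in at_left t0. y s = x s"
        by (rule eventually_mono[OF eventually_at_left_real[OF tt]]) (auto intro: before)
      then have "(x \<longlongrightarrow> y t0) (at_left t0)" by (rule Lim_transform_eventually[OF l1(2)])
      then show ?thesis using tendsto_unique[OF trivial_limit_at_left_real l1(1)] st by simp
    qed
  qed
  have "t0 = T"
  proof (rule ccontr)
    assume "t0 \<noteq> T"
    then have t0T: "t0 < T" using t0 by simp
    have "norm (y t0) < r" using eq0[of t0] xr[of t0] t0 \<tau> by simp
    moreover have "(y \<longlongrightarrow> y t0) (at t0 within {-\<tau>..T})" using cy t0 \<tau> by (auto simp: continuous_on_def)
    ultimately have "\<forall>\<^sub>F s in at t0 within {-\<tau>..T}. norm (y s) < r" by (intro order_tendstoD(2)[OF tendsto_norm])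
    then obtain d where d: "0 < d" "\<And>s. s \<in> {-\<tau>..T} \<Longrightarrow> s \<noteq> t0 \<Longrightarrow> dist s t0 < d \<Longrightarrow> norm (y s) < r"
      unfolding eventually_at by blast
    define Na where "Na = onorm ((*v) A)"
    have Na: "norm (A *v u) \<le> Na * norm u" "0 \<le> Na" for u
      unfolding Na_def by (rule onorm[OF matrix_vector_mul_bounded_linear], rule onorm_pos_le[OF matrix_vector_mul_bounded_linear])
    have G: "0 < Gamma \<alpha>" by (rule Gamma_real_pos[OF \<alpha>])
    \<comment> \<open>The kernel integrates to h^\<alpha>/\<alpha> over a segment of length h, and
      the right-hand side varies by at most Na + 2\<eta> times the maximal difference. Thus q
      h^\<alpha> is the contraction factor on that segment.\<close>
    define q where "q = (Na + 2 * \<eta>) / (Gamma \<alpha> * \<alpha>)"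
    have q: "0 \<le> q" using Na(2) \<eta> G \<alpha> by (simp add: q_def)
    \<comment> \<open>The three bounds keep \<open>y\<close> in the ball, keep the segment inside
      [0,T], and make q h^\<alpha> at most 1/2.\<close>
    define h where "h = min (d / 2) (min (T - t0) ((1 / (2 * (q + 1))) powr (1 / \<alpha>)))"
    have h: "h \<le> d / 2" "h \<le> T - t0" "h \<le> (1 / (2 * (q + 1))) powr (1 / \<alpha>)"
      unfolding h_def by (rule min.cobounded1, rule min.coboundedI2[OF min.cobounded1], rule min.coboundedI2[OF min.cobounded2])
    have h0: "0 < h" using d(1) t0T q by (simp add: h_def)
    note h = h0 h
    have "h powr \<alpha> \<le> ((1 / (2 * (q + 1))) powr (1 / \<alpha>)) powr \<alpha>" using h \<alpha> by (intro powr_mono2) auto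
    also have "\<dots> = 1 / (2 * (q + 1))" using q \<alpha> by (simp add: powr_powr)
    finally have "q * h powr \<alpha> \<le> q * (1 / (2 * (q + 1)))" using q by (rule mult_left_mono)
    also have "\<dots> \<le> 1 / 2" using q by (simp add: field_simps)
    finally have qh: "q * h powr \<alpha> \<le> 1 / 2" .
    have yr: "norm (y s) < r" if "s \<in> {-\<tau>..t0 + h}" for s
    proof (cases "s \<le> t0")
      case True then show ?thesis using eq0[of s] xr[of s] that t0 by simp
    next
      case False then show ?thesis using d(2)[of s] that h d(1) by (simp add: dist_real_def)
    qed
    have "continuous_on {t0..t0 + h} (\<lambda>s. norm (x s - y s))"
      using cx cy t0 \<tau> h by (intro continuous_intros) (auto elim!: continuous_on_subset)
    then obtain s0 where s0: "s0 \<in> {t0..t0 + h}" "\<And>s. s \<in> {t0..t0 + h} \<Longrightarrow> norm (x s - y s) \<le> norm (x s0 - y s0)"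
      using continuous_attains_sup[of "{t0..t0 + h}" "\<lambda>s. norm (x s - y s)"] h by auto
    define m where "m = norm (x s0 - y s0)"
    have mb: "norm (x s - y s) \<le> m" if "s \<in> {-\<tau>..t0 + h}" for s
    proof (cases "s \<le> t0")
      case True then show ?thesis using eq0[of s] that by (simp add: m_def)
    next
      case False then show ?thesis using s0(2)[of s] that by (simp add: m_def)
    qed
    have s0T: "s0 \<in> {0..T}" using s0(1) t0 h by auto
    let ?c = "(Na + 2 * \<eta>) * m"
    \<comment> \<open>Before \<open>t0\<close> the integrands agree, including their delayed
      arguments, so the memory of the fractional integral cancels and only the part of the kernel
      after \<open>t0\<close> remains.\<close>
    have pw: "norm (?f x s0 s - ?f y s0 s) \<le> (if s \<in> {t0..s0} then ?c * (s0 - s) powr (\<alpha> - 1) else 0)" if s: "s \<in> {0..s0}" for s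
    proof (cases "t0 \<le> s")
      case False
      then have "y s = x s" "y (s - \<tau>) = x (s - \<tau>)" using s \<tau> by (auto intro!: eq0)
      then show ?thesis using False by simp
    next
      case True
      have ss: "s \<in> {-\<tau>..t0 + h}" "s - \<tau> \<in> {-\<tau>..t0 + h}" using s s0(1) \<tau> t0 by auto
      have sT: "s \<in> {-\<tau>..T}" "s - \<tau> \<in> {-\<tau>..T}" using ss h by auto
      have "norm (A *v (x (s - \<tau>) - y (s - \<tau>))) \<le> Na * m"
        using Na(1)[of "x (s - \<tau>) - y (s - \<tau>)"] mult_left_mono[OF mb[OF ss(2)] Na(2)] by linarith
      moreover have "norm (g (x s) (x (s - \<tau>)) - g (y s) (y (s - \<tau>))) \<le> \<eta> * (m + m)"
        using lip[OF xr[OF sT(1)] xr[OF sT(2)] yr[OF ss(1)] yr[OF ss(2)]]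
          mult_left_mono[OF add_mono[OF mb[OF ss(1)] mb[OF ss(2)]] \<eta>] by linarith
      moreover have "(A *v x (s - \<tau>) + g (x s) (x (s - \<tau>))) - (A *v y (s - \<tau>) + g (y s) (y (s - \<tau>))) =
          A *v (x (s - \<tau>) - y (s - \<tau>)) + (g (x s) (x (s - \<tau>)) - g (y s) (y (s - \<tau>)))"
        by (simp add: matrix_vector_mult_diff_distrib)
      ultimately have "norm ((A *v x (s - \<tau>) + g (x s) (x (s - \<tau>))) - (A *v y (s - \<tau>) + g (y s) (y (s - \<tau>)))) \<le> Na * m + \<eta> * (m + m)"
        by (metis add_mono norm_triangle_le)
      also have "\<dots> = ?c" by (simp add: algebra_simps)
      finally have "(s0 - s) powr (\<alpha> - 1) * norm ((A *v x (s - \<tau>) + g (x s) (x (s - \<tau>))) - (A *v y (s - \<tau>) + g (y s) (y (s - \<tau>)))) \<le> (s0 - s) powr (\<alpha> - 1) * ?c"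
        by (rule mult_left_mono) simp
      then show ?thesis using True s by (simp add: scaleR_diff_right[symmetric] mult.commute)
    qed
    have Bint: "((\<lambda>s. if s \<in> {t0..s0} then ?c * (s0 - s) powr (\<alpha> - 1) else 0) has_integral ?c * ((s0 - t0) powr \<alpha> / \<alpha>)) {0..s0}"
      using has_integral_mult_right[OF has_integral_kernel_segment[OF \<alpha>, of t0 s0], of ?c] s0(1) t0
      by (subst has_integral_restrict) auto
    have "x s0 - y s0 = (1 / Gamma \<alpha>) *\<^sub>R integral {0..s0} (\<lambda>s. ?f x s0 s - ?f y s0 s)"
    proof -
      have "integral {0..s0} (\<lambda>s. ?f x s0 s - ?f y s0 s) = integral {0..s0} (?f x s0) - integral {0..s0} (?f y s0)"
        by (rule Henstock_Kurzweil_Integration.integral_diff[OF xint(1)[OF s0T] yint(1)[OF s0T]])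
      then show ?thesis unfolding xint(2)[OF s0T] yint(2)[OF s0T] by (simp only: scaleR_diff_right add_diff_cancel_left)
    qed
    then have "m = (1 / Gamma \<alpha>) * norm (integral {0..s0} (\<lambda>s. ?f x s0 s - ?f y s0 s))"
      using G by (simp add: m_def)
    also have "\<dots> \<le> (1 / Gamma \<alpha>) * (?c * ((s0 - t0) powr \<alpha> / \<alpha>))"
    proof (rule mult_left_mono)
      have "norm (integral {0..s0} (\<lambda>s. ?f x s0 s - ?f y s0 s)) \<le> integral {0..s0} (\<lambda>s. if s \<in> {t0..s0} then ?c * (s0 - s) powr (\<alpha> - 1) else 0)"
        using has_integral_integrable[OF Bint]
        by (intro Henstock_Kurzweil_Integration.integral_norm_bound_integral Henstock_Kurzweil_Integration.integrable_diff xint(1)[OF s0T] yint(1)[OF s0T] pw)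
      then show "norm (integral {0..s0} (\<lambda>s. ?f x s0 s - ?f y s0 s)) \<le> ?c * ((s0 - t0) powr \<alpha> / \<alpha>)"
        by (simp only: integral_unique[OF Bint])
    qed (use G in simp)
    also have "\<dots> = (q * (s0 - t0) powr \<alpha>) * m" by (simp add: q_def)
    also have "\<dots> \<le> (1 / 2) * m"
    proof (rule mult_right_mono)
      have "(s0 - t0) powr \<alpha> \<le> h powr \<alpha>" using s0(1) \<alpha> by (intro powr_mono2) auto
      then show "q * (s0 - t0) powr \<alpha> \<le> 1 / 2" using qh mult_left_mono[OF _ q] by fastforce
    qed (simp add: m_def)
    finally have "m \<le> 0" by simp
    have "y s = x s" if "s \<in> {-\<tau>..t0 + h}" for s
    proof -
      have "norm (x s - y s) \<le> 0" using mb[OF that] \<open>m \<le> 0\<close> by linarith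
      then show ?thesis by simp
    qed
    then have "t0 + h \<in> Z" using t0 h by (auto simp: Z_def)
    then have "t0 + h \<le> t0" unfolding t0_def using Zb by (rule cSup_upper)
    then show False using h by simp
  qed
  then show ?thesis using eq0 by blast
qed

section \<open>From the diagonalized system to solutions\<close>

lemma has_bochner_integral_vec:
  fixes f :: "'b \<Rightarrow> real ^ 'd"
  assumes "\<And>j. has_bochner_integral M (\<lambda>s. f s $ j) (I $ j)"
  shows "has_bochner_integral M f I"
proof -
  have ex: "(\<Sum>j\<in>UNIV. (v $ j) *\<^sub>R axis j 1) = v" for v :: "real ^ 'd"
    using basis_expansion[of v] by (simp add: scalar_mult_eq_scaleR)
  have "has_bochner_integral M (\<lambda>s. \<Sum>j\<in>UNIV. (f s $ j) *\<^sub>R (axis j 1 :: real ^ 'd)) (\<Sum>j\<in>UNIV. (I $ j) *\<^sub>R axis j 1)"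
    by (intro has_bochner_integral_sum has_bochner_integral_scaleR_left assms)
  then show ?thesis by (simp only: ex)
qed

lemma absolutely_integrable_on_of_lborel:
  fixes f :: "real \<Rightarrow> 'a::euclidean_space"
  assumes "set_integrable lborel S f"
  shows "f absolutely_integrable_on S"
  using assms borel_measurable_integrable integrable_completion unfolding set_integrable_def by blast

lemma solution_onI:
  fixes A :: "real ^ 'd ^ 'd"
  assumes \<alpha>: "0 < \<alpha>" and cont: "continuous_on {-\<tau>..T} x" and hist: "\<And>t. t \<in> {-\<tau>..0} \<Longrightarrow> x t = \<phi> t"
    and eq: "\<And>t. t \<in> {0..T} \<Longrightarrow> has_bochner_integral lborel
      (\<lambda>s. indicator {0..} s *\<^sub>R (rl_kernel \<alpha> (t - s) *\<^sub>R (A *v x (s - \<tau>) + g (x s) (x (s - \<tau>))))) (x t - \<phi> 0)"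
  shows "solution_on \<alpha> \<tau> A g \<phi> T x"
  unfolding solution_on_def
proof (intro conjI ballI)
  fix t assume t: "t \<in> {0..T}"
  let ?h = "\<lambda>s. A *v x (s - \<tau>) + g (x s) (x (s - \<tau>))"
  let ?f = "\<lambda>s. (t - s) powr (\<alpha> - 1) *\<^sub>R ?h s"
  have G: "0 < Gamma \<alpha>" by (rule Gamma_real_pos[OF \<alpha>])
  have "has_bochner_integral lborel (\<lambda>s. Gamma \<alpha> *\<^sub>R (indicator {0..} s *\<^sub>R (rl_kernel \<alpha> (t - s) *\<^sub>R ?h s))) (Gamma \<alpha> *\<^sub>R (x t - \<phi> 0))"
    by (intro has_bochner_integral_scaleR_right eq t)
  \<comment> \<open>At s = t both sides are 0, because
    \<open>0 powr (\<alpha> - 1) = 0\<close>.\<close>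
  moreover have "Gamma \<alpha> *\<^sub>R (indicator {0..} s *\<^sub>R (rl_kernel \<alpha> (t - s) *\<^sub>R ?h s)) = indicator {0..t} s *\<^sub>R ?f s" for s
    using G by (auto simp: rl_kernel_def indicator_def)
  ultimately have b: "has_bochner_integral lborel (\<lambda>s. indicator {0..t} s *\<^sub>R ?f s) (Gamma \<alpha> *\<^sub>R (x t - \<phi> 0))" by (simp only:)
  then have si: "set_integrable lborel {0..t} ?f" by (simp add: set_integrable_def has_bochner_integral_iff)
  then show "?f absolutely_integrable_on {0..t}" by (rule absolutely_integrable_on_of_lborel)
  have "integral {0..t} ?f = Gamma \<alpha> *\<^sub>R (x t - \<phi> 0)"
    using set_borel_integral_eq_integral(2)[OF si] has_bochner_integral_integral_eq[OF b] by (simp add: set_lebesgue_integral_def)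
  then show "x t = \<phi> 0 + (1 / Gamma \<alpha>) *\<^sub>R integral {0..t} ?f" using G by simp
qed (use cont hist in auto)

text \<open>In the coordinates that nearly diagonalize \<open>A\<close> the fixed point y is
  complex, and P y is not known to be real. The real part inside \<open>W\<close> ensures that
  \<open>g\<close> is evaluated at real vectors only. Since \<open>A\<close> is real, the real part
  of P y still solves the original equation. The nearly vanishing matrix \<open>M\<close> and the
  transformed \<open>g\<close> together form the perturbation \<open>\<Phi>\<close>.\<close>

lemma small_solutions:
  fixes A :: "real ^ 'd ^ 'd" and g :: "real ^ 'd \<Rightarrow> real ^ 'd \<Rightarrow> real ^ 'd"
  assumes \<alpha>: "0 < \<alpha>" "\<alpha> < 1" and \<tau>: "0 < \<tau>" and g0: "g 0 0 = 0"
    and lip: "\<And>\<eta>. 0 < \<eta> \<Longrightarrow> \<exists>r>0. \<forall>u v u' v'. norm u < r \<longrightarrow> norm v < r \<longrightarrow> norm u' < r \<longrightarrow> norm v' < r \<longrightarrow>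
      norm (g u v - g u' v') \<le> \<eta> * (norm (u - u') + norm (v - v'))"
    and ev: "\<And>z. complex_eigenvalue A z \<Longrightarrow> z \<in> stability_region \<alpha> \<tau>"
    and e: "0 < e"
  shows "\<exists>\<delta>>0. \<forall>\<phi>. continuous_on {-\<tau>..0} \<phi> \<and> (\<forall>t\<in>{-\<tau>..0}. norm (\<phi> t) \<le> \<delta>) \<longrightarrow>
    (\<exists>x. maximal_solution \<alpha> \<tau> A g \<phi> \<infinity> x \<and> (\<forall>t\<ge>0. norm (x t) \<le> e) \<and> (x \<longlongrightarrow> 0) at_top)"
proof -
  obtain \<Lambda> :: "'d \<Rightarrow> complex" where
    eig: "\<forall>i. \<exists>v. (\<exists>j. v j \<noteq> 0) \<and> (\<forall>j. (\<Sum>k\<in>UNIV. of_real (A $ j $ k) * v k) = \<Lambda> i * v j)"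
    and diag: "\<forall>\<epsilon>>0. \<exists>P Q M. (\<forall>i j. (\<Sum>k\<in>UNIV. P i k * Q k j) = (if i = j then 1 else 0)) \<and>
      (\<forall>i j. (\<Sum>k\<in>UNIV. of_real (A $ i $ k) * P k j) = P i j * \<Lambda> j + (\<Sum>k\<in>UNIV. P i k * M k j)) \<and>
      (\<forall>i j. cmod (M i j) \<le> \<epsilon>)"
    using near_diagonalization[of "\<lambda>i j. of_real (A $ i $ j)"] by (elim exE conjE) (rule that)
  have \<Lambda>: "\<Lambda> i \<in> stability_region \<alpha> \<tau>" for i
  proof (rule ev)
    obtain v where v: "(\<exists>j. v j \<noteq> 0) \<and> (\<forall>j. (\<Sum>k\<in>UNIV. of_real (A $ j $ k) * v k) = \<Lambda> i * v j)"
      using spec[OF eig, of i] by (rule exE)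
    show "complex_eigenvalue A (\<Lambda> i)"
      unfolding complex_eigenvalue_def
      using v by (intro exI[of _ "\<chi> j. v j"])
        (auto simp: Finite_Cartesian_Product.vec_eq_iff matrix_vector_mult_def map_matrix_def)
  qed
  define R where "R = (\<lambda>i. LINT t|lborel. cmod (delay_ml \<alpha> \<tau> (\<Lambda> i) 0 t))"
  define S where "S = (\<Sum>i\<in>UNIV. R i)"
  have R0: "0 \<le> R i" for i by (simp add: R_def)
  have S0: "0 \<le> S" unfolding S_def by (intro sum_nonneg R0)
  define n where "n = real CARD('d)"
  have n: "0 < n" by (simp add: n_def)
  \<comment> \<open>\<open>\<epsilon>\<close> for the matrix part and, below, \<open>\<eta>\<close>
    for the part of \<open>g\<close> each use up a quarter of the bound 1/2 on 2 \<kappa> S. The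
    added 1 keeps the denominators positive.\<close>
  define \<epsilon> where "\<epsilon> = 1 / (8 * (n * S + 1))"
  have \<epsilon>: "0 < \<epsilon>" "2 * (n * \<epsilon>) * S \<le> 1 / 4"
  proof -
    have p: "0 < n * S + 1" using n S0 by (intro add_nonneg_pos) auto
    then show "0 < \<epsilon>" by (simp add: \<epsilon>_def)
    show "2 * (n * \<epsilon>) * S \<le> 1 / 4" using p by (simp add: \<epsilon>_def field_simps)
  qed
  obtain P Q M where PQ': "\<forall>i j. (\<Sum>k\<in>UNIV. P i k * Q k j) = (if i = j then 1 else 0)"
    and AP': "\<forall>i j. (\<Sum>k\<in>UNIV. of_real (A $ i $ k) * P k j) = P i j * \<Lambda> j + (\<Sum>k\<in>UNIV. P i k * M k j)"
    and M': "\<forall>i j. cmod (M i j) \<le> \<epsilon>"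
    using diag[rule_format, OF \<epsilon>(1)] by (elim exE conjE) (rule that)
  note PQ = PQ'[rule_format] and AP = AP'[rule_format] and M = M'[rule_format]
  define Cp where "Cp = (\<Sum>j\<in>UNIV. \<Sum>i\<in>UNIV. cmod (P j i))"
  define Cq where "Cq = (\<Sum>j\<in>UNIV. \<Sum>i\<in>UNIV. cmod (Q j i))"
  have Cp: "0 \<le> Cp" and Cq: "0 \<le> Cq" by (auto simp: Cp_def Cq_def intro!: sum_nonneg)
  define \<eta> where "\<eta> = 1 / (8 * (Cq * Cp * S + 1))"
  have \<eta>: "0 < \<eta>" "2 * (Cq * \<eta> * Cp) * S \<le> 1 / 4"
  proof -
    have p: "0 < Cq * Cp * S + 1" using Cp Cq S0 by (intro add_nonneg_pos) auto
    then show "0 < \<eta>" by (simp add: \<eta>_def)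
    show "2 * (Cq * \<eta> * Cp) * S \<le> 1 / 4" using p by (simp add: \<eta>_def field_simps)
  qed
  obtain r where r: "0 < r" and glip: "\<And>u v u' v'. norm u < r \<Longrightarrow> norm v < r \<Longrightarrow> norm u' < r \<Longrightarrow> norm v' < r \<Longrightarrow>
      norm (g u v - g u' v') \<le> \<eta> * (norm (u - u') + norm (v - v'))"
    using lip[OF \<eta>(1)] by blast
  \<comment> \<open>\<open>Cp * \<rho>\<close> bounds \<open>W\<close> on the ball of radius
    \<open>\<rho>\<close>; it has to stay below the radius \<open>r\<close> where \<open>g\<close>
    is Lipschitz and within the target bound \<open>e\<close>.\<close>
  define \<rho> where "\<rho> = min r e / (2 * (Cp + 1))"
  have \<rho>: "0 < \<rho>" using r e Cp by (simp add: \<rho>_def)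
  have Cp\<rho>: "Cp * \<rho> < r" "Cp * \<rho> \<le> e"
  proof -
    have "Cp * \<rho> \<le> (Cp + 1) * \<rho>" using \<rho> by (intro mult_right_mono) auto
    also have "\<dots> = min r e / 2" using Cp by (simp add: \<rho>_def field_simps)
    finally have "Cp * \<rho> \<le> min r e / 2" .
    then show "Cp * \<rho> < r" "Cp * \<rho> \<le> e" using r e by (auto simp: min_def split: if_splits)
  qed
  define W :: "complex ^ 'd \<Rightarrow> real ^ 'd" where "W = (\<lambda>u. \<chi> j. Re (\<Sum>i\<in>UNIV. P j i * u $ i))"
  have W_diff: "W u - W u' = W (u - u')" for u u'
    by (simp add: W_def Finite_Cartesian_Product.vec_eq_iff right_diff_distrib sum_subtractf)
  have W_norm: "norm (W u) \<le> Cp * norm u" for u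
  proof -
    have "norm (W u) \<le> (\<Sum>j\<in>UNIV. \<bar>W u $ j\<bar>)" by (rule norm_le_l1_cart)
    also have "\<dots> \<le> (\<Sum>j\<in>UNIV. (\<Sum>i\<in>UNIV. cmod (P j i)) * norm u)"
    proof (rule sum_mono)
      fix j
      have "\<bar>W u $ j\<bar> \<le> cmod (\<Sum>i\<in>UNIV. P j i * u $ i)" unfolding W_def by (simp only: vec_lambda_beta abs_Re_le_cmod)
      also have "\<dots> \<le> (\<Sum>i\<in>UNIV. cmod (P j i) * norm u)"
        by (rule sum_norm_le) (simp add: norm_mult mult_left_mono Finite_Cartesian_Product.norm_nth_le)
      finally show "\<bar>W u $ j\<bar> \<le> (\<Sum>i\<in>UNIV. cmod (P j i)) * norm u" by (simp only: sum_distrib_right)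
    qed
    also have "\<dots> = Cp * norm u" by (simp only: Cp_def sum_distrib_right)
    finally show ?thesis .
  qed
  have W_cont: "continuous_on X W" for X
    unfolding W_def by (intro continuous_on_vec_lambda continuous_intros)
  have W0: "W 0 = 0" by (simp add: W_def Finite_Cartesian_Product.vec_eq_iff)
  have W_small: "norm (W u) < r" if "norm u \<le> \<rho>" for u
    using W_norm[of u] mult_left_mono[OF that Cp] Cp\<rho>(1) by linarith
  define V :: "real ^ 'd \<Rightarrow> complex ^ 'd" where "V = (\<lambda>w. \<chi> i. \<Sum>k\<in>UNIV. Q i k * of_real (w $ k))"
  have V_nth: "cmod (V w $ i) \<le> (\<Sum>k\<in>UNIV. cmod (Q i k)) * norm w" for w i
  proof -
    have "cmod (V w $ i) \<le> (\<Sum>k\<in>UNIV. cmod (Q i k) * norm w)"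
      unfolding V_def vec_lambda_beta
      by (rule sum_norm_le) (simp add: norm_mult mult_left_mono component_le_norm_cart)
    then show ?thesis by (simp only: sum_distrib_right)
  qed
  have V_norm: "norm (V w) \<le> Cq * norm w" for w
    using norm_vec_le_bound[OF V_nth] by (simp only: Cq_def sum_distrib_right)
  have V_nth': "cmod (V w $ i) \<le> Cq * norm w" for w i
    using Finite_Cartesian_Product.norm_nth_le[of "V w" i] V_norm[of w] by linarith
  have PV: "(\<Sum>i\<in>UNIV. P j i * V w $ i) = of_real (w $ j)" for w j
  proof -
    have "(\<Sum>i\<in>UNIV. P j i * V w $ i) = (\<Sum>i\<in>UNIV. \<Sum>k\<in>UNIV. P j i * Q i k * of_real (w $ k))"
      by (simp add: V_def sum_distrib_left mult.assoc)
    also have "\<dots> = (\<Sum>k\<in>UNIV. \<Sum>i\<in>UNIV. P j i * Q i k * of_real (w $ k))" by (rule sum.swap)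
    also have "\<dots> = (\<Sum>k\<in>UNIV. (if j = k then 1 else 0) * of_real (w $ k))" by (simp only: sum_distrib_right[symmetric] PQ)
    also have "\<dots> = (\<Sum>k\<in>UNIV. if j = k then of_real (w $ k) else 0)" by (intro sum.cong) auto
    also have "\<dots> = of_real (w $ j)" by simp
    finally show ?thesis .
  qed
  have WV: "W (V w) = w" for w by (simp only: W_def Finite_Cartesian_Product.vec_eq_iff vec_lambda_beta PV Re_complex_of_real simp_thms)
  \<comment> \<open>\<open>M\<close> acts on the delayed argument, like the diagonal part, and
    \<open>V\<close>, a right inverse of P on real vectors, brings the value of \<open>g\<close>
    into the new coordinates.\<close>
  define \<Phi> where "\<Phi> = (\<lambda>u v. \<chi> i. (\<Sum>k\<in>UNIV. M i k * v $ k) + V (g (W u) (W v)) $ i)"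
  define \<kappa> where "\<kappa> = n * \<epsilon> + Cq * \<eta> * Cp"
  have \<kappa>: "0 \<le> \<kappa>" "2 * \<kappa> * (\<Sum>i\<in>UNIV. R i) \<le> 1 / 2"
  proof -
    show "0 \<le> \<kappa>" using n \<epsilon> \<eta> Cp Cq by (simp add: \<kappa>_def)
    have "2 * \<kappa> * S = 2 * (n * \<epsilon>) * S + 2 * (Cq * \<eta> * Cp) * S" by (simp add: \<kappa>_def algebra_simps)
    then show "2 * \<kappa> * (\<Sum>i\<in>UNIV. R i) \<le> 1 / 2" using \<epsilon>(2) \<eta>(2) unfolding S_def by linarith
  qed
  have \<Phi>0: "\<Phi> 0 0 = 0" by (simp add: \<Phi>_def W0 g0 V_def Finite_Cartesian_Product.vec_eq_iff)
  have \<Phi>lip: "norm (\<Phi> u v $ i - \<Phi> u' v' $ i) \<le> \<kappa> * (norm (u - u') + norm (v - v'))"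
    if b: "norm u \<le> \<rho>" "norm v \<le> \<rho>" "norm u' \<le> \<rho>" "norm v' \<le> \<rho>" for u v u' v' i
  proof -
    let ?d = "g (W u) (W v) - g (W u') (W v')"
    have "\<Phi> u v $ i - \<Phi> u' v' $ i = (\<Sum>k\<in>UNIV. M i k * (v - v') $ k) + V ?d $ i"
      by (simp add: \<Phi>_def V_def right_diff_distrib sum_subtractf)
    then have "norm (\<Phi> u v $ i - \<Phi> u' v' $ i) \<le> cmod (\<Sum>k\<in>UNIV. M i k * (v - v') $ k) + cmod (V ?d $ i)"
      by (simp only: norm_triangle_ineq)
    moreover have "cmod (\<Sum>k\<in>UNIV. M i k * (v - v') $ k) \<le> (\<Sum>k\<in>(UNIV :: 'd set). \<epsilon> * norm (v - v'))"
      by (rule sum_norm_le) (simp only: norm_mult, intro mult_mono M Finite_Cartesian_Product.norm_nth_le, use \<epsilon> in auto)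
    moreover have "(\<Sum>k\<in>(UNIV :: 'd set). \<epsilon> * norm (v - v')) = n * \<epsilon> * norm (v - v')" by (simp add: n_def)
    moreover have "cmod (V ?d $ i) \<le> Cq * \<eta> * Cp * (norm (u - u') + norm (v - v'))"
    proof -
      have "norm ?d \<le> \<eta> * (norm (W u - W u') + norm (W v - W v'))" by (intro glip W_small b)
      also have "\<dots> \<le> \<eta> * (Cp * norm (u - u') + Cp * norm (v - v'))"
        unfolding W_diff using \<eta> by (intro mult_left_mono add_mono W_norm) auto
      finally have "Cq * norm ?d \<le> Cq * (\<eta> * (Cp * norm (u - u') + Cp * norm (v - v')))" using Cq by (rule mult_left_mono)
      then show ?thesis using V_nth'[of ?d i] by (simp add: algebra_simps)
    qed
    moreover have "n * \<epsilon> * norm (v - v') \<le> n * \<epsilon> * (norm (u - u') + norm (v - v'))"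
      using n \<epsilon> by (intro mult_left_mono) auto
    ultimately show ?thesis unfolding \<kappa>_def distrib_right by linarith
  qed
  \<comment> \<open>Rests on P \<Lambda> + P M = A P with \<Lambda> as a diagonal matrix, on P V w =
    w, and on the fact that the real matrix \<open>A\<close> commutes with taking real
    parts.\<close>
  have comb: "Re (\<Sum>i\<in>UNIV. P j i * (\<Lambda> i * v $ i + \<Phi> u v $ i)) = (A *v W v + g (W u) (W v)) $ j" for u v j
  proof -
    have "(\<Sum>i\<in>UNIV. P j i * (\<Lambda> i * v $ i + \<Phi> u v $ i)) =
        (\<Sum>i\<in>UNIV. P j i * \<Lambda> i * v $ i) + (\<Sum>i\<in>UNIV. \<Sum>k\<in>UNIV. P j i * M i k * v $ k) + (\<Sum>i\<in>UNIV. P j i * V (g (W u) (W v)) $ i)"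
      by (simp add: \<Phi>_def distrib_left sum.distrib sum_distrib_left mult.assoc)
    also have "(\<Sum>i\<in>UNIV. \<Sum>k\<in>UNIV. P j i * M i k * v $ k) = (\<Sum>k\<in>UNIV. \<Sum>i\<in>UNIV. P j i * M i k * v $ k)" by (rule sum.swap)
    also have "(\<Sum>i\<in>UNIV. P j i * \<Lambda> i * v $ i) + (\<Sum>k\<in>UNIV. \<Sum>i\<in>UNIV. P j i * M i k * v $ k) =
        (\<Sum>k\<in>UNIV. (P j k * \<Lambda> k + (\<Sum>i\<in>UNIV. P j i * M i k)) * v $ k)"
      by (simp only: sum.distrib[symmetric] distrib_right sum_distrib_right)
    also have "\<dots> = (\<Sum>k\<in>UNIV. \<Sum>m\<in>UNIV. of_real (A $ j $ m) * P m k * v $ k)"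
      by (simp only: AP[symmetric] sum_distrib_right)
    also have "\<dots> = (\<Sum>m\<in>UNIV. \<Sum>k\<in>UNIV. of_real (A $ j $ m) * P m k * v $ k)" by (rule sum.swap)
    also have "\<dots> = (\<Sum>m\<in>UNIV. of_real (A $ j $ m) * (\<Sum>k\<in>UNIV. P m k * v $ k))" by (simp add: sum_distrib_left mult.assoc)
    finally show ?thesis unfolding PV by (simp add: W_def matrix_vector_mult_def)
  qed
  define D where "D = 1 + (\<Sum>i\<in>UNIV. R i * cmod (\<Lambda> i))"
  have D: "0 < D" unfolding D_def by (intro add_pos_nonneg sum_nonneg mult_nonneg_nonneg R0) auto
  \<comment> \<open>In the new coordinates the history is bounded by \<open>Cq * \<delta>\<close>,
    and the fixed point theorem asks for this bound times \<open>D\<close> to be at most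
    \<open>\<rho> / 2\<close>.\<close>
  define \<delta> where "\<delta> = \<rho> / (2 * (Cq + 1) * D)"
  have \<delta>: "0 < \<delta>" using \<rho> Cq D by (simp add: \<delta>_def)
  have \<delta>D: "Cq * \<delta> * D \<le> \<rho> / 2"
  proof -
    have "Cq * \<delta> * D \<le> (Cq + 1) * \<delta> * D" using \<delta> D by (intro mult_right_mono) auto
    also have "\<dots> = \<rho> / 2"
    proof -
      have "E * (\<rho> / (2 * E * D)) * D = \<rho> / 2" if "E \<noteq> 0" for E using that D by (simp add: field_simps)
      from this[of "Cq + 1"] show ?thesis using Cq by (simp add: \<delta>_def)
    qed
    finally show ?thesis .
  qed
  have "\<exists>x. maximal_solution \<alpha> \<tau> A g \<phi> \<infinity> x \<and> (\<forall>t\<ge>0. norm (x t) \<le> e) \<and> (x \<longlongrightarrow> 0) at_top"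
    if \<phi>: "continuous_on {-\<tau>..0} \<phi>" "\<And>t. t \<in> {-\<tau>..0} \<Longrightarrow> norm (\<phi> t) \<le> \<delta>" for \<phi>
  proof -
    \<comment> \<open>Clamping the time extends the history to a continuous function on the whole
      line that is constant after 0, as the fixed point theorem requires.\<close>
    define c where "c = (\<lambda>t. max (- \<tau>) (min t 0))"
    have c: "c t \<in> {-\<tau>..0}" for t using \<tau> by (auto simp: c_def)
    have c_id: "c t = t" if "t \<in> {-\<tau>..0}" for t using that by (auto simp: c_def)
    have c_pos: "c t = 0" if "0 \<le> t" for t using that \<tau> by (auto simp: c_def)
    define \<psi> where "\<psi> = (\<lambda>t. V (\<phi> (c t)))"
    have "continuous_on UNIV (\<lambda>t. \<phi> (c t))"
      by (rule continuous_on_compose2[OF \<phi>(1)]) (use c in \<open>auto simp: c_def intro!: continuous_intros\<close>)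
    then have \<psi>1: "continuous_on UNIV \<psi>"
      unfolding \<psi>_def V_def by (intro continuous_on_vec_lambda continuous_intros)
    have \<psi>2: "norm (\<psi> t) \<le> Cq * \<delta>" for t
      unfolding \<psi>_def using V_norm[of "\<phi> (c t)"] mult_left_mono[OF \<phi>(2)[OF c] Cq] by (rule order_trans)
    have \<psi>3: "\<psi> t = \<psi> 0" if "0 \<le> t" for t using c_pos[OF that] c_pos[of 0] by (simp add: \<psi>_def)
    obtain y where yc: "continuous_on UNIV y" and yb: "\<And>t. norm (y t) \<le> \<rho>" and y0: "(y \<longlongrightarrow> 0) at_top"
      and yh: "\<And>t. t \<le> 0 \<Longrightarrow> y t = \<psi> t"
      and yeq: "\<And>t i. 0 \<le> t \<Longrightarrow> has_bochner_integral lborel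
       (\<lambda>s. indicator {0..} s *\<^sub>R (of_real (rl_kernel \<alpha> (t - s)) * (\<Lambda> i * y (s - \<tau>) $ i + \<Phi> (y s) (y (s - \<tau>)) $ i)))
       (y t $ i - \<psi> 0 $ i)"
    proof (rule perturbed_fixed_point[OF \<alpha> \<tau> \<Lambda> \<kappa>(1) \<kappa>(2)[unfolded R_def] \<rho> \<Phi>0 \<Phi>lip \<psi>1 \<psi>2 \<psi>3 \<delta>D[unfolded D_def R_def]])
      fix y
      assume h: "continuous_on UNIV y" "\<And>t. norm (y t) \<le> \<rho>" "(y \<longlongrightarrow> 0) at_top" "\<And>t. t \<le> 0 \<Longrightarrow> y t = \<psi> t"
        "\<And>t i. 0 \<le> t \<Longrightarrow> has_bochner_integral lborel
          (\<lambda>s. indicator {0..} s *\<^sub>R (of_real (rl_kernel \<alpha> (t - s)) * (\<Lambda> i * y (s - \<tau>) $ i + \<Phi> (y s) (y (s - \<tau>)) $ i)))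
          (y t $ i - \<psi> 0 $ i)"
      show thesis by (rule that[OF h])
    qed
    define x where "x = (\<lambda>t. W (y t))"
    have xc: "continuous_on X x" for X
      unfolding x_def by (rule continuous_on_compose2[OF W_cont[of UNIV] continuous_on_subset[OF yc]]) auto
    have xr: "norm (x t) < r" for t unfolding x_def by (rule W_small[OF yb])
    have xe: "norm (x t) \<le> e" for t
      using W_norm[of "y t"] mult_left_mono[OF yb[of t] Cp] Cp\<rho>(2) unfolding x_def by linarith
    have x0: "(x \<longlongrightarrow> 0) at_top"
      using isCont_tendsto_compose[OF _ y0, of W] W_cont[of UNIV] W0 unfolding x_def
      by (simp add: continuous_on_eq_continuous_at)
    have xh: "x t = \<phi> t" if "t \<in> {-\<tau>..0}" for t
      using yh[of t] that c_id[OF that] by (simp add: x_def \<psi>_def WV)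
    have x\<phi>: "W (\<psi> 0) = \<phi> 0" using c_pos[of 0] by (simp add: \<psi>_def WV)
    have sol: "solution_on \<alpha> \<tau> A g \<phi> T x" for T
    proof (rule solution_onI[OF \<alpha>(1) xc xh])
      fix t assume t: "t \<in> {0..T}"
      show "has_bochner_integral lborel (\<lambda>s. indicator {0..} s *\<^sub>R (rl_kernel \<alpha> (t - s) *\<^sub>R (A *v x (s - \<tau>) + g (x s) (x (s - \<tau>))))) (x t - \<phi> 0)"
      proof (rule has_bochner_integral_vec)
        fix j
        let ?b = "\<lambda>i s. \<Lambda> i * y (s - \<tau>) $ i + \<Phi> (y s) (y (s - \<tau>)) $ i"
        have "has_bochner_integral lborel (\<lambda>s. Re (\<Sum>i\<in>UNIV. P j i * (indicator {0..} s *\<^sub>R (of_real (rl_kernel \<alpha> (t - s)) * ?b i s))))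
           (Re (\<Sum>i\<in>UNIV. P j i * (y t $ i - \<psi> 0 $ i)))"
          by (intro has_bochner_integral_bounded_linear[OF bounded_linear_Re] has_bochner_integral_sum has_bochner_integral_mult_right yeq)
             (use t in auto)
        moreover have "Re (\<Sum>i\<in>UNIV. P j i * (y t $ i - \<psi> 0 $ i)) = (x t - \<phi> 0) $ j"
          unfolding x\<phi>[symmetric] x_def W_def by (simp add: right_diff_distrib sum_subtractf)
        moreover have "Re (\<Sum>i\<in>UNIV. P j i * (indicator {0..} s *\<^sub>R (of_real (rl_kernel \<alpha> (t - s)) * ?b i s))) =
            (indicator {0..} s *\<^sub>R (rl_kernel \<alpha> (t - s) *\<^sub>R (A *v x (s - \<tau>) + g (x s) (x (s - \<tau>))))) $ j" for s
        proof -
          have "(\<Sum>i\<in>UNIV. P j i * (indicator {0..} s *\<^sub>R (of_real (rl_kernel \<alpha> (t - s)) * ?b i s))) =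
             of_real (indicator {0..} s * rl_kernel \<alpha> (t - s)) * (\<Sum>i\<in>UNIV. P j i * ?b i s)"
            unfolding sum_distrib_left by (intro sum.cong refl) (simp add: scaleR_conv_of_real)
          then have "Re (\<Sum>i\<in>UNIV. P j i * (indicator {0..} s *\<^sub>R (of_real (rl_kernel \<alpha> (t - s)) * ?b i s))) =
             indicator {0..} s * rl_kernel \<alpha> (t - s) * Re (\<Sum>i\<in>UNIV. P j i * ?b i s)"
            by (simp only: Re_complex_of_real Im_complex_of_real times_complex.simps mult_zero_left diff_zero)
          then show ?thesis unfolding comb x_def by simp
        qed
        ultimately show "has_bochner_integral lborel (\<lambda>s. (indicator {0..} s *\<^sub>R (rl_kernel \<alpha> (t - s) *\<^sub>R (A *v x (s - \<tau>) + g (x s) (x (s - \<tau>))))) $ j) ((x t - \<phi> 0) $ j)"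
          by (simp only:)
      qed
    qed
    have "maximal_solution \<alpha> \<tau> A g \<phi> \<infinity> x"
      unfolding maximal_solution_def
    proof (intro conjI allI impI)
      show "\<forall>t\<in>{- \<tau>..T}. y' t = x t" if "0 < T" "solution_on \<alpha> \<tau> A g \<phi> T y'" for T y'
        by (rule solution_unique[OF \<alpha>(1) \<tau> that(1) less_imp_le[OF \<eta>(1)] glip sol xr that(2)])
    qed (auto intro: sol)
    then show ?thesis using xe x0 by blast
  qed
  then show ?thesis using \<delta> by blast
qed

section \<open>Transfer to the given norm\<close>

theorem theorem3p1:
  fixes N :: "real ^ 'd \<Rightarrow> real"
    and \<alpha> \<tau> :: real
    and A :: "real ^ 'd ^ 'd"
    and g :: "real ^ 'd \<Rightarrow> real ^ 'd \<Rightarrow> real ^ 'd"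
  assumes "is_norm N"
    and "0 < \<alpha>" and "\<alpha> < 1" and "0 < \<tau>"
    and "g 0 0 = 0"
    and "lipschitz_near_origin N g"
    and "((\<lambda>r. lipschitz_modulus N g r) \<longlongrightarrow> 0) (at_right 0)"
    and "\<forall>z. complex_eigenvalue A z \<longrightarrow> z \<in> stability_region \<alpha> \<tau>"
  shows "asymptotically_stable N \<alpha> \<tau> A g"
proof -
  obtain c1 c2 where c: "0 < c1" "0 < c2" and N1: "\<And>x. N x \<le> c1 * norm x" and N2: "\<And>x. norm x \<le> c2 * N x"
    using is_norm_equivalence[OF assms(1)] by blast
  have lip: "\<exists>r>0. \<forall>u v u' v'. norm u < r \<longrightarrow> norm v < r \<longrightarrow> norm u' < r \<longrightarrow> norm v' < r \<longrightarrow>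
      norm (g u v - g u' v') \<le> \<eta> * (norm (u - u') + norm (v - v'))" if \<eta>: "0 < \<eta>" for \<eta>
  proof -
    \<comment> \<open>Changing the norm on both sides of the Lipschitz estimate costs the factor
      \<open>c1 * c2\<close>; as the modulus tends to 0, it can be compensated in advance.\<close>
    have "0 < \<eta> / (c1 * c2)" using \<eta> c by simp
    then obtain r where r: "0 < r" and rl: "\<And>u v u' v'. N u < r \<Longrightarrow> N v < r \<Longrightarrow> N u' < r \<Longrightarrow> N v' < r \<Longrightarrow>
      N (g u v - g u' v') \<le> \<eta> / (c1 * c2) * (N (u - u') + N (v - v'))"
      using lipschitz_modulus_small[OF assms(1,7)] by blast
    have small: "N u < r" if "norm u < r / c1" for u
    proof -
      have "c1 * norm u < r" using that c by (simp add: field_simps)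
      then show ?thesis using N1[of u] by linarith
    qed
    have "norm (g u v - g u' v') \<le> \<eta> * (norm (u - u') + norm (v - v'))"
      if "norm u < r / c1" "norm v < r / c1" "norm u' < r / c1" "norm v' < r / c1" for u v u' v'
    proof -
      have "norm (g u v - g u' v') \<le> c2 * N (g u v - g u' v')" by (rule N2)
      also have "\<dots> \<le> c2 * (\<eta> / (c1 * c2) * (N (u - u') + N (v - v')))"
        using c by (intro mult_left_mono rl small that) auto
      also have "\<dots> \<le> c2 * (\<eta> / (c1 * c2) * (c1 * norm (u - u') + c1 * norm (v - v')))"
        using c \<eta> by (intro mult_left_mono add_mono N1) auto
      also have "\<dots> = \<eta> * (norm (u - u') + norm (v - v'))" using c by (simp add: field_simps)
      finally show ?thesis .
    qed
    then show ?thesis using r c by (intro exI[of _ "r / c1"]) auto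
  qed
  have main: "\<exists>\<delta>>0. \<forall>\<phi>. continuous_on {-\<tau>..0} \<phi> \<and> sup_norm N \<tau> \<phi> \<le> \<delta> \<longrightarrow>
      (\<exists>x. maximal_solution \<alpha> \<tau> A g \<phi> \<infinity> x \<and> (\<forall>t\<ge>0. N (x t) \<le> \<epsilon>) \<and> (x \<longlongrightarrow> 0) at_top)" if \<epsilon>: "0 < \<epsilon>" for \<epsilon>
  proof -
    have "0 < \<epsilon> / c1" using \<epsilon> c by simp
    then obtain \<delta> where \<delta>: "0 < \<delta>" and sol: "\<And>\<phi>. continuous_on {-\<tau>..0} \<phi> \<Longrightarrow> \<forall>t\<in>{-\<tau>..0}. norm (\<phi> t) \<le> \<delta> \<Longrightarrow>
        \<exists>x. maximal_solution \<alpha> \<tau> A g \<phi> \<infinity> x \<and> (\<forall>t\<ge>0. norm (x t) \<le> \<epsilon> / c1) \<and> (x \<longlongrightarrow> 0) at_top"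
      using small_solutions[OF assms(2,3,4,5) lip, of A "\<epsilon> / c1"] assms(8) by blast
    have "\<exists>x. maximal_solution \<alpha> \<tau> A g \<phi> \<infinity> x \<and> (\<forall>t\<ge>0. N (x t) \<le> \<epsilon>) \<and> (x \<longlongrightarrow> 0) at_top"
      if \<phi>: "continuous_on {-\<tau>..0} \<phi>" "sup_norm N \<tau> \<phi> \<le> \<delta> / c2" for \<phi>
    proof -
      \<comment> \<open>The supremum in \<open>sup_norm\<close> dominates the values only if they
        are bounded above, which continuity on the compact interval provides.\<close>
      have "bounded (\<phi> ` {-\<tau>..0})"
        by (intro compact_imp_bounded compact_continuous_image \<phi>(1)) auto
      then obtain B where B: "\<forall>v\<in>\<phi> ` {-\<tau>..0}. norm v \<le> B" unfolding bounded_iff by blast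
      have bdd: "bdd_above ((\<lambda>t. N (\<phi> t)) ` {-\<tau>..0})"
      proof (rule bdd_aboveI2)
        fix t assume "t \<in> {-\<tau>..0}"
        then have "c1 * norm (\<phi> t) \<le> c1 * B" using B c by (intro mult_left_mono) auto
        then show "N (\<phi> t) \<le> c1 * B" using N1[of "\<phi> t"] by linarith
      qed
      have "norm (\<phi> t) \<le> \<delta>" if t: "t \<in> {-\<tau>..0}" for t
      proof -
        have "N (\<phi> t) \<le> \<delta> / c2" using cSUP_upper[OF t bdd] \<phi>(2) unfolding sup_norm_def by (rule order_trans)
        then have "c2 * N (\<phi> t) \<le> \<delta>" using c by (simp add: field_simps)
        then show ?thesis using N2[of "\<phi> t"] by linarith
      qed
      then obtain x where x: "maximal_solution \<alpha> \<tau> A g \<phi> \<infinity> x" "\<forall>t\<ge>0. norm (x t) \<le> \<epsilon> / c1" "(x \<longlongrightarrow> 0) at_top"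
        using sol[OF \<phi>(1)] by blast
      have "N (x t) \<le> \<epsilon>" if "0 \<le> t" for t
      proof -
        have "c1 * norm (x t) \<le> \<epsilon>" using x(2) that c by (simp add: field_simps)
        then show ?thesis using N1[of "x t"] by linarith
      qed
      then show ?thesis using x by blast
    qed
    then show ?thesis using \<delta> c by (intro exI[of _ "\<delta> / c2"]) auto
  qed
  have "stable N \<alpha> \<tau> A g" unfolding stable_def using main by meson
  moreover have "\<exists>\<delta>>0. \<forall>\<phi>. continuous_on {-\<tau>..0} \<phi> \<and> sup_norm N \<tau> \<phi> \<le> \<delta> \<longrightarrow>
      (\<exists>x. maximal_solution \<alpha> \<tau> A g \<phi> \<infinity> x \<and> (x \<longlongrightarrow> 0) at_top)"
  proof -
    \<comment> \<open>For attraction any bound on the solution will do; 1 is arbitrary.\<close>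
    have "0 < (1 :: real)" by simp
    from main[OF this] show ?thesis by blast
  qed
  ultimately show ?thesis by (simp add: asymptotically_stable_def)
qed

end
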